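(* Let $\mathcal{D}$ be a set. The graded dual of the Hopf algebra $(\mathit{CP}(\mathcal{D}),\cdot,\Delta)$ is the enveloping algebra of a preLie algebra $\mathfrak{g}_{\mathit{CP}}(\mathcal{D})$, described as follows. The preLie algebra $\mathfrak{g}_{\mathit{CP}}(\mathcal{D})$ is the linear span of $\mathcal{PT}_1(\mathcal{D})$, and for any $T,T'\in\mathcal{PT}_1(\mathcal{D})$ the preLie product is given by $$T\diamond T'=\sum_{\substack{s\in V(T),\\ b\in\mathcal{B}l(s)\sqcup\{*\}}}T\bullet_{s,b}T'.$$
   Context: $\mathbb{K}$ is a field of characteristic zero. A (right) preLie algebra is a vector space with a bilinear product $\diamond$ such that $(a\diamond b)\diamond c-a\diamond(b\diamond c)=(a\diamond c)\diamond b-a\diamond(c\diamond b)$; its enveloping algebra is that of the Lie algebra with bracket $[a,b]=a\diamond b-b\diamond a$. A partitioned forest is a rooted forest $F$ with vertex set $V(F)$, edges oriented from the roots to the leaves, together with a partition of $V(F)$ into blocks such that two vertices in the same block are either both roots or have the same parent. It is a partitioned tree if all its roots lie in one block; the empty forest $\emptyset$ is a partitioned tree. $\mathcal{PT}(\mathcal{D})$ is the set of isomorphism classes of partitioned trees (including $\emptyset$) with vertices decorated by $\mathcal{D}$, and $\mathcal{PT}_1(\mathcal{D})$ is the subset of those with exactly one root. $\mathit{CP}(\mathcal{D})$ is the vector space with basis $\mathcal{PT}(\mathcal{D})$. $T\cdot T'$ is the disjoint union with the two blocks of roots merged into one block; the unit is $\emptyset$. The coproduct is $\Delta(T)=\sum_I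 R^I(T)\otimes P^I(T)$ over all ideals $I$ of $T$ (subsets $I\subseteq V(T)$ such that if $v\in I$ and there is an edge from $v$ to $w$ then $w\in I$); $R^I(T)$ is the restriction of $T$ to $V(T)\setminus I$, and $P^I(T)$ is the product $\cdot$ of the partitioned trees of the restriction of $T$ to $I$ (so all its roots are put in a single block). As a commutative algebra, $\mathit{CP}(\mathcal{D})$ is freely generated by $\mathcal{PT}_1(\mathcal{D})$, and $\Delta(T)-\emptyset\otimes T\in\mathrm{Vect}(\mathcal{PT}_1(\mathcal{D}))\otimes\mathit{CP}(\mathcal{D})$ for $T\in\mathcal{PT}_1(\mathcal{D})$, that is, it is a right-sided combinatorial bialgebra in the sense of Loday and Ronco; it is for this reason that its graded dual is the enveloping algebra of a preLie algebra, denoted $\mathfrak{g}_{\mathit{CP}}(\mathcal{D})$. Throughout, $\mathit{CP}(\mathcal{D})$ is identified with its graded dual by considering the basis of partitioned trees as orthonormal. For a vertex $s$ of $T$, $\mathcal{B}l(s)$ is the set of blocks of $T$ consisting of children of $s$. For $b\in\mathcal{B}l(s)\sqcup\{*\}$, $T\bullet_{s,b}T'$ is the partitioned tree obtained by adding edges from $s$ to every root of $T'$ and, if $b\in\mathcal{B}l(s)$, merging the block $b$ with the block of roots of $T'$ (if $b=*$, no blocks are merged).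
   Formalization: A tree T with one root is identified with |Aut T| times its dual basis element, not with the dual basis element itself, because the displayed preLie product fails when partitioned trees are taken as orthonormal. *)

theory Defs
  imports
    Complex_Main
    "HOL-Library.Disjoint_Sets"
    "HOL-Library.Poly_Mapping"
    "HOL-Library.Function_Algebras"
    "HOL-Combinatorics.Permutations"
begin

section \<open>Partitioned forests and trees\<close>

record ('v, 'd) pforest =
  verts :: "'v set"
  edges :: "('v \<times> 'v) set"
  blocks :: "'v set set"
  dec :: "'v \<Rightarrow> 'd"

text \<open>An edge \<open>(u, v)\<close> goes from the parent \<open>u\<close> to the child \<open>v\<close>. The values of
  \<open>dec\<close> outside \<open>verts\<close> are irrelevant: isomorphisms do not see them.\<close>

definition roots :: "('v, 'd) pforest \<Rightarrow> 'v set" where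
  "roots F = {v \<in> verts F. \<nexists>u. (u, v) \<in> edges F}"

definition rooted_forest :: "('v, 'd) pforest \<Rightarrow> bool" where
  "rooted_forest F \<longleftrightarrow>
     finite (verts F) \<and> edges F \<subseteq> verts F \<times> verts F \<and>
     (\<forall>u u' v. (u, v) \<in> edges F \<and> (u', v) \<in> edges F \<longrightarrow> u = u') \<and>
     acyclic (edges F)"

definition part_forest :: "('v, 'd) pforest \<Rightarrow> bool" where
  "part_forest F \<longleftrightarrow>
     rooted_forest F \<and> partition_on (verts F) (blocks F) \<and>
     (\<forall>B\<in>blocks F. \<forall>v\<in>B. \<forall>w\<in>B.
        (v \<in> roots F \<and> w \<in> roots F) \<or> (\<exists>u. (u, v) \<in> edges F \<and> (u, w) \<in> edges F))"

definition part_tree :: "('v, 'd) pforest \<Rightarrow> bool" where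
  "part_tree F \<longleftrightarrow> part_forest F \<and> (roots F = {} \<or> (\<exists>B\<in>blocks F. roots F \<subseteq> B))"

definition pf_iso :: "('v \<Rightarrow> 'w) \<Rightarrow> ('v, 'd) pforest \<Rightarrow> ('w, 'd) pforest \<Rightarrow> bool" where
  "pf_iso \<phi> F G \<longleftrightarrow>
     bij_betw \<phi> (verts F) (verts G) \<and>
     (\<forall>u\<in>verts F. \<forall>v\<in>verts F. (u, v) \<in> edges F \<longleftrightarrow> (\<phi> u, \<phi> v) \<in> edges G) \<and>
     blocks G = (\<lambda>B. \<phi> ` B) ` blocks F \<and>
     (\<forall>v\<in>verts F. dec G (\<phi> v) = dec F v)"

definition pf_isomorphic :: "('v, 'd) pforest \<Rightarrow> ('w, 'd) pforest \<Rightarrow> bool" where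
  "pf_isomorphic F G \<longleftrightarrow> (\<exists>\<phi>. pf_iso \<phi> F G)"

definition empty_forest :: "('v, 'd) pforest" where
  "empty_forest = \<lparr>verts = {}, edges = {}, blocks = {}, dec = (\<lambda>_. undefined)\<rparr>"

lemma part_tree_empty_forest: "part_tree empty_forest"
  by (auto simp: part_tree_def part_forest_def rooted_forest_def empty_forest_def roots_def
      partition_on_def acyclic_def disjoint_def)

lemma pf_iso_refl:
  assumes "part_tree F" shows "pf_iso id F F"
  by (auto simp: pf_iso_def)

lemma pf_iso_trans:
  assumes "part_tree F" and FG: "pf_iso \<phi> F G" and GH: "pf_iso \<psi> G H"
  shows "pf_iso (\<psi> \<circ> \<phi>) F H"
proof -
  have b: "bij_betw \<phi> (verts F) (verts G)" using FG by (simp add: pf_iso_def)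
  hence mem: "\<And>v. v \<in> verts F \<Longrightarrow> \<phi> v \<in> verts G" by (auto simp: bij_betw_def)
  have "blocks H = (\<lambda>B. (\<psi> \<circ> \<phi>) ` B) ` blocks F"
    using FG GH by (simp add: pf_iso_def image_image image_comp)
  moreover have "bij_betw (\<psi> \<circ> \<phi>) (verts F) (verts H)"
    using b GH bij_betw_trans by (auto simp: pf_iso_def)
  ultimately show ?thesis using FG GH mem by (simp add: pf_iso_def)
qed

lemma pf_iso_sym:
  assumes F: "part_tree F" and FG: "pf_iso \<phi> F G"
  shows "pf_iso (inv_into (verts F) \<phi>) G F"
proof -
  let ?inv = "inv_into (verts F) \<phi>"
  have b: "bij_betw \<phi> (verts F) (verts G)" using FG by (simp add: pf_iso_def)
  have inj: "inj_on \<phi> (verts F)" and img: "\<phi> ` verts F = verts G"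
    using b by (auto simp: bij_betw_def)
  have inv_in: "\<And>v. v \<in> verts G \<Longrightarrow> ?inv v \<in> verts F \<and> \<phi> (?inv v) = v"
    using img by (metis f_inv_into_f inv_into_into)
  have sub: "\<And>B. B \<in> blocks F \<Longrightarrow> B \<subseteq> verts F"
    using F by (auto simp: part_tree_def part_forest_def partition_on_def)
  have "(\<lambda>B. ?inv ` B) ` blocks G = (\<lambda>B. B) ` blocks F"
    unfolding FG[unfolded pf_iso_def, THEN conjunct2, THEN conjunct2, THEN conjunct1] image_image
    using sub inj by (intro image_cong) (auto simp: subset_iff image_iff)
  thus ?thesis using FG inv_in bij_betw_inv_into[OF b]
    unfolding pf_iso_def by (metis image_ident)
qed

quotient_type 'd ptree = "(nat, 'd) pforest" / partial:
  "\<lambda>F G. part_tree F \<and> part_tree G \<and> pf_isomorphic F G"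
proof (rule part_equivpI)
  show "\<exists>F::(nat, 'd) pforest. part_tree F \<and> part_tree F \<and> pf_isomorphic F F"
    using part_tree_empty_forest pf_iso_refl pf_isomorphic_def by blast
  show "symp (\<lambda>(F::(nat, 'd) pforest) G::(nat, 'd) pforest.
      part_tree F \<and> part_tree G \<and> pf_isomorphic F G)"
    by (auto intro!: sympI simp: pf_isomorphic_def dest: pf_iso_sym)
  show "transp (\<lambda>(F::(nat, 'd) pforest) G::(nat, 'd) pforest.
      part_tree F \<and> part_tree G \<and> pf_isomorphic F G)"
    unfolding transp_def pf_isomorphic_def by (blast intro: pf_iso_trans)
qed

text \<open>The isomorphism class of a partitioned tree on any vertex type (it always has an
  isomorphic copy with vertices in \<open>nat\<close>).\<close>

definition ptree_class :: "('v, 'd) pforest \<Rightarrow> 'd ptree" where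
  "ptree_class F = abs_ptree (SOME G. part_tree G \<and> pf_isomorphic F G)"

definition empty_ptree :: "'d ptree" where
  "empty_ptree = ptree_class (empty_forest :: (nat, 'd) pforest)"

definition PT :: "'d set \<Rightarrow> 'd ptree set" where
  "PT D = {T. dec (rep_ptree T) ` verts (rep_ptree T) \<subseteq> D}"

definition PT1 :: "'d set \<Rightarrow> 'd ptree set" where
  "PT1 D = {T \<in> PT D. card (roots (rep_ptree T)) = 1}"

text \<open>The order of the automorphism group.\<close>

definition sym_factor :: "'d ptree \<Rightarrow> nat" where
  "sym_factor T = card {\<phi>. \<phi> permutes verts (rep_ptree T) \<and> pf_iso \<phi> (rep_ptree T) (rep_ptree T)}"

definition disj_union :: "('v, 'd) pforest \<Rightarrow> ('w, 'd) pforest \<Rightarrow> ('v + 'w, 'd) pforest" where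
  "disj_union F G =
     \<lparr>verts = verts F <+> verts G,
      edges = map_prod Inl Inl ` edges F \<union> map_prod Inr Inr ` edges G,
      blocks = (\<lambda>B. Inl ` B) ` blocks F \<union> (\<lambda>B. Inr ` B) ` blocks G,
      dec = case_sum (dec F) (dec G)\<rparr>"

definition merge_roots :: "('v, 'd) pforest \<Rightarrow> ('v, 'd) pforest" where
  "merge_roots F =
     F\<lparr>blocks := {B \<in> blocks F. \<not> B \<subseteq> roots F} \<union> (if roots F = {} then {} else {roots F})\<rparr>"

definition restrict_forest :: "('v, 'd) pforest \<Rightarrow> 'v set \<Rightarrow> ('v, 'd) pforest" where
  "restrict_forest F W =
     \<lparr>verts = verts F \<inter> W,
      edges = edges F \<inter> W \<times> W,
      blocks = (\<lambda>B. B \<inter> W) ` blocks F - {{}},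
      dec = dec F\<rparr>"

definition ideals :: "('v, 'd) pforest \<Rightarrow> 'v set set" where
  "ideals F = {I. I \<subseteq> verts F \<and> (\<forall>v w. v \<in> I \<and> (v, w) \<in> edges F \<longrightarrow> w \<in> I)}"

definition child_blocks :: "('v, 'd) pforest \<Rightarrow> 'v \<Rightarrow> 'v set set" where
  "child_blocks F s = {B \<in> blocks F. \<forall>v\<in>B. (s, v) \<in> edges F}"

text \<open>The grafting \<open>F \<bullet>\<^sub>s\<^sub>,\<^sub>b G\<close>; \<open>None\<close> stands for \<open>b = *\<close>.\<close>

definition graft :: "('v, 'd) pforest \<Rightarrow> 'v \<Rightarrow> 'v set option \<Rightarrow> ('w, 'd) pforest
    \<Rightarrow> ('v + 'w, 'd) pforest" where
  "graft F s b G =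
     (let U = disj_union F G; R = Inr ` roots G in
      U\<lparr>edges := edges U \<union> {Inl s} \<times> R,
        blocks := (case b of
            None \<Rightarrow> blocks U
          | Some B \<Rightarrow> (blocks U - {Inl ` B, R}) \<union> {Inl ` B \<union> R})\<rparr>)"


section \<open>The bialgebra of partitioned trees\<close>

text \<open>\<open>'a \<Rightarrow>\<^sub>0 'k\<close> is the vector space with basis \<open>'a\<close>. Tensor products of spaces with bases
  \<open>'a\<close> and \<open>'b\<close> are spaces with basis \<open>'a \<times> 'b\<close>.\<close>

definition pscale :: "'k::field \<Rightarrow> ('a \<Rightarrow>\<^sub>0 'k) \<Rightarrow> ('a \<Rightarrow>\<^sub>0 'k)" where
  "pscale c x = Poly_Mapping.map (\<lambda>y. c * y) x"

definition lin_ext :: "('a \<Rightarrow> ('b \<Rightarrow>\<^sub>0 'k::field)) \<Rightarrow> ('a \<Rightarrow>\<^sub>0 'k) \<Rightarrow> ('b \<Rightarrow>\<^sub>0 'k)" where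
  "lin_ext m x = (\<Sum>a\<in>Poly_Mapping.keys x. pscale (Poly_Mapping.lookup x a) (m a))"

definition bilin_ext :: "('a \<Rightarrow> 'b \<Rightarrow> ('c \<Rightarrow>\<^sub>0 'k::field))
    \<Rightarrow> ('a \<Rightarrow>\<^sub>0 'k) \<Rightarrow> ('b \<Rightarrow>\<^sub>0 'k) \<Rightarrow> ('c \<Rightarrow>\<^sub>0 'k)" where
  "bilin_ext m x y = (\<Sum>a\<in>Poly_Mapping.keys x. \<Sum>b\<in>Poly_Mapping.keys y. pscale (Poly_Mapping.lookup x a * Poly_Mapping.lookup y b) (m a b))"

definition evaluate :: "('a \<Rightarrow> 'k::field) \<Rightarrow> ('a \<Rightarrow>\<^sub>0 'k) \<Rightarrow> 'k" where
  "evaluate f x = (\<Sum>a\<in>Poly_Mapping.keys x. Poly_Mapping.lookup x a * f a)"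

definition CP_mult :: "('d ptree \<Rightarrow>\<^sub>0 'k::field) \<Rightarrow> ('d ptree \<Rightarrow>\<^sub>0 'k) \<Rightarrow> ('d ptree \<Rightarrow>\<^sub>0 'k)" where
  "CP_mult = bilin_ext (\<lambda>T T'. Poly_Mapping.single
     (ptree_class (merge_roots (disj_union (rep_ptree T) (rep_ptree T')))) 1)"

definition CP_unit :: "'d ptree \<Rightarrow>\<^sub>0 'k::field" where
  "CP_unit = Poly_Mapping.single empty_ptree 1"

definition CP_comult :: "('d ptree \<Rightarrow>\<^sub>0 'k::field) \<Rightarrow> ('d ptree \<times> 'd ptree \<Rightarrow>\<^sub>0 'k)" where
  "CP_comult = lin_ext (\<lambda>T. let F = rep_ptree T in
     \<Sum>I\<in>ideals F. Poly_Mapping.single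
       (ptree_class (restrict_forest F (verts F - I)),
        ptree_class (merge_roots (restrict_forest F I))) 1)"

definition CP_counit :: "('d ptree \<Rightarrow>\<^sub>0 'k::field) \<Rightarrow> 'k" where
  "CP_counit = evaluate (\<lambda>T. if T = empty_ptree then 1 else 0)"


section \<open>The graded dual\<close>

text \<open>A function \<open>f :: 'd ptree \<Rightarrow> 'k\<close> is identified with the linear form on the space of
  partitioned trees taking these values on the basis. For infinite \<open>D\<close>, grading by the number
  of vertices alone would give infinite-dimensional components; the graded dual is meant with
  respect to the grading by the multiset of decorations, and is the span of the dual basis.\<close>

definition fin_supp_on :: "'a set \<Rightarrow> ('a \<Rightarrow> 'k::zero) set" where
  "fin_supp_on X = {f. finite {a. f a \<noteq> 0} \<and> {a. f a \<noteq> 0} \<subseteq> X}"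

definition fscale :: "'k::field \<Rightarrow> ('a \<Rightarrow> 'k) \<Rightarrow> ('a \<Rightarrow> 'k)" where
  "fscale c f = (\<lambda>a. c * f a)"

definition tens :: "('a \<Rightarrow> 'k::field) \<Rightarrow> ('b \<Rightarrow> 'k) \<Rightarrow> ('a \<times> 'b \<Rightarrow> 'k)" where
  "tens f g = (\<lambda>(a, b). f a * g b)"

definition CP_dual :: "'d set \<Rightarrow> ('d ptree \<Rightarrow> 'k::field) set" where
  "CP_dual D = fin_supp_on (PT D)"

definition dual_mult :: "('d ptree \<Rightarrow> 'k::field) \<Rightarrow> ('d ptree \<Rightarrow> 'k) \<Rightarrow> ('d ptree \<Rightarrow> 'k)" where
  "dual_mult f g = (\<lambda>T. evaluate (tens f g) (CP_comult (Poly_Mapping.single T 1)))"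

definition dual_unit :: "'d ptree \<Rightarrow> 'k::field" where
  "dual_unit = (\<lambda>T. CP_counit (Poly_Mapping.single T 1))"

definition dual_comult :: "('d ptree \<Rightarrow> 'k::field) \<Rightarrow> ('d ptree \<times> 'd ptree \<Rightarrow> 'k)" where
  "dual_comult f = (\<lambda>(T, T').
     evaluate f (CP_mult (Poly_Mapping.single T 1) (Poly_Mapping.single T' 1)))"

definition dual_counit :: "('d ptree \<Rightarrow> 'k::field) \<Rightarrow> 'k" where
  "dual_counit f = evaluate f CP_unit"

definition delta :: "'a \<Rightarrow> 'a \<Rightarrow> 'k::field" where
  "delta a = (\<lambda>b. if b = a then 1 else 0)"

text \<open>The product \<open>(f \<otimes> f')(g \<otimes> g') = fg \<otimes> f'g'\<close>, extended bilinearly to finitely supported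
  functions on pairs.\<close>

definition tens_mult :: "(('a \<Rightarrow> 'k::field) \<Rightarrow> ('a \<Rightarrow> 'k) \<Rightarrow> ('a \<Rightarrow> 'k))
    \<Rightarrow> ('a \<times> 'a \<Rightarrow> 'k) \<Rightarrow> ('a \<times> 'a \<Rightarrow> 'k) \<Rightarrow> ('a \<times> 'a \<Rightarrow> 'k)" where
  "tens_mult m X Y =
     (\<Sum>(a, a')\<in>{p. X p \<noteq> 0}. \<Sum>(b, b')\<in>{q. Y q \<noteq> 0}.
        fscale (X (a, a') * Y (b, b')) (tens (m (delta a) (delta b)) (m (delta a') (delta b'))))"


section \<open>PreLie algebras and enveloping algebras\<close>

text \<open>Algebraic structures live on a subspace \<open>A\<close> of an ambient vector space.\<close>

definition linear_on :: "'a set \<Rightarrow> ('k \<Rightarrow> 'a \<Rightarrow> 'a) \<Rightarrow> ('k \<Rightarrow> 'b \<Rightarrow> 'b)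
    \<Rightarrow> ('a::ab_group_add \<Rightarrow> 'b::ab_group_add) \<Rightarrow> bool" where
  "linear_on A sA sB f \<longleftrightarrow>
     (\<forall>x\<in>A. \<forall>y\<in>A. f (x + y) = f x + f y) \<and> (\<forall>c. \<forall>x\<in>A. f (sA c x) = sB c (f x))"

locale bilinear_product = vector_space scl
  for scl :: "'k::field \<Rightarrow> 'a::ab_group_add \<Rightarrow> 'a" +
  fixes A :: "'a set" and mul :: "'a \<Rightarrow> 'a \<Rightarrow> 'a"
  assumes carrier_subspace: "subspace A"
    and mul_closed: "x \<in> A \<Longrightarrow> y \<in> A \<Longrightarrow> mul x y \<in> A"
    and mul_linear_left: "y \<in> A \<Longrightarrow> linear_on A scl scl (\<lambda>x. mul x y)"
    and mul_linear_right: "x \<in> A \<Longrightarrow> linear_on A scl scl (\<lambda>y. mul x y)"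

locale prelie_algebra = bilinear_product scl A mul
  for scl :: "'k::field \<Rightarrow> 'a::ab_group_add \<Rightarrow> 'a" and A :: "'a set" and mul +
  assumes right_prelie: "x \<in> A \<Longrightarrow> y \<in> A \<Longrightarrow> z \<in> A \<Longrightarrow>
    mul (mul x y) z - mul x (mul y z) = mul (mul x z) y - mul x (mul z y)"

locale unital_algebra = bilinear_product scl A mul
  for scl :: "'k::field \<Rightarrow> 'a::ab_group_add \<Rightarrow> 'a" and A :: "'a set" and mul +
  fixes e :: 'a
  assumes unit_closed: "e \<in> A"
    and unit_left: "x \<in> A \<Longrightarrow> mul e x = x"
    and unit_right: "x \<in> A \<Longrightarrow> mul x e = x"
    and mul_assoc: "x \<in> A \<Longrightarrow> y \<in> A \<Longrightarrow> z \<in> A \<Longrightarrow> mul (mul x y) z = mul x (mul y z)"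

definition alg_hom :: "('k \<Rightarrow> 'a \<Rightarrow> 'a) \<Rightarrow> 'a set \<Rightarrow> ('a \<Rightarrow> 'a \<Rightarrow> 'a) \<Rightarrow> 'a
    \<Rightarrow> ('k \<Rightarrow> 'b \<Rightarrow> 'b) \<Rightarrow> 'b set \<Rightarrow> ('b \<Rightarrow> 'b \<Rightarrow> 'b) \<Rightarrow> 'b
    \<Rightarrow> ('a::ab_group_add \<Rightarrow> 'b::ab_group_add) \<Rightarrow> bool" where
  "alg_hom sA A mA eA sB B mB eB F \<longleftrightarrow>
     linear_on A sA sB F \<and> (\<forall>x\<in>A. F x \<in> B) \<and>
     (\<forall>x\<in>A. \<forall>y\<in>A. F (mA x y) = mB (F x) (F y)) \<and> F eA = eB"

definition commutator :: "('a \<Rightarrow> 'a \<Rightarrow> 'a) \<Rightarrow> 'a \<Rightarrow> 'a \<Rightarrow> 'a::ab_group_add" where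
  "commutator m x y = m x y - m y x"

definition lie_hom :: "('k \<Rightarrow> 'a \<Rightarrow> 'a) \<Rightarrow> 'a set \<Rightarrow> ('a \<Rightarrow> 'a \<Rightarrow> 'a)
    \<Rightarrow> ('k \<Rightarrow> 'b \<Rightarrow> 'b) \<Rightarrow> 'b set \<Rightarrow> ('b \<Rightarrow> 'b \<Rightarrow> 'b)
    \<Rightarrow> ('a::ab_group_add \<Rightarrow> 'b::ab_group_add) \<Rightarrow> bool" where
  "lie_hom sG G brG sH H brH f \<longleftrightarrow>
     linear_on G sG sH f \<and> (\<forall>x\<in>G. f x \<in> H) \<and>
     (\<forall>x\<in>G. \<forall>y\<in>G. f (brG x y) = brH (f x) (f y))"

text \<open>The universal property of the enveloping algebra \<open>\<iota> : G \<rightarrow> A\<close> of a Lie algebra, with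
  respect to all unital associative algebras on the type \<open>'b\<close>. In a theorem \<open>'b\<close> must be left
  a type variable, so that all algebras are covered.\<close>

definition enveloping_algebra :: "'b::ab_group_add itself
    \<Rightarrow> ('k::field \<Rightarrow> 'g::ab_group_add \<Rightarrow> 'g) \<Rightarrow> 'g set \<Rightarrow> ('g \<Rightarrow> 'g \<Rightarrow> 'g)
    \<Rightarrow> ('k \<Rightarrow> 'a::ab_group_add \<Rightarrow> 'a) \<Rightarrow> 'a set \<Rightarrow> ('a \<Rightarrow> 'a \<Rightarrow> 'a) \<Rightarrow> 'a
    \<Rightarrow> ('g \<Rightarrow> 'a) \<Rightarrow> bool" where
  "enveloping_algebra _ sG G br sA A mA eA \<iota> \<longleftrightarrow>
     unital_algebra sA A mA eA \<and>
     lie_hom sG G br sA A (commutator mA) \<iota> \<and>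
     (\<forall>sB (B :: 'b set) mB eB f.
        unital_algebra sB B mB eB \<and> lie_hom sG G br sB B (commutator mB) f \<longrightarrow>
        (\<exists>F. alg_hom sA A mA eA sB B mB eB F \<and> (\<forall>x\<in>G. F (\<iota> x) = f x) \<and>
           (\<forall>F'. alg_hom sA A mA eA sB B mB eB F' \<and> (\<forall>x\<in>G. F' (\<iota> x) = f x) \<longrightarrow>
              (\<forall>a\<in>A. F' a = F a))))"

text \<open>The Hopf algebra structure of an enveloping algebra consists of the algebra morphisms
  \<open>comul : A \<rightarrow> A \<otimes> A\<close> and \<open>counit : A \<rightarrow> K\<close> for which the elements of the Lie algebra are
  primitive. It is stated for \<open>A\<close> the space of finitely supported functions on \<open>X\<close>, so that
  \<open>A \<otimes> A\<close> is the space of finitely supported functions on \<open>X \<times> X\<close>.\<close>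

definition enveloping_hopf_algebra :: "'b::ab_group_add itself
    \<Rightarrow> ('k::field \<Rightarrow> 'g::ab_group_add \<Rightarrow> 'g) \<Rightarrow> 'g set \<Rightarrow> ('g \<Rightarrow> 'g \<Rightarrow> 'g)
    \<Rightarrow> 'x set \<Rightarrow> (('x \<Rightarrow> 'k) \<Rightarrow> ('x \<Rightarrow> 'k) \<Rightarrow> ('x \<Rightarrow> 'k)) \<Rightarrow> ('x \<Rightarrow> 'k)
    \<Rightarrow> (('x \<Rightarrow> 'k) \<Rightarrow> ('x \<times> 'x \<Rightarrow> 'k)) \<Rightarrow> (('x \<Rightarrow> 'k) \<Rightarrow> 'k)
    \<Rightarrow> ('g \<Rightarrow> ('x \<Rightarrow> 'k)) \<Rightarrow> bool" where
  "enveloping_hopf_algebra TB sG G br X m e comul counit \<iota> \<longleftrightarrow>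
     enveloping_algebra TB sG G br fscale (fin_supp_on X) m e \<iota> \<and>
     alg_hom fscale (fin_supp_on X) m e
       fscale (fin_supp_on (X \<times> X)) (tens_mult m) (tens e e) comul \<and>
     alg_hom fscale (fin_supp_on X) m e (*) UNIV (*) 1 counit \<and>
     (\<forall>x\<in>G. comul (\<iota> x) = tens (\<iota> x) e + tens e (\<iota> x) \<and> counit (\<iota> x) = 0)"


section \<open>The preLie algebra of partitioned trees\<close>

definition gCP :: "'d set \<Rightarrow> ('d ptree \<Rightarrow>\<^sub>0 'k::field) set" where
  "gCP D = module.span pscale ((\<lambda>T. Poly_Mapping.single T 1) ` PT1 D)"

definition gCP_prod :: "('d ptree \<Rightarrow>\<^sub>0 'k::field) \<Rightarrow> ('d ptree \<Rightarrow>\<^sub>0 'k) \<Rightarrow> ('d ptree \<Rightarrow>\<^sub>0 'k)" where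
  "gCP_prod = bilin_ext (\<lambda>T T'. let F = rep_ptree T; G = rep_ptree T' in
     \<Sum>s\<in>verts F. \<Sum>b\<in>insert None (Some ` child_blocks F s).
       Poly_Mapping.single (ptree_class (graft F s b G)) 1)"

text \<open>The embedding of the preLie algebra in the graded dual. A tree \<open>T\<close> is identified with
  the linear form \<open>T' \<mapsto> |Aut T| \<delta>\<^sub>T\<^sub>,\<^sub>T\<^sub>'\<close>. The factor cannot be omitted: if \<open>T\<close> is the tree with two
  vertices and \<open>T'\<close> the one with a single vertex (one decoration), two ideals of the tree formed
  by a root and one block of two leaves give \<open>T \<otimes> T'\<close>, whereas only one grafting of \<open>T'\<close> on \<open>T\<close>
  gives this tree.\<close>

definition gCP_embed :: "('d ptree \<Rightarrow>\<^sub>0 'k::field) \<Rightarrow> ('d ptree \<Rightarrow> 'k)" where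
  "gCP_embed x = (\<lambda>T. of_nat (sym_factor T) * Poly_Mapping.lookup x T)"

end

theory Submission
  imports Defs
begin

text \<open>
  Dually to the coproduct, \<open>(f * g)(T)\<close> is the sum of \<open>f(R\<^sup>I(T)) g(P\<^sup>I(T))\<close> over the ideals \<open>I\<close> of
  \<open>T\<close>. If \<open>P\<^sup>I(T)\<close> is a tree \<open>x\<close> with one root, then either \<open>I\<close> is a connected component, so
  that \<open>T = R\<^sup>I(T) \<cdot> x\<close>, or \<open>R\<^sup>I(T)\<close> has as many roots as \<open>T\<close>. Hence, for the dual basis,
  \<open>a * x\<close> is a nonzero multiple of \<open>a \<cdot> x\<close> up to trees with at most as many roots as \<open>a\<close>, and
  the brackets of trees with one root are combinations of such trees. A Lie algebra morphism \<open>f\<close>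
  extends to the dual by induction on the number of roots: its value at \<open>a \<cdot> x\<close> is forced by its value
  at \<open>a * x\<close>, and does not depend on the decomposition because
  \<open>(c * y) * x - (c * x) * y = c * [y, x]\<close>.

  A grafting \<open>T \<bullet>\<^sub>s\<^sub>,\<^sub>b T'\<close> with an isomorphism to \<open>H\<close> amounts to an ideal \<open>I\<close> of \<open>H\<close> with
  isomorphisms from \<open>T\<close> to \<open>R\<^sup>I(H)\<close> and from \<open>T'\<close> to \<open>P\<^sup>I(H)\<close>; so, up to orders of automorphism
  groups, the preLie product is the part of \<open>*\<close> with one root. The preLie identity is the one-root
  part of associativity: the bracket has no part with two roots, so the two-root part of \<open>y * z\<close> is
  symmetric in \<open>y\<close> and \<open>z\<close>.
\<close>

section \<open>Finitely supported functions\<close>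

text \<open>A tree with n roots has up to n decompositions \<open>a \<cdot> x\<close>, so the value
  forced at it by one of them has to be compared with those forced by the others. Two distinct
  decompositions single out two different components and have a common remainder \<open>c\<close>;
  hence the one relation with [y, x] settles all comparisons, and no ordering of the trees is
  chosen. The leading coefficients are never computed: they count ideals, so they are nonzero in
  characteristic zero, and the relation between them that the comparison requires is read off by
  evaluating the same identity at the common tree. The automorphism orders come from counting
  isomorphisms instead of classes: each number of isomorphisms between two trees is 0 or an
  automorphism order. Characteristic zero enters a second time when these orders are inverted. The
  two products differ on trees with several roots. At a tree with one root only the right factor is
  affected, since \<open>R\<^sup>I\<close> then has at most one root while \<open>P\<^sup>I\<close>
  may have many; this asymmetry is why a right preLie product results.\<close>

lemma fin_supp_on_iff: "f \<in> fin_supp_on X \<longleftrightarrow> finite {a. f a \<noteq> 0} \<and> (\<forall>a. f a \<noteq> 0 \<longrightarrow> a \<in> X)"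
  by (auto simp: fin_supp_on_def)

lemma fin_supp_on_mono: "X \<subseteq> Y \<Longrightarrow> f \<in> fin_supp_on X \<Longrightarrow> f \<in> fin_supp_on Y"
  by (auto simp: fin_supp_on_iff)

lemma sum_fun_apply: "(\<Sum>i\<in>I. f i) x = (\<Sum>i\<in>I. f i x)"
  by (induction I rule: infinite_finite_induct) (auto simp: plus_fun_apply zero_fun_apply)

lemma vector_space_fscale: "vector_space (fscale :: 'k::field \<Rightarrow> ('a \<Rightarrow> 'k) \<Rightarrow> _)"
  by unfold_locales (auto simp: fscale_def fun_eq_iff algebra_simps)

interpretation fs: vector_space "fscale :: 'k::field \<Rightarrow> ('a \<Rightarrow> 'k) \<Rightarrow> _"
  by (rule vector_space_fscale)

lemma fscale_apply: "fscale c f a = c * f a" by (simp add: fscale_def)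

text \<open>The induction method eta-expands function-valued terms, so evaluation rules for functions
  must not be applied by default.\<close>

declare plus_fun_apply [simp del] zero_fun_apply [simp del] minus_apply [simp del] uminus_apply [simp del]

lemmas fun_apply = plus_fun_apply zero_fun_apply minus_apply uminus_apply fscale_apply

lemma fin_supp_on_add: "f \<in> fin_supp_on X \<Longrightarrow> g \<in> fin_supp_on X \<Longrightarrow> f + g \<in> fin_supp_on (X :: 'a set)"
  for f g :: "'a \<Rightarrow> 'k::field"
proof -
  assume a: "f \<in> fin_supp_on X" "g \<in> fin_supp_on X"
  have "{a. (f + g) a \<noteq> 0} \<subseteq> {a. f a \<noteq> 0} \<union> {a. g a \<noteq> 0}" by (auto simp: fun_apply)
  thus ?thesis using a unfolding fin_supp_on_def by (blast intro: finite_subset[OF _ finite_UnI])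
qed

lemma fin_supp_on_scale: "f \<in> fin_supp_on X \<Longrightarrow> fscale c f \<in> fin_supp_on X"
  unfolding fin_supp_on_def by (auto simp: fun_apply intro: finite_subset[of _ "{a. f a \<noteq> 0}"])

lemma fin_supp_on_zero: "0 \<in> fin_supp_on X" by (simp add: fin_supp_on_def fun_apply)

lemma subspace_fin_supp_on: "fs.subspace (fin_supp_on X)"
  by (simp add: fs.subspace_def fin_supp_on_add fin_supp_on_scale fin_supp_on_zero)

lemma fin_supp_on_diff: "f \<in> fin_supp_on X \<Longrightarrow> g \<in> fin_supp_on X \<Longrightarrow> f - g \<in> fin_supp_on X"
  for f g :: "'a \<Rightarrow> 'k::field"
  by (rule fs.subspace_diff[OF subspace_fin_supp_on])

lemma fin_supp_on_delta: "a \<in> X \<Longrightarrow> delta a \<in> fin_supp_on X"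
  by (auto simp: fin_supp_on_def delta_def)

lemma fin_supp_expand:
  assumes "finite {a. f a \<noteq> 0}"
  shows "f = (\<Sum>a | f a \<noteq> 0. fscale (f a) (delta a))"
proof
  fix x
  have "(\<Sum>a | f a \<noteq> 0. f a * delta a x) = (\<Sum>a | f a \<noteq> 0. if a = x then f a else 0)"
    by (rule sum.cong) (auto simp: delta_def)
  also have "\<dots> = f x" using assms by (simp add: sum.delta)
  finally show "f x = (\<Sum>a | f a \<noteq> 0. fscale (f a) (delta a)) x" by (simp add: sum_fun_apply fun_apply)
qed

text \<open>The case \<open>single\<close> carries a scalar, so statements closed under sums are
  proved without a separate step for multiples.\<close>

lemma fin_supp_induct [consumes 1, case_names zero add single]:
  fixes f :: "'a \<Rightarrow> 'k::field"
  assumes f: "f \<in> fin_supp_on X" and z: "Q 0"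
    and add: "\<And>f g. f \<in> fin_supp_on X \<Longrightarrow> g \<in> fin_supp_on X \<Longrightarrow> Q f \<Longrightarrow> Q g \<Longrightarrow> Q (f + g)"
    and single: "\<And>c a. a \<in> X \<Longrightarrow> Q (fscale c (delta a))"
  shows "Q f"
proof -
  have "S \<subseteq> X \<Longrightarrow> Q (\<Sum>a\<in>S. fscale (f a) (delta a)) \<and> (\<Sum>a\<in>S. fscale (f a) (delta a)) \<in> fin_supp_on X"
    if "finite S" for S
    using that
  proof (induction S)
    case (insert a S)
    thus ?case by (simp add: add single fin_supp_on_add fin_supp_on_scale fin_supp_on_delta)
  qed (auto simp: z fin_supp_on_zero)
  from this[of "{a. f a \<noteq> 0}"] f have Q: "Q (\<Sum>a | f a \<noteq> 0. fscale (f a) (delta a))"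
    by (auto simp: fin_supp_on_iff)
  have "f = (\<Sum>a | f a \<noteq> 0. fscale (f a) (delta a))"
    by (rule fin_supp_expand) (use f in \<open>simp add: fin_supp_on_iff\<close>)
  thus ?thesis by (rule ssubst) (rule Q)
qed

section \<open>Linear extension of maps given on a basis\<close>

definition lin_comb :: "('k::field \<Rightarrow> 'b::ab_group_add \<Rightarrow> 'b) \<Rightarrow> ('x \<Rightarrow> 'b) \<Rightarrow> ('x \<Rightarrow> 'k) \<Rightarrow> 'b" where
  "lin_comb sB \<phi> u = (\<Sum>t | u t \<noteq> 0. sB (u t) (\<phi> t))"

context vector_space begin

text \<open>Supports vary with the function; additivity is checked after all of them are enlarged to
  one finite index set. On an infinite support the sum defining \<open>lin_comb\<close> is 0, whence
  the finiteness hypotheses below.\<close>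

lemma lin_comb_superset: "finite S \<Longrightarrow> {t. u t \<noteq> 0} \<subseteq> S \<Longrightarrow> lin_comb scale \<phi> u = (\<Sum>t\<in>S. scale (u t) (\<phi> t))"
  unfolding lin_comb_def by (rule sum.mono_neutral_left) auto

lemma lin_comb_add:
  assumes "finite {t. u t \<noteq> 0}" "finite {t. v t \<noteq> 0}"
  shows "lin_comb scale \<phi> (u + v) = lin_comb scale \<phi> u + lin_comb scale \<phi> v"
proof -
  let ?S = "{t. u t \<noteq> 0} \<union> {t. v t \<noteq> 0}"
  have S: "finite ?S" using assms by simp
  have 1: "lin_comb scale \<phi> u = (\<Sum>t\<in>?S. scale (u t) (\<phi> t))" by (rule lin_comb_superset[OF S]) auto
  have 2: "lin_comb scale \<phi> v = (\<Sum>t\<in>?S. scale (v t) (\<phi> t))" by (rule lin_comb_superset[OF S]) auto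
  have 3: "lin_comb scale \<phi> (u + v) = (\<Sum>t\<in>?S. scale ((u + v) t) (\<phi> t))"
    by (rule lin_comb_superset[OF S]) (auto simp: fun_apply)
  show ?thesis unfolding 1 2 3 by (simp add: fun_apply scale_left_distrib sum.distrib)
qed

lemma lin_comb_scale: 
  assumes "finite {t. u t \<noteq> 0}"
  shows "lin_comb scale \<phi> (fscale c u) = scale c (lin_comb scale \<phi> u)"
proof -
  have "lin_comb scale \<phi> (fscale c u) = (\<Sum>t | u t \<noteq> 0. scale (fscale c u t) (\<phi> t))"
    by (rule lin_comb_superset[OF assms]) (auto simp: fun_apply)
  thus ?thesis by (simp add: fun_apply lin_comb_def scale_sum_right)
qed

lemma lin_comb_diff:
  assumes "finite {t. u t \<noteq> 0}" "finite {t. v t \<noteq> 0}"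
  shows "lin_comb scale \<phi> (u - v) = lin_comb scale \<phi> u - lin_comb scale \<phi> v"
proof -
  have "{t. (fscale (-1) v) t \<noteq> 0} = {t. v t \<noteq> 0}" by (auto simp: fun_apply)
  hence "lin_comb scale \<phi> (u + fscale (-1) v) = lin_comb scale \<phi> u - lin_comb scale \<phi> v"
    using assms by (simp only: lin_comb_add lin_comb_scale) simp
  moreover have "u + fscale (-1) v = u - v" by (simp add: fun_eq_iff fun_apply)
  ultimately show ?thesis by simp
qed

lemma lin_comb_delta [simp]: "lin_comb scale \<phi> (delta t) = \<phi> t"
proof -
  have "lin_comb scale \<phi> (delta t) = (\<Sum>s\<in>{t}. scale (delta t s) (\<phi> s))"
    by (rule lin_comb_superset) (auto simp: delta_def)
  thus ?thesis by (simp add: delta_def)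
qed

lemma lin_comb_cong: "(\<And>t. u t \<noteq> 0 \<Longrightarrow> \<phi> t = \<psi> t) \<Longrightarrow> lin_comb scale \<phi> u = lin_comb scale \<psi> u"
  unfolding lin_comb_def by (rule sum.cong) auto

lemma lin_comb_closed: "subspace B \<Longrightarrow> (\<And>t. u t \<noteq> 0 \<Longrightarrow> \<phi> t \<in> B) \<Longrightarrow> lin_comb scale \<phi> u \<in> B"
  unfolding lin_comb_def by (rule subspace_sum) (auto intro: subspace_scale)

end

context bilinear_product begin

lemma mul_add_left: "x \<in> A \<Longrightarrow> x' \<in> A \<Longrightarrow> y \<in> A \<Longrightarrow> mul (x + x') y = mul x y + mul x' y"
  and mul_scale_left: "x \<in> A \<Longrightarrow> y \<in> A \<Longrightarrow> mul (scl c x) y = scl c (mul x y)"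
  using mul_linear_left unfolding linear_on_def by auto

lemma mul_add_right: "x \<in> A \<Longrightarrow> y \<in> A \<Longrightarrow> y' \<in> A \<Longrightarrow> mul x (y + y') = mul x y + mul x y'"
  and mul_scale_right: "x \<in> A \<Longrightarrow> y \<in> A \<Longrightarrow> mul x (scl c y) = scl c (mul x y)"
  using mul_linear_right unfolding linear_on_def by auto

lemma closed_diff: "x \<in> A \<Longrightarrow> y \<in> A \<Longrightarrow> x - y \<in> A"
  and closed_scale: "x \<in> A \<Longrightarrow> scl c x \<in> A"
  and closed_zero: "0 \<in> A"
  using carrier_subspace subspace_diff subspace_scale subspace_0 by auto

lemma mul_diff_left: "x \<in> A \<Longrightarrow> x' \<in> A \<Longrightarrow> y \<in> A \<Longrightarrow> mul (x - x') y = mul x y - mul x' y"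
  using mul_add_left[of "x - x'" x' y] closed_diff[of x x'] by (simp add: eq_diff_eq)

lemma mul_diff_right: "x \<in> A \<Longrightarrow> y \<in> A \<Longrightarrow> y' \<in> A \<Longrightarrow> mul x (y - y') = mul x y - mul x y'"
  using mul_add_right[of x "y - y'" y'] closed_diff[of y y'] by (simp add: eq_diff_eq)

lemma mul_zero_left: "y \<in> A \<Longrightarrow> mul 0 y = 0" 
  using mul_add_left[of 0 0 y] closed_zero by simp

lemma mul_zero_right: "y \<in> A \<Longrightarrow> mul y 0 = 0" 
  using mul_add_right[of y 0 0] closed_zero by simp

end

section \<open>A criterion for enveloping algebras\<close>

text \<open>The basis is graded by \<open>deg\<close>, the Lie algebra is spanned by the elements of degree 1, and
  \<open>ext a x\<close> is the only term of degree \<open>deg a + 1\<close> of the product of \<open>a\<close> and \<open>x\<close>.\<close>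

locale enveloping_basis =
  fixes X :: "'x set" and m :: "('x \<Rightarrow> 'k::field) \<Rightarrow> ('x \<Rightarrow> 'k) \<Rightarrow> ('x \<Rightarrow> 'k)"
    and e0 :: 'x and deg :: "'x \<Rightarrow> nat" and ext :: "'x \<Rightarrow> 'x \<Rightarrow> 'x"
  assumes alg: "unital_algebra fscale (fin_supp_on X) m (delta e0)"
    and e0_in: "e0 \<in> X"
    and deg_0: "t \<in> X \<Longrightarrow> deg t = 0 \<Longrightarrow> t = e0" and deg_e0: "deg e0 = 0"
    and ext_in: "a \<in> X \<Longrightarrow> x \<in> X \<Longrightarrow> deg x = 1 \<Longrightarrow> ext a x \<in> X"
    and deg_ext: "a \<in> X \<Longrightarrow> x \<in> X \<Longrightarrow> deg x = 1 \<Longrightarrow> deg (ext a x) = Suc (deg a)"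
    and top_coeff: "a \<in> X \<Longrightarrow> x \<in> X \<Longrightarrow> deg x = 1 \<Longrightarrow> m (delta a) (delta x) (ext a x) \<noteq> 0"
    and lower: "a \<in> X \<Longrightarrow> x \<in> X \<Longrightarrow> deg x = 1 \<Longrightarrow> m (delta a) (delta x) t \<noteq> 0 \<Longrightarrow> t = ext a x \<or> deg t \<le> deg a"
    and bracket: "x \<in> X \<Longrightarrow> y \<in> X \<Longrightarrow> deg x = 1 \<Longrightarrow> deg y = 1 \<Longrightarrow>
        commutator m (delta x) (delta y) \<in> fin_supp_on {t \<in> X. deg t = 1}"
    and decomp: "t \<in> X \<Longrightarrow> deg t > 0 \<Longrightarrow> \<exists>a\<in>X. \<exists>x\<in>X. deg x = 1 \<and> t = ext a x"
    and diamond: "a \<in> X \<Longrightarrow> b \<in> X \<Longrightarrow> x \<in> X \<Longrightarrow> y \<in> X \<Longrightarrow> deg x = 1 \<Longrightarrow> deg y = 1 \<Longrightarrow>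
        ext a x = ext b y \<Longrightarrow> (a = b \<and> x = y) \<or> (\<exists>c\<in>X. a = ext c y \<and> b = ext c x)"
begin

sublocale unital_algebra fscale "fin_supp_on X" m "delta e0" by (rule alg)

abbreviation "A \<equiv> fin_supp_on X :: ('x \<Rightarrow> 'k) set"
abbreviation "X1 \<equiv> {t \<in> X. deg t = 1}"
abbreviation "G \<equiv> fin_supp_on X1 :: ('x \<Rightarrow> 'k) set"

lemma delta_A: "t \<in> X \<Longrightarrow> delta t \<in> A" by (rule fin_supp_on_delta)

lemma delta_G: "t \<in> X \<Longrightarrow> deg t = 1 \<Longrightarrow> delta t \<in> G" by (simp add: fin_supp_on_delta)

lemma G_A: "u \<in> G \<Longrightarrow> u \<in> A" by (rule fin_supp_on_mono) auto

definition coeff where "coeff a x = m (delta a) (delta x) (ext a x)"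

definition rest where "rest a x = m (delta a) (delta x) - fscale (coeff a x) (delta (ext a x))"

text \<open>At \<open>ext a x\<close> the whole coefficient is subtracted, and every other basis
  element of the product has degree at most \<open>deg a\<close> by \<open>lower\<close>.\<close>

lemma rest_deg: assumes "a \<in> X" "x \<in> X" "deg x = 1"
  shows "rest a x \<in> fin_supp_on {t \<in> X. deg t \<le> deg a}"
proof -
  have "rest a x \<in> A" unfolding rest_def
    using assms by (intro closed_diff closed_scale mul_closed delta_A ext_in)
  moreover have "deg t \<le> deg a" if "rest a x t \<noteq> 0" for t
  proof (cases "t = ext a x")
    case True
    thus ?thesis using that by (simp add: rest_def coeff_def delta_def fun_apply)
  next
    case False
    thus ?thesis using that lower[OF assms, of t] by (simp add: rest_def delta_def fun_apply)
  qed
  ultimately show ?thesis by (simp add: fin_supp_on_iff)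
qed

lemma mult_expand: "m (delta a) (delta x) = fscale (coeff a x) (delta (ext a x)) + rest a x"
  by (simp add: rest_def)

text \<open>The degree filtration. It controls every product formed when a morphism is extended,
  since there all right factors come from \<open>G\<close>.\<close>

lemma mult_deg:
  assumes u: "u \<in> fin_supp_on {t \<in> X. deg t \<le> n}" and y: "y \<in> G"
  shows "m u y \<in> fin_supp_on {t \<in> X. deg t \<le> Suc n}"
proof -
  have uA: "v \<in> A" if "v \<in> fin_supp_on {t \<in> X. deg t \<le> n}" for v by (rule fin_supp_on_mono[OF _ that]) auto
  show ?thesis using u
  proof (induction u rule: fin_supp_induct)
    case zero
    show ?case by (simp add: mul_zero_left[OF G_A[OF y]] fin_supp_on_zero)
  next
    case (add f g)
    thus ?case using uA y by (simp add: mul_add_left G_A fin_supp_on_add)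
  next
    case (single c a)
    hence a: "a \<in> X" "deg a \<le> n" by auto
    have "m (delta a) y \<in> fin_supp_on {t \<in> X. deg t \<le> Suc n}" using y
    proof (induction y rule: fin_supp_induct)
      case zero
      show ?case by (simp add: mul_zero_right[OF delta_A[OF a(1)]] fin_supp_on_zero)
    next
      case (add f g)
      thus ?case using a by (simp add: mul_add_right G_A delta_A fin_supp_on_add)
    next
      case (single d x)
      hence x: "x \<in> X" "deg x = 1" by auto
      have "m (delta a) (delta x) \<in> fin_supp_on {t \<in> X. deg t \<le> Suc n}"
        unfolding mult_expand
      proof (intro fin_supp_on_add fin_supp_on_scale fin_supp_on_delta)
        show "ext a x \<in> {t \<in> X. deg t \<le> Suc n}" using a deg_ext[OF a(1) x] ext_in[OF a(1) x] by simp
        show "rest a x \<in> fin_supp_on {t \<in> X. deg t \<le> Suc n}"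
          by (rule fin_supp_on_mono[OF _ rest_deg[OF a(1) x]]) (use a in auto)
      qed
      thus ?case using a x by (simp add: mul_scale_right delta_A fin_supp_on_scale)
    qed
    thus ?case using a y by (simp add: mul_scale_left delta_A G_A fin_supp_on_scale)
  qed
qed

text \<open>Every element is reached from the unit by right multiplications by elements of degree
  one: for \<open>t = ext a x\<close>, the product of \<open>a\<close> and \<open>x\<close> minus
  \<open>rest a x\<close> is a nonzero multiple of \<open>delta t\<close>, and both \<open>a\<close>
  and the rest have smaller degree. Serves to extend multiplicativity to all right factors and to
  prove uniqueness.\<close>

lemma generation [consumes 1, case_names unit add scale mult]:
  assumes u: "u \<in> A" and unit: "Q (delta e0)"
    and add: "\<And>u v. u \<in> A \<Longrightarrow> v \<in> A \<Longrightarrow> Q u \<Longrightarrow> Q v \<Longrightarrow> Q (u + v)"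
    and scale: "\<And>c u. u \<in> A \<Longrightarrow> Q u \<Longrightarrow> Q (fscale c u)"
    and mult: "\<And>u x. u \<in> A \<Longrightarrow> Q u \<Longrightarrow> x \<in> X \<Longrightarrow> deg x = 1 \<Longrightarrow> Q (m u (delta x))"
  shows "Q u"
proof -
  have Q0: "Q 0" using scale[OF delta_A[OF e0_in] unit, of 0] by simp
  \<comment> \<open>Applied to \<open>X\<close> at the end and, inside the induction, to the basis
    elements of degree below \<open>deg t\<close>, where \<open>rest a x\<close> lives.\<close>
  have *: "Q v" if "\<And>t. t \<in> Y \<Longrightarrow> Q (delta t)" "v \<in> fin_supp_on Y" "Y \<subseteq> X" for v Y
    using that(2)
  proof (induction v rule: fin_supp_induct)
    case (add f g)
    thus ?case using assms(3)[of f g] fin_supp_on_mono[OF that(3)] by blast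
  next
    case (single c a)
    thus ?case using that(1,3) scale delta_A by blast
  qed (rule Q0)
  have "Q (delta t)" if "t \<in> X" for t
    using that
  proof (induction "deg t" arbitrary: t rule: less_induct)
    case less
    show ?case
    proof (cases "deg t = 0")
      case True
      thus ?thesis using deg_0[OF less.prems] unit by simp
    next
      case False
      then obtain a x where ax: "a \<in> X" "x \<in> X" "deg x = 1" "t = ext a x"
        using decomp[OF less.prems] by blast
      have d: "deg t = Suc (deg a)" using ax deg_ext by simp
      have "Q (delta a)" using less.hyps[of a] ax d by simp
      hence 1: "Q (m (delta a) (delta x))" using mult ax delta_A by blast
      have 2: "Q (rest a x)"
        by (rule *[OF _ rest_deg[OF ax(1-3)]]) (use less.hyps d in auto)
      have rA: "rest a x \<in> A" by (rule fin_supp_on_mono[OF _ rest_deg[OF ax(1-3)]]) auto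
      have c: "coeff a x \<noteq> 0" using top_coeff ax by (simp add: coeff_def)
      have "Q (m (delta a) (delta x) + fscale (-1) (rest a x))"
        using 1 2 rA ax by (intro add scale) (auto intro: mul_closed delta_A simp del: fs.scale_minus_left fs.scale_one intro!: closed_scale)
      also have "m (delta a) (delta x) + fscale (-1) (rest a x) = fscale (coeff a x) (delta t)"
        by (simp add: rest_def ax fun_eq_iff fun_apply)
      finally have "Q (fscale (coeff a x) (delta t))" .
      from scale[OF closed_scale[OF delta_A[OF less.prems]] this, of "inverse (coeff a x)"]
      show ?thesis using c by simp
    qed
  qed
  from *[OF this u] show ?thesis by simp
qed

end

section \<open>Extension of a Lie algebra morphism to an algebra morphism, degree by degree\<close>

locale enveloping_target = enveloping_basis X m e0 deg ext + B: unital_algebra sB B mB eB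
  for X :: "'x set" and m :: "('x \<Rightarrow> 'k::field) \<Rightarrow> ('x \<Rightarrow> 'k) \<Rightarrow> ('x \<Rightarrow> 'k)"
    and e0 :: 'x and deg :: "'x \<Rightarrow> nat" and ext :: "'x \<Rightarrow> 'x \<Rightarrow> 'x"
    and sB :: "'k \<Rightarrow> 'b::ab_group_add \<Rightarrow> 'b" and B mB eB +
  fixes f :: "('x \<Rightarrow> 'k) \<Rightarrow> 'b"
  assumes f_hom: "lie_hom fscale G (commutator m) sB B (commutator mB) f"
begin

lemma f_add: "u \<in> G \<Longrightarrow> v \<in> G \<Longrightarrow> f (u + v) = f u + f v"
  and f_scale: "u \<in> G \<Longrightarrow> f (fscale c u) = sB c (f u)"
  and f_in: "u \<in> G \<Longrightarrow> f u \<in> B"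
  and f_bracket: "u \<in> G \<Longrightarrow> v \<in> G \<Longrightarrow> f (commutator m u v) = mB (f u) (f v) - mB (f v) (f u)"
  using f_hom by (auto simp: lie_hom_def linear_on_def commutator_def)

lemma f_zero: "f 0 = 0" using f_scale[OF fin_supp_on_zero, of 0] by simp

abbreviation "L \<equiv> lin_comb sB"

text \<open>The values of an algebra morphism on basis elements of degree at most \<open>k\<close>;
  higher values are unconstrained. Multiplicativity is asked for right factors of degree one only:
  by \<open>mult_deg\<close> the products in question are combinations of basis elements of degree
  at most \<open>k\<close>, and by \<open>generation\<close> these factors determine the
  rest.\<close>

definition partial_hom :: "nat \<Rightarrow> ('x \<Rightarrow> 'b) \<Rightarrow> bool" where
  "partial_hom k \<phi> \<longleftrightarrow> \<phi> e0 = eB \<and> (\<forall>t\<in>X. deg t \<le> k \<longrightarrow> \<phi> t \<in> B) \<and>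
     (\<forall>a\<in>X. \<forall>x\<in>X. deg x = 1 \<longrightarrow> Suc (deg a) \<le> k \<longrightarrow> L \<phi> (m (delta a) (delta x)) = mB (\<phi> a) (f (delta x)))"

lemma fin: "u \<in> fin_supp_on Y \<Longrightarrow> finite {t. u t \<noteq> 0}" by (simp add: fin_supp_on_def)

lemma L_add: "u \<in> fin_supp_on Y \<Longrightarrow> v \<in> fin_supp_on Z \<Longrightarrow> L \<phi> (u + v) = L \<phi> u + L \<phi> v"
  and L_diff: "u \<in> fin_supp_on Y \<Longrightarrow> v \<in> fin_supp_on Z \<Longrightarrow> L \<phi> (u - v) = L \<phi> u - L \<phi> v"
  and L_scale: "u \<in> fin_supp_on Y \<Longrightarrow> L \<phi> (fscale c u) = sB c (L \<phi> u)"
  by (simp_all add: B.lin_comb_add B.lin_comb_diff B.lin_comb_scale fin)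

lemma L_zero: "L \<phi> 0 = 0" by (simp add: lin_comb_def zero_fun_apply)

lemma L_in: "partial_hom k \<phi> \<Longrightarrow> u \<in> fin_supp_on {t \<in> X. deg t \<le> k} \<Longrightarrow> L \<phi> u \<in> B"
  by (rule B.lin_comb_closed[OF B.carrier_subspace]) (auto simp: partial_hom_def fin_supp_on_iff)

text \<open>The condition of \<open>partial_hom\<close>, extended bilinearly. One degree of room is
  kept in \<open>u\<close>, since \<open>y\<close> may raise the degree by one.\<close>

lemma L_mult:
  assumes P: "partial_hom k \<phi>" and u: "u \<in> fin_supp_on {t \<in> X. Suc (deg t) \<le> k}" and y: "y \<in> G"
  shows "L \<phi> (m u y) = mB (L \<phi> u) (f y)"
proof -
  have uA: "v \<in> A" if "v \<in> fin_supp_on {t \<in> X. Suc (deg t) \<le> k}" for v by (rule fin_supp_on_mono[OF _ that]) auto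
  have uB: "L \<phi> v \<in> B" if "v \<in> fin_supp_on {t \<in> X. Suc (deg t) \<le> k}" for v
    by (rule L_in[OF P]) (rule fin_supp_on_mono[OF _ that], auto)
  show ?thesis using u
  proof (induction u rule: fin_supp_induct)
    case zero
    show ?case by (simp add: mul_zero_left[OF G_A[OF y]] L_zero B.mul_zero_left f_in[OF y])
  next
    case (add u v)
    have "m u y \<in> A" "m v y \<in> A" using add uA y G_A mul_closed by auto
    thus ?case using add uA uB y
      by (simp add: mul_add_left G_A L_add[OF add.hyps(1,2)] L_add[of _ X _ X] B.mul_add_left f_in)
  next
    case (single c a)
    hence a: "a \<in> X" "Suc (deg a) \<le> k" by auto
    hence pa: "\<phi> a \<in> B" using P by (auto simp: partial_hom_def)
    have "L \<phi> (m (delta a) y) = mB (\<phi> a) (f y)" using y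
    proof (induction y rule: fin_supp_induct)
      case zero
      show ?case by (simp add: mul_zero_right[OF delta_A[OF a(1)]] L_zero B.mul_zero_right pa f_zero)
    next
      case (add u v)
      have "m (delta a) u \<in> A" "m (delta a) v \<in> A" using add a G_A delta_A mul_closed by auto
      thus ?case using add a pa
        by (simp add: mul_add_right G_A delta_A f_add L_add[of _ X _ X] B.mul_add_right f_in)
    next
      case (single d x)
      hence x: "x \<in> X" "deg x = 1" by auto
      have "L \<phi> (m (delta a) (delta x)) = mB (\<phi> a) (f (delta x))"
        using P a x by (auto simp: partial_hom_def)
      thus ?case using a x pa mul_closed[OF delta_A[OF a(1)] delta_A[OF x(1)]] delta_G[OF x]
        by (simp add: mul_scale_right delta_A f_scale L_scale[of _ X] B.mul_scale_right f_in)
    qed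
    thus ?case using a y pa mul_closed[OF delta_A[OF a(1)] G_A[OF y]]
      by (simp add: mul_scale_left delta_A G_A L_scale[of _ X] B.mul_scale_left f_in)
  qed
qed

text \<open>The value at \<open>ext a x\<close> found by applying a morphism to \<open>m (delta a)
  (delta x) = fscale (coeff a x) (delta (ext a x)) + rest a x\<close> and solving; nothing else is
  possible.\<close>

definition next_val where
  "next_val \<phi> a x = sB (inverse (coeff a x)) (mB (\<phi> a) (f (delta x)) - L \<phi> (rest a x))"

text \<open>With \<open>a = ext c y\<close>, \<open>b = ext c x\<close>, the two candidates are compared by expanding
  \<open>(c * y) * x - (c * x) * y = c * [y, x]\<close>, where only terms of lower degree remain.\<close>

lemma next_val_eq:
  assumes P: "partial_hom k \<phi>" and N: "N \<in> X" "Suc (deg N) \<le> k" and x: "x \<in> X" "deg x = 1" and y: "y \<in> X" "deg y = 1"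
    and a: "a = ext N y" and b: "b = ext N x" and T: "ext a x = ext b y"
  shows "next_val \<phi> a x = next_val \<phi> b y"
proof -
  let ?N = "delta N" and ?x = "delta x" and ?y = "delta y" and ?a = "delta a" and ?b = "delta b"
  let ?T = "delta (ext a x)"
  have aX: "a \<in> X" and bX: "b \<in> X" and da: "deg a = Suc (deg N)" and db: "deg b = Suc (deg N)"
    using N x y ext_in deg_ext by (auto simp: a b)
  have TX: "ext a x \<in> X" and dT: "deg (ext a x) = Suc (Suc (deg N))" using ext_in deg_ext aX x da by auto
  have dl: "?N \<in> A" "?x \<in> A" "?y \<in> A" "?a \<in> A" "?b \<in> A" "?T \<in> A"
    using N x y aX bX TX by (auto intro: delta_A)
  have gl: "?x \<in> G" "?y \<in> G" by (rule delta_G[OF x], rule delta_G[OF y])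
  define C1 C2 D1 D2 where "C1 = coeff N y" and "C2 = coeff a x" and "D1 = coeff N x" and "D2 = coeff b y"
  define R1 R2 S1 S2 where "R1 = rest N y" and "R2 = rest a x" and "S1 = rest N x" and "S2 = rest b y"
  define Z where "Z = commutator m ?y ?x"
  note defs = C1_def C2_def D1_def D2_def R1_def R2_def S1_def S2_def
  have nz: "C2 \<noteq> 0" "D2 \<noteq> 0" "C1 \<noteq> 0" "D1 \<noteq> 0" using top_coeff N x y aX bX by (auto simp: defs coeff_def)
  have e1: "m ?N ?y = fscale C1 ?a + R1" and e2: "m ?a ?x = fscale C2 ?T + R2"
    and e3: "m ?N ?x = fscale D1 ?b + S1" and e4: "m ?b ?y = fscale D2 ?T + S2"
    using mult_expand[of N y] mult_expand[of a x] mult_expand[of N x] mult_expand[of b y] T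
    by (simp_all add: defs a b)
  have R1: "R1 \<in> fin_supp_on {t \<in> X. deg t \<le> deg N}" and S1: "S1 \<in> fin_supp_on {t \<in> X. deg t \<le> deg N}"
    and R2: "R2 \<in> fin_supp_on {t \<in> X. deg t \<le> Suc (deg N)}" and S2: "S2 \<in> fin_supp_on {t \<in> X. deg t \<le> Suc (deg N)}"
    using rest_deg[OF N(1) y] rest_deg[OF N(1) x] rest_deg[OF aX x] rest_deg[OF bX y]
    unfolding defs da db .
  have RA: "R1 \<in> A" "S1 \<in> A" "R2 \<in> A" "S2 \<in> A"
    using fin_supp_on_mono[OF _ R1, of X] fin_supp_on_mono[OF _ S1, of X]
      fin_supp_on_mono[OF _ R2, of X] fin_supp_on_mono[OF _ S2, of X] by auto
  have Z: "Z \<in> G" unfolding Z_def using bracket x y by blast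
  \<comment> \<open>Associativity leaves \<open>?N\<close> times a commutator, and \<open>Z\<close>
    lies in degree one by \<open>bracket\<close>.\<close>
  have "m (m ?N ?y) ?x - m (m ?N ?x) ?y = m ?N Z"
    using dl by (simp add: mul_assoc Z_def commutator_def mul_diff_right mul_closed)
  hence main: "fscale C1 (fscale C2 ?T + R2) + m R1 ?x - (fscale D1 (fscale D2 ?T + S2) + m S1 ?y) = m ?N Z"
    unfolding e1 e3 using dl RA by (simp add: mul_add_left mul_scale_left closed_scale e2 e4)
  have k1: "m R1 ?x \<in> fin_supp_on {t \<in> X. deg t \<le> Suc (deg N)}" by (rule mult_deg[OF R1 gl(1)])
  have k2: "m S1 ?y \<in> fin_supp_on {t \<in> X. deg t \<le> Suc (deg N)}" by (rule mult_deg[OF S1 gl(2)])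
  have k3: "m ?N Z \<in> fin_supp_on {t \<in> X. deg t \<le> Suc (deg N)}"
    by (rule mult_deg[OF _ Z]) (use N in \<open>auto intro: fin_supp_on_delta\<close>)
  \<comment> \<open>The common element \<open>ext a x\<close> has degree \<open>deg N + 2\<close>,
    so only the two leading terms of \<open>main\<close> reach it; this yields the equality of the
    products of leading coefficients.\<close>
  have zero: "v (ext a x) = 0" if "v \<in> fin_supp_on {t \<in> X. deg t \<le> Suc (deg N)}" for v :: "'x \<Rightarrow> 'k"
    using that dT by (auto simp: fin_supp_on_iff)
  have CD: "C1 * C2 = D1 * D2"
    using fun_cong[OF main, of "ext a x"] zero[OF k1] zero[OF k2] zero[OF k3] zero[OF R2] zero[OF S2]
    by (simp add: delta_def fun_apply)
  \<comment> \<open>The leading terms cancel. Everything left has degree at most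
    \<open>deg N + 1\<close>, hence at most \<open>k\<close>, where \<open>\<phi>\<close> already
    satisfies the morphism condition.\<close>
  have main': "fscale C1 R2 - fscale D1 S2 = m ?N Z - m R1 ?x + m S1 ?y"
  proof
    fix t
    show "(fscale C1 R2 - fscale D1 S2) t = (m ?N Z - m R1 ?x + m S1 ?y) t"
      using fun_cong[OF main, of t] CD by (simp add: fun_apply algebra_simps)
  qed
  have low: "v \<in> fin_supp_on {t \<in> X. Suc (deg t) \<le> k}" if "v \<in> fin_supp_on {t \<in> X. deg t \<le> deg N}" for v :: "'x \<Rightarrow> 'k"
    by (rule fin_supp_on_mono[OF _ that]) (use N in auto)
  have inB: "f ?x \<in> B" "f ?y \<in> B" "\<phi> N \<in> B" "\<phi> a \<in> B" "\<phi> b \<in> B" "f Z \<in> B"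
    using gl Z f_in P N aX bX da db by (auto simp: partial_hom_def)
  have lowN: "v \<in> fin_supp_on {t \<in> X. deg t \<le> k}" if "v \<in> fin_supp_on {t \<in> X. deg t \<le> Suc (deg N)}" for v :: "'x \<Rightarrow> 'k"
    by (rule fin_supp_on_mono[OF _ that]) (use N in auto)
  have lB: "L \<phi> R1 \<in> B" "L \<phi> S1 \<in> B" "L \<phi> R2 \<in> B" "L \<phi> S2 \<in> B"
  proof -
    have "R1 \<in> fin_supp_on {t \<in> X. deg t \<le> Suc (deg N)}" by (rule fin_supp_on_mono[OF _ R1]) auto
    moreover have "S1 \<in> fin_supp_on {t \<in> X. deg t \<le> Suc (deg N)}" by (rule fin_supp_on_mono[OF _ S1]) auto
    ultimately show "L \<phi> R1 \<in> B" "L \<phi> S1 \<in> B" "L \<phi> R2 \<in> B" "L \<phi> S2 \<in> B"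
      using R2 S2 by (simp_all add: L_in[OF P] lowN)
  qed
  have l1: "L \<phi> (m ?N Z) = mB (\<phi> N) (f Z)"
    using L_mult[OF P _ Z, of ?N] N by (auto intro: fin_supp_on_delta)
  have l2: "L \<phi> (m R1 ?x) = mB (L \<phi> R1) (f ?x)" by (rule L_mult[OF P low[OF R1] gl(1)])
  have l3: "L \<phi> (m S1 ?y) = mB (L \<phi> S1) (f ?y)" by (rule L_mult[OF P low[OF S1] gl(2)])
  have fZ: "f Z = mB (f ?y) (f ?x) - mB (f ?x) (f ?y)" unfolding Z_def using f_bracket gl by blast
  have "L \<phi> (fscale C1 R2 - fscale D1 S2) = sB C1 (L \<phi> R2) - sB D1 (L \<phi> S2)"
    using RA by (simp add: L_diff[OF closed_scale closed_scale] L_scale[of _ X])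
  hence A1: "sB C1 (L \<phi> R2) - sB D1 (L \<phi> S2) = mB (\<phi> N) (f Z) - mB (L \<phi> R1) (f ?x) + mB (L \<phi> S1) (f ?y)"
    unfolding main' using L_add[OF fin_supp_on_diff[OF k3 k1] k2] L_diff[OF k3 k1] by (simp add: l1 l2 l3)
  have "L \<phi> (m ?N ?y) = mB (\<phi> N) (f ?y)" using P N y by (auto simp: partial_hom_def)
  hence A2: "sB C1 (\<phi> a) = mB (\<phi> N) (f ?y) - L \<phi> R1"
    unfolding e1 using L_add[OF closed_scale[OF dl(4)] R1] L_scale[OF dl(4)] by (simp add: eq_diff_eq)
  have "L \<phi> (m ?N ?x) = mB (\<phi> N) (f ?x)" using P N x by (auto simp: partial_hom_def)
  hence A3: "sB D1 (\<phi> b) = mB (\<phi> N) (f ?x) - L \<phi> S1"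
    unfolding e3 using L_add[OF closed_scale[OF dl(5)] S1] L_scale[OF dl(5)] by (simp add: eq_diff_eq)
  \<comment> \<open>By \<open>A2\<close> and \<open>A3\<close>, and associativity in
    \<open>B\<close>, the difference of the scaled products becomes the right-hand side of
    \<open>A1\<close>.\<close>
  have A4: "sB C1 (mB (\<phi> a) (f ?x)) = mB (mB (\<phi> N) (f ?y)) (f ?x) - mB (L \<phi> R1) (f ?x)"
    using inB lB by (simp add: B.mul_scale_left[symmetric] A2 B.mul_diff_left B.mul_closed)
  have A5: "sB D1 (mB (\<phi> b) (f ?y)) = mB (mB (\<phi> N) (f ?x)) (f ?y) - mB (L \<phi> S1) (f ?y)"
    using inB lB by (simp add: B.mul_scale_left[symmetric] A3 B.mul_diff_left B.mul_closed)
  have A6: "mB (\<phi> N) (f Z) = mB (mB (\<phi> N) (f ?y)) (f ?x) - mB (mB (\<phi> N) (f ?x)) (f ?y)"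
    unfolding fZ using inB by (simp add: B.mul_diff_right B.mul_closed B.mul_assoc)
  have fin: "sB C1 (mB (\<phi> a) (f ?x) - L \<phi> R2) = sB D1 (mB (\<phi> b) (f ?y) - L \<phi> S2)"
    using A1 unfolding B.scale_right_diff_distrib A4 A5 A6 by (simp add: algebra_simps)
  \<comment> \<open>Both inverses are rewritten over the common denominator
    \<open>C1 * C2 = D1 * D2\<close>.\<close>
  have i1: "inverse C2 = inverse (C1 * C2) * C1" and i2: "inverse D2 = inverse (C1 * C2) * D1"
    using nz CD by (auto simp: field_simps)
  have "next_val \<phi> a x = sB (inverse (C1 * C2)) (sB C1 (mB (\<phi> a) (f ?x) - L \<phi> R2))"
    using i1 by (simp add: next_val_def defs)
  also have "\<dots> = next_val \<phi> b y"
    unfolding fin using i2 by (simp add: next_val_def defs)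
  finally show ?thesis .
qed

text \<open>New values are required in degree \<open>k + 1\<close> only. They are set by an
  arbitrarily chosen decomposition, and \<open>next_val_eq\<close> makes the morphism condition hold
  for every other decomposition too.\<close>

lemma partial_hom_Suc:
  assumes P: "partial_hom k \<phi>"
  shows "\<exists>\<phi>'. partial_hom (Suc k) \<phi>' \<and> (\<forall>t. deg t \<le> k \<longrightarrow> \<phi>' t = \<phi> t)"
proof -
  define p where "p t = (SOME (a, x). a \<in> X \<and> x \<in> X \<and> deg x = 1 \<and> t = ext a x)" for t
  define \<phi>' where "\<phi>' t = (if deg t \<le> k then \<phi> t else next_val \<phi> (fst (p t)) (snd (p t)))" for t
  have old: "\<phi>' t = \<phi> t" if "deg t \<le> k" for t using that by (simp add: \<phi>'_def)
  have p: "fst (p t) \<in> X" "snd (p t) \<in> X" "deg (snd (p t)) = 1" "t = ext (fst (p t)) (snd (p t))"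
    if tX: "t \<in> X" "deg t > 0" for t
    proof -
    have "\<exists>q. (case q of (a, x) \<Rightarrow> a \<in> X \<and> x \<in> X \<and> deg x = 1 \<and> t = ext a x)" using decomp[OF tX] by auto
    hence "case p t of (a, x) \<Rightarrow> a \<in> X \<and> x \<in> X \<and> deg x = 1 \<and> t = ext a x"
      unfolding p_def by (rule someI_ex)
    thus "fst (p t) \<in> X" "snd (p t) \<in> X" "deg (snd (p t)) = 1" "t = ext (fst (p t)) (snd (p t))"
      by (auto simp: case_prod_unfold)
  qed
  have new: "\<phi>' (ext a x) = next_val \<phi> a x" if ax: "a \<in> X" "x \<in> X" "deg x = 1" "deg a = k" for a x
  proof -
    let ?t = "ext a x"
    have t: "?t \<in> X" "deg ?t = Suc k" using ax ext_in deg_ext by auto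
    define b y where "b = fst (p ?t)" and "y = snd (p ?t)"
    have by_: "b \<in> X" "y \<in> X" "deg y = 1" "?t = ext b y" using p[of ?t] t unfolding b_def y_def by auto
    have "next_val \<phi> a x = next_val \<phi> b y"
    proof (cases "a = b \<and> x = y")
      case False
      \<comment> \<open>Two different decompositions share \<open>c\<close>, of degree one less than
        \<open>k\<close>; this is the degree bound that \<open>next_val_eq\<close> asks for.\<close>
      then obtain c where c: "c \<in> X" "a = ext c y" "b = ext c x"
        using diamond[OF ax(1) by_(1) ax(2) by_(2) ax(3) by_(3,4)] by blast
      have "Suc (deg c) \<le> k" using deg_ext[OF c(1) by_(2,3)] c ax by simp
      thus ?thesis using next_val_eq[OF P c(1) _ ax(2,3) by_(2,3) c(2,3) by_(4)] by blast
    qed simp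
    thus ?thesis using t by (simp add: \<phi>'_def b_def y_def)
  qed
  have nvB: "next_val \<phi> a x \<in> B" if "a \<in> X" "x \<in> X" "deg x = 1" "deg a = k" for a x
  proof -
    have "L \<phi> (rest a x) \<in> B" using L_in[OF P] rest_deg[OF that(1-3)] that(4) by simp
    moreover have "\<phi> a \<in> B" using P that by (simp add: partial_hom_def)
    ultimately show ?thesis unfolding next_val_def
      using that by (intro B.closed_scale B.closed_diff B.mul_closed f_in delta_G) auto
  qed
  have "partial_hom (Suc k) \<phi>'"
    unfolding partial_hom_def
  proof (intro conjI ballI impI)
    show "\<phi>' e0 = eB" using P old[of e0] by (simp add: deg_e0 partial_hom_def)
    show "\<phi>' t \<in> B" if tX: "t \<in> X" "deg t \<le> Suc k" for t
    proof (cases "deg t \<le> k")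
      case True
      thus ?thesis using P tX old by (simp add: partial_hom_def)
    next
      case False
      then obtain a x where ax: "a \<in> X" "x \<in> X" "deg x = 1" "t = ext a x" using decomp[OF tX(1)] by auto
      hence "deg a = k" using deg_ext[OF ax(1-3)] tX False by simp
      thus ?thesis using new nvB ax by simp
    qed
    show "L \<phi>' (m (delta a) (delta x)) = mB (\<phi>' a) (f (delta x))"
      if ax: "a \<in> X" "x \<in> X" "deg x = 1" "Suc (deg a) \<le> Suc k" for a x
    \<comment> \<open>In the top degree the condition is the equation that \<open>next_val\<close>
      solves; below it only old values occur.\<close>
    proof (cases "deg a = k")
      case True
      have r: "L \<phi>' (rest a x) = L \<phi> (rest a x)"
        by (rule B.lin_comb_cong) (use rest_deg[OF ax(1-3)] old True in \<open>auto simp: fin_supp_on_iff\<close>)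
      have c: "coeff a x \<noteq> 0" using top_coeff ax by (simp add: coeff_def)
      have "L \<phi>' (m (delta a) (delta x)) = sB (coeff a x) (\<phi>' (ext a x)) + L \<phi>' (rest a x)"
        unfolding mult_expand
        using L_add[OF closed_scale[OF delta_A[OF ext_in[OF ax(1-3)]]] rest_deg[OF ax(1-3)]]
          L_scale[OF delta_A[OF ext_in[OF ax(1-3)]]] by simp
      also have "\<dots> = mB (\<phi> a) (f (delta x))"
        unfolding new[OF ax(1-3) True] r using c by (simp add: next_val_def)
      finally show ?thesis using old True by simp
    next
      case False
      hence da: "Suc (deg a) \<le> k" using ax by simp
      have "m (delta a) (delta x) \<in> fin_supp_on {t \<in> X. deg t \<le> Suc (deg a)}"
        using ax by (intro mult_deg fin_supp_on_delta delta_G) auto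
      hence "L \<phi>' (m (delta a) (delta x)) = L \<phi> (m (delta a) (delta x))"
        by (intro B.lin_comb_cong old) (use da in \<open>auto simp: fin_supp_on_iff\<close>)
      thus ?thesis using P ax da old[of a] by (simp add: partial_hom_def)
    qed
  qed
  thus ?thesis using old by blast
qed

text \<open>Each extension keeps the lower values, so a sequence of extensions stabilises at every
  basis element, and its diagonal satisfies all the conditions at once.\<close>

lemma hom_exists: "\<exists>\<phi>. \<forall>k. partial_hom k \<phi>"
proof -
  \<comment> \<open>In degree 0 the multiplicativity condition is vacuous.\<close>
  have "partial_hom 0 (\<lambda>_. eB)" using B.unit_closed by (simp add: partial_hom_def)
  hence "\<exists>\<Phi>. \<forall>k. partial_hom k (\<Phi> k) \<and> (\<forall>t. deg t \<le> k \<longrightarrow> \<Phi> (Suc k) t = \<Phi> k t)"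
    using partial_hom_Suc
    by (intro dependent_nat_choice[where P = partial_hom and Q = "\<lambda>k \<phi> \<phi>'. \<forall>t. deg t \<le> k \<longrightarrow> \<phi>' t = \<phi> t"]) auto
  then obtain \<Phi> where P: "\<And>k. partial_hom k (\<Phi> k)" and S: "\<And>k t. deg t \<le> k \<Longrightarrow> \<Phi> (Suc k) t = \<Phi> k t" by blast
  define \<phi> where "\<phi> t = \<Phi> (deg t) t" for t
  have eq: "\<Phi> k t = \<phi> t" if "deg t \<le> k" for k t
    using that by (induction k rule: dec_induct) (auto simp: \<phi>_def S)
  have "partial_hom k \<phi>" for k
    unfolding partial_hom_def
  proof (intro conjI ballI impI)
    show "\<phi> e0 = eB" using P[of 0] eq[of e0 0] by (simp add: deg_e0 partial_hom_def)
    show "\<phi> t \<in> B" if "t \<in> X" "deg t \<le> k" for t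
      using P[of k] that eq[of t k] unfolding partial_hom_def by metis
    show "L \<phi> (m (delta a) (delta x)) = mB (\<phi> a) (f (delta x))"
      if ax: "a \<in> X" "x \<in> X" "deg x = 1" "Suc (deg a) \<le> k" for a x
    proof -
      have "m (delta a) (delta x) \<in> fin_supp_on {t \<in> X. deg t \<le> Suc (deg a)}"
        using ax by (intro mult_deg fin_supp_on_delta delta_G) auto
      hence "L \<phi> (m (delta a) (delta x)) = L (\<Phi> k) (m (delta a) (delta x))"
        by (intro B.lin_comb_cong eq[symmetric]) (use ax in \<open>auto simp: fin_supp_on_iff\<close>)
      thus ?thesis using P[of k] ax eq[of a k] by (simp add: partial_hom_def)
    qed
  qed
  thus ?thesis by blast
qed

text \<open>Multiplicativity for right factors of degree one propagates to all right factors by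
  associativity on both sides, along \<open>generation\<close>. Uniqueness follows the same
  induction.\<close>

lemma universal:
  "\<exists>F. alg_hom fscale A m (delta e0) sB B mB eB F \<and> (\<forall>x\<in>G. F x = f x) \<and>
     (\<forall>F'. alg_hom fscale A m (delta e0) sB B mB eB F' \<and> (\<forall>x\<in>G. F' x = f x) \<longrightarrow> (\<forall>a\<in>A. F' a = F a))"
proof -
  obtain \<phi> where P: "\<And>k. partial_hom k \<phi>" using hom_exists by blast
  have e: "\<phi> e0 = eB" and cl: "\<And>t. t \<in> X \<Longrightarrow> \<phi> t \<in> B" using P by (auto simp: partial_hom_def)
  have LB: "L \<phi> u \<in> B" if "u \<in> A" for u
    by (rule B.lin_comb_closed[OF B.carrier_subspace]) (use that cl in \<open>auto simp: fin_supp_on_iff\<close>)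
  have step: "L \<phi> (m u y) = mB (L \<phi> u) (f y)" if u: "u \<in> A" and y: "y \<in> G" for u y
  proof -
    \<comment> \<open>A finitely supported \<open>u\<close> has bounded degree, so one of the
      partial conditions covers it.\<close>
    have "finite (deg ` {t. u t \<noteq> 0})" using fin[OF u] by simp
    then obtain k where "\<And>t. u t \<noteq> 0 \<Longrightarrow> deg t \<le> k" by (auto simp: finite_nat_set_iff_bounded_le)
    hence "u \<in> fin_supp_on {t \<in> X. Suc (deg t) \<le> Suc k}" using u by (auto simp: fin_supp_on_iff)
    from L_mult[OF P this y] show ?thesis .
  qed
  \<comment> \<open>The value at \<open>y\<close> is recovered by multiplying the unit by
    \<open>y\<close>.\<close>
  have Lf: "L \<phi> y = f y" if y: "y \<in> G" for y
    using step[OF delta_A[OF e0_in] y] by (simp add: unit_left G_A[OF y] e B.unit_left f_in[OF y])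
  have hom: "alg_hom fscale A m (delta e0) sB B mB eB (L \<phi>)"
    unfolding alg_hom_def linear_on_def
  proof (intro conjI ballI allI)
    show "L \<phi> (m u v) = mB (L \<phi> u) (L \<phi> v)" if "u \<in> A" "v \<in> A" for u v
      using that(2,1)
    proof (induction v arbitrary: u rule: generation)
      case unit
      thus ?case by (simp add: unit_right e B.unit_right LB)
    next
      case (add v w)
      thus ?case by (simp add: mul_add_right L_add[of _ X _ X] mul_closed B.mul_add_right LB)
    next
      case (scale c v)
      thus ?case by (simp add: mul_scale_right L_scale[of _ X] mul_closed B.mul_scale_right LB)
    next
      case (mult v x)
      have d: "delta x \<in> A" "delta x \<in> G" by (rule delta_A[OF mult(2)], rule delta_G[OF mult(2,3)])
      show ?case
        using mult d by (simp add: mul_assoc[symmetric] step mul_closed)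
          (simp add: B.mul_assoc LB f_in)
    qed
  qed (auto simp: L_add[of _ X _ X] L_scale[of _ X] LB e)
  moreover have "F' a = L \<phi> a" if F': "alg_hom fscale A m (delta e0) sB B mB eB F'"
    "\<forall>x\<in>G. F' x = f x" and a: "a \<in> A" for F' a
    using a
  proof (induction a rule: generation)
    case unit
    thus ?case using F' e by (simp add: alg_hom_def)
  next
    case (add u v)
    thus ?case using F' by (simp add: alg_hom_def linear_on_def L_add[of _ X _ X])
  next
    case (scale c u)
    thus ?case using F' by (simp add: alg_hom_def linear_on_def L_scale[of _ X])
  next
    case (mult u x)
    have d: "delta x \<in> A" "delta x \<in> G" by (rule delta_A[OF mult(2)], rule delta_G[OF mult(2,3)])
    thus ?case using F' mult by (simp add: alg_hom_def step)
  qed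
  ultimately show ?thesis using Lf by blast
qed

end

section \<open>Transport of the universal property along a linear isomorphism\<close>

context enveloping_basis begin

lemma bracket_closed: "u \<in> G \<Longrightarrow> v \<in> G \<Longrightarrow> commutator m u v \<in> G"
proof -
  assume u: "u \<in> G" and v: "v \<in> G"
  show ?thesis using u
  proof (induction u rule: fin_supp_induct)
    case zero
    show ?case using v by (simp add: commutator_def mul_zero_left mul_zero_right G_A fin_supp_on_zero)
  next
    case (add a b)
    have "commutator m (a + b) v = commutator m a v + commutator m b v"
      using add v by (simp add: commutator_def mul_add_left mul_add_right G_A)
    thus ?case using add by (simp add: fin_supp_on_add)
  next
    case (single c x)
    hence x: "x \<in> X" "deg x = 1" by auto
    have "commutator m (delta x) v \<in> G" using v
    proof (induction v rule: fin_supp_induct)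
      case zero
      show ?case using x by (simp add: commutator_def mul_zero_left mul_zero_right delta_A fin_supp_on_zero)
    next
      case (add a b)
      have "commutator m (delta x) (a + b) = commutator m (delta x) a + commutator m (delta x) b"
        using add x by (simp add: commutator_def mul_add_left mul_add_right G_A delta_A)
      thus ?case using add by (simp add: fin_supp_on_add)
    next
      case (single d y)
      hence y: "y \<in> X" "deg y = 1" by auto
      have "commutator m (delta x) (fscale d (delta y)) = fscale d (commutator m (delta x) (delta y))"
        using x y by (simp add: commutator_def mul_scale_left mul_scale_right delta_A fs.scale_right_diff_distrib)
      thus ?case using bracket[OF x(1) y(1) x(2) y(2)] by (simp add: fin_supp_on_scale)
    qed
    moreover have "commutator m (fscale c (delta x)) v = fscale c (commutator m (delta x) v)"
      using x v by (simp add: commutator_def mul_scale_left mul_scale_right delta_A G_A fs.scale_right_diff_distrib)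
    ultimately show ?case by (simp add: fin_supp_on_scale)
  qed
qed

text \<open>The Lie algebra may live on another type than its image \<open>G\<close>. Composing with
  the inverse \<open>j\<close> of \<open>\<iota>\<close> turns morphisms from \<open>H\<close> into
  morphisms from \<open>G\<close>; \<open>j\<close> is linear and compatible with brackets because
  \<open>\<iota>\<close> is so and is injective.\<close>

lemma enveloping_algebra_transport:
  fixes sG :: "'k \<Rightarrow> 'g::ab_group_add \<Rightarrow> 'g"
  assumes lin: "linear_on H sG fscale \<iota>" and bij: "bij_betw \<iota> H G"
    and Hadd: "\<And>x y. x \<in> H \<Longrightarrow> y \<in> H \<Longrightarrow> x + y \<in> H" and Hscale: "\<And>c x. x \<in> H \<Longrightarrow> sG c x \<in> H"
    and br: "\<And>x y. x \<in> H \<Longrightarrow> y \<in> H \<Longrightarrow> br x y \<in> H \<and> \<iota> (br x y) = commutator m (\<iota> x) (\<iota> y)"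
  shows "enveloping_algebra TYPE('b::ab_group_add) sG H br fscale A m (delta e0) \<iota>"
  unfolding enveloping_algebra_def
proof (intro conjI allI impI alg)
  have in_G: "\<iota> x \<in> G" if "x \<in> H" for x using bij that by (auto simp: bij_betw_def)
  show "lie_hom sG H br fscale A (commutator m) \<iota>"
    using lin br in_G G_A by (auto simp: lie_hom_def)
  fix sB :: "'k \<Rightarrow> 'b \<Rightarrow> 'b" and B mB eB f
  assume asm: "unital_algebra sB B mB eB \<and> lie_hom sG H br sB B (commutator mB) f"
  define j where "j = inv_into H \<iota>"
  have j: "j u \<in> H" "\<iota> (j u) = u" if "u \<in> G" for u
    using that bij by (auto simp: j_def bij_betw_def intro: inv_into_into f_inv_into_f)
  have inj: "x = y" if "\<iota> x = \<iota> y" "x \<in> H" "y \<in> H" for x y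
    using that bij by (auto simp: bij_betw_def inj_on_def)
  have ji: "j (\<iota> x) = x" if "x \<in> H" for x using inj j in_G that by blast
  have j_add: "j (u + v) = j u + j v" if "u \<in> G" "v \<in> G" for u v
    by (rule inj) (use that j lin Hadd in \<open>auto simp: linear_on_def fin_supp_on_add\<close>)
  have j_scale: "j (fscale c u) = sG c (j u)" if "u \<in> G" for c u
    by (rule inj) (use that j lin Hscale in \<open>auto simp: linear_on_def fin_supp_on_scale\<close>)
  have j_br: "j (commutator m u v) = br (j u) (j v)" if "u \<in> G" "v \<in> G" for u v
    by (rule inj) (use that j br bracket_closed in auto)
  have "lie_hom fscale G (commutator m) sB B (commutator mB) (f \<circ> j)"
    using asm j unfolding lie_hom_def linear_on_def by (auto simp: j_add j_scale j_br)
  then interpret enveloping_target X m e0 deg ext sB B mB eB "f \<circ> j"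
    using asm enveloping_basis_axioms by (simp add: enveloping_target_def enveloping_target_axioms_def)
  have all: "(\<forall>x\<in>G. F x = (f \<circ> j) x) \<longleftrightarrow> (\<forall>x\<in>H. F (\<iota> x) = f x)" for F
  proof
    assume "\<forall>x\<in>G. F x = (f \<circ> j) x" thus "\<forall>x\<in>H. F (\<iota> x) = f x" using in_G ji by simp
  next
    assume *: "\<forall>x\<in>H. F (\<iota> x) = f x"
    show "\<forall>x\<in>G. F x = (f \<circ> j) x"
    proof
      fix u assume "u \<in> G"
      thus "F u = (f \<circ> j) u" using *[rule_format, of "j u"] j by simp
    qed
  qed
  show "\<exists>F. alg_hom fscale A m (delta e0) sB B mB eB F \<and> (\<forall>x\<in>H. F (\<iota> x) = f x) \<and>
     (\<forall>F'. alg_hom fscale A m (delta e0) sB B mB eB F' \<and> (\<forall>x\<in>H. F' (\<iota> x) = f x) \<longrightarrow> (\<forall>a\<in>A. F' a = F a))"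
    using universal unfolding all .
qed

end

section \<open>Partitioned forests up to isomorphism\<close>


text \<open>A partition is determined by its equivalence relation, so that isomorphisms can be checked on
  vertices instead of blocks.\<close>

definition same_block :: "('v, 'd) pforest \<Rightarrow> 'v \<Rightarrow> 'v \<Rightarrow> bool" where
  "same_block F u v \<longleftrightarrow> (\<exists>B\<in>blocks F. u \<in> B \<and> v \<in> B)"

lemma partition_on_unique: "partition_on V P \<Longrightarrow> B \<in> P \<Longrightarrow> C \<in> P \<Longrightarrow> v \<in> B \<Longrightarrow> v \<in> C \<Longrightarrow> B = C"
  unfolding partition_on_def disjoint_def by blast

text \<open>A partition is the quotient by its equivalence relation, and the hypothesis identifies
  the two relations.\<close>

lemma partition_on_eqI:
  assumes P: "partition_on V P" and Q: "partition_on V Q"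
    and eq: "\<And>u v. u \<in> V \<Longrightarrow> v \<in> V \<Longrightarrow> (\<exists>B\<in>P. u \<in> B \<and> v \<in> B) \<longleftrightarrow> (\<exists>B\<in>Q. u \<in> B \<and> v \<in> B)"
  shows "P = Q"
proof -
  define r where "r = {(u, v). \<exists>B\<in>P. u \<in> B \<and> v \<in> B}"
  define s where "s = {(u, v). \<exists>B\<in>Q. u \<in> B \<and> v \<in> B}"
  have "r \<subseteq> V \<times> V" "s \<subseteq> V \<times> V"
    using partition_onD1[OF P] partition_onD1[OF Q] by (auto simp: r_def s_def)
  moreover have "(u, v) \<in> r \<longleftrightarrow> (u, v) \<in> s" if "u \<in> V" "v \<in> V" for u v
    unfolding r_def s_def mem_Collect_eq prod.case by (rule eq[OF that])
  ultimately have "r = s" by blast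
  have "P = V // r" unfolding r_def by (rule partition_on_eq_quotient[OF P, symmetric])
  also have "\<dots> = V // s" by (simp only: \<open>r = s\<close>)
  also have "\<dots> = Q" unfolding s_def by (rule partition_on_eq_quotient[OF Q])
  finally show ?thesis .
qed

lemma partition_onI':
  assumes "\<And>v. v \<in> V \<longleftrightarrow> (\<exists>B\<in>P. v \<in> B)" "{} \<notin> P"
    and "\<And>B C v. B \<in> P \<Longrightarrow> C \<in> P \<Longrightarrow> v \<in> B \<Longrightarrow> v \<in> C \<Longrightarrow> B = C"
  shows "partition_on V P"
  by (rule partition_onI) (use assms in \<open>auto simp: disjnt_def\<close>)

text \<open>The number of proper ancestors is a rank. Ranks pass to restrictions, disjoint unions,
  relabellings and grafts by an explicit formula.\<close>

lemma acyclic_iff_rank: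
  assumes "finite E"
  shows "acyclic E \<longleftrightarrow> (\<exists>h::'v \<Rightarrow> nat. \<forall>u v. (u, v) \<in> E \<longrightarrow> h u < h v)"
proof
  assume ac: "acyclic E"
  have "card {w. (w, u) \<in> E\<^sup>+} < card {w. (w, v) \<in> E\<^sup>+}" if "(u, v) \<in> E" for u v
  proof (rule psubset_card_mono)
    have "{w. (w, v) \<in> E\<^sup>+} \<subseteq> Domain (E\<^sup>+)" by blast
    thus "finite {w. (w, v) \<in> E\<^sup>+}"
      unfolding trancl_domain using finite_Domain[OF assms] by (rule finite_subset)
    show "{w. (w, u) \<in> E\<^sup>+} \<subset> {w. (w, v) \<in> E\<^sup>+}"
      using that ac by (auto simp: acyclic_def intro: trancl_into_trancl)
  qed
  thus "\<exists>h::'v \<Rightarrow> nat. \<forall>u v. (u, v) \<in> E \<longrightarrow> h u < h v"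
    by (intro exI[of _ "\<lambda>v. card {w. (w, v) \<in> E\<^sup>+}"]) blast
next
  assume "\<exists>h::'v \<Rightarrow> nat. \<forall>u v. (u, v) \<in> E \<longrightarrow> h u < h v"
  then obtain h :: "'v \<Rightarrow> nat" where h: "\<And>u v. (u, v) \<in> E \<Longrightarrow> h u < h v" by blast
  have "h u < h v" if "(u, v) \<in> E\<^sup>+" for u v
    using that by (induction rule: trancl_induct) (auto dest: h intro: less_trans)
  thus "acyclic E" unfolding acyclic_def by blast
qed

lemma rooted_forest_rank:
  "rooted_forest F \<longleftrightarrow> finite (verts F) \<and> edges F \<subseteq> verts F \<times> verts F \<and>
     (\<forall>u u' v. (u, v) \<in> edges F \<and> (u', v) \<in> edges F \<longrightarrow> u = u') \<and>
     (\<exists>h::_ \<Rightarrow> nat. \<forall>u v. (u, v) \<in> edges F \<longrightarrow> h u < h v)"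
  unfolding rooted_forest_def using acyclic_iff_rank[of "edges F"]
  by (metis finite_SigmaI finite_subset)

lemma part_forest_iff:
  "part_forest F \<longleftrightarrow> rooted_forest F \<and> partition_on (verts F) (blocks F) \<and>
     (\<forall>u v. same_block F u v \<longrightarrow> (u \<in> roots F \<and> v \<in> roots F) \<or> (\<exists>p. (p, u) \<in> edges F \<and> (p, v) \<in> edges F))"
  unfolding part_forest_def same_block_def by blast

lemma part_treeD: "part_tree F \<Longrightarrow> part_forest F" by (simp add: part_tree_def)

lemma part_forestD:
  assumes "part_forest F"
  shows "finite (verts F)"
    and "(u, v) \<in> edges F \<Longrightarrow> u \<in> verts F" and "(u, v) \<in> edges F \<Longrightarrow> v \<in> verts F"
    and "(u, v) \<in> edges F \<Longrightarrow> (u', v) \<in> edges F \<Longrightarrow> u = u'"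
    and "partition_on (verts F) (blocks F)"
    and "same_block F u v \<Longrightarrow> u \<in> verts F" and "same_block F u v \<Longrightarrow> v \<in> verts F"
    and "u \<in> verts F \<Longrightarrow> same_block F u u"
    and "same_block F u v \<Longrightarrow> same_block F v w \<Longrightarrow> same_block F u w"
    and "same_block F u v \<Longrightarrow> same_block F v u"
    and "same_block F u v \<Longrightarrow> (p, u) \<in> edges F \<longleftrightarrow> (p, v) \<in> edges F"
    and "same_block F u v \<Longrightarrow> u \<in> roots F \<longleftrightarrow> v \<in> roots F"
proof -
  have 1: "finite (verts F)" "edges F \<subseteq> verts F \<times> verts F"
    "\<And>u u' v. (u, v) \<in> edges F \<Longrightarrow> (u', v) \<in> edges F \<Longrightarrow> u = u'"
    "partition_on (verts F) (blocks F)"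
    "\<And>u v. same_block F u v \<Longrightarrow> (u \<in> roots F \<and> v \<in> roots F) \<or> (\<exists>p. (p, u) \<in> edges F \<and> (p, v) \<in> edges F)"
    using assms by (auto simp: part_forest_iff rooted_forest_def)
  show "finite (verts F)" "partition_on (verts F) (blocks F)" using 1 by auto
  show "(u, v) \<in> edges F \<Longrightarrow> u \<in> verts F" "(u, v) \<in> edges F \<Longrightarrow> v \<in> verts F"
    "(u, v) \<in> edges F \<Longrightarrow> (u', v) \<in> edges F \<Longrightarrow> u = u'" using 1 by auto
  show "same_block F u v \<Longrightarrow> u \<in> verts F" "same_block F u v \<Longrightarrow> v \<in> verts F"
    "u \<in> verts F \<Longrightarrow> same_block F u u"
    "same_block F u v \<Longrightarrow> same_block F v u"
    using 1(4) by (auto simp: partition_on_def same_block_def)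
  have eq: "B = C" if "B \<in> blocks F" "C \<in> blocks F" "v \<in> B" "v \<in> C" for B C v
    using that disjointD[OF partition_onD2[OF 1(4)]] by blast
  show "same_block F u v \<Longrightarrow> same_block F v w \<Longrightarrow> same_block F u w"
    unfolding same_block_def using eq by blast
  show "same_block F u v \<Longrightarrow> (p, u) \<in> edges F \<longleftrightarrow> (p, v) \<in> edges F"
    using 1(5)[of u v] 1(3) by (auto simp: roots_def)
  show "same_block F u v \<Longrightarrow> u \<in> roots F \<longleftrightarrow> v \<in> roots F"
    using 1(5)[of u v] 1(3) by (auto simp: roots_def)
qed

lemma part_tree_iff:
  "part_tree F \<longleftrightarrow> part_forest F \<and> (\<forall>u\<in>roots F. \<forall>v\<in>roots F. same_block F u v)"
proof (cases "part_forest F")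
  case True
  have "roots F = {} \<or> (\<exists>B\<in>blocks F. roots F \<subseteq> B)" if tr: "\<forall>u\<in>roots F. \<forall>v\<in>roots F. same_block F u v"
  proof (cases "roots F = {}")
    case False
    then obtain u where u: "u \<in> roots F" by blast
    hence "u \<in> verts F" by (simp add: roots_def)
    then obtain B where B: "B \<in> blocks F" "u \<in> B"
      using part_forestD(8)[OF True] by (auto simp: same_block_def)
    have "roots F \<subseteq> B"
    proof
      fix v assume "v \<in> roots F"
      then obtain C where "C \<in> blocks F" "u \<in> C" "v \<in> C" using tr u by (auto simp: same_block_def)
      thus "v \<in> B" using B disjointD[OF partition_onD2[OF part_forestD(5)[OF True]]] by blast
    qed
    thus ?thesis using B by blast
  qed simp
  thus ?thesis using True by (auto simp: part_tree_def same_block_def)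
qed (simp add: part_tree_def)

lemma roots_subset: "roots F \<subseteq> verts F" by (auto simp: roots_def)

lemma pf_isoI:
  assumes F: "part_forest F" and G: "part_forest G" and b: "bij_betw \<phi> (verts F) (verts G)"
    and e: "\<And>u v. u \<in> verts F \<Longrightarrow> v \<in> verts F \<Longrightarrow> (u, v) \<in> edges F \<longleftrightarrow> (\<phi> u, \<phi> v) \<in> edges G"
    and s: "\<And>u v. u \<in> verts F \<Longrightarrow> v \<in> verts F \<Longrightarrow> same_block F u v \<longleftrightarrow> same_block G (\<phi> u) (\<phi> v)"
    and d: "\<And>v. v \<in> verts F \<Longrightarrow> dec G (\<phi> v) = dec F v"
  shows "pf_iso \<phi> F G"
proof -
  have inj: "inj_on \<phi> (verts F)" and img: "verts G = \<phi> ` verts F" using b by (auto simp: bij_betw_def)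
  have sub: "\<And>B. B \<in> blocks F \<Longrightarrow> B \<subseteq> verts F"
    using part_forestD(5)[OF F] by (auto simp: partition_on_def)
  have im: "\<phi> u \<in> \<phi> ` B \<longleftrightarrow> u \<in> B" if "B \<in> blocks F" "u \<in> verts F" for u B
    using sub[OF that(1)] that(2) inj by (simp add: inj_on_image_mem_iff)
  have "blocks G = (\<lambda>B. \<phi> ` B) ` blocks F"
  proof (rule partition_on_eqI[OF part_forestD(5)[OF G]])
    have "{} \<notin> (`) \<phi> ` blocks F" using part_forestD(5)[OF F] by (auto simp: partition_on_def)
    thus "partition_on (verts G) ((`) \<phi> ` blocks F)"
      unfolding img using partition_on_inj_image[OF part_forestD(5)[OF F] inj] by simp
    fix u' v' assume "u' \<in> verts G" "v' \<in> verts G"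
    then obtain u v where uv: "u \<in> verts F" "v \<in> verts F" "u' = \<phi> u" "v' = \<phi> v" by (auto simp: img)
    show "(\<exists>B\<in>blocks G. u' \<in> B \<and> v' \<in> B) \<longleftrightarrow> (\<exists>B\<in>(`) \<phi> ` blocks F. u' \<in> B \<and> v' \<in> B)"
      using s[OF uv(1,2)] uv im by (simp add: same_block_def)
  qed
  thus ?thesis using b e d by (auto simp: pf_iso_def)
qed

lemma pf_isoD:
  assumes F: "part_forest F" and i: "pf_iso \<phi> F G"
  shows "bij_betw \<phi> (verts F) (verts G)" "inj_on \<phi> (verts F)" "verts G = \<phi> ` verts F"
    "u \<in> verts F \<Longrightarrow> \<phi> u \<in> verts G"
    "u \<in> verts F \<Longrightarrow> v \<in> verts F \<Longrightarrow> (\<phi> u, \<phi> v) \<in> edges G \<longleftrightarrow> (u, v) \<in> edges F"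
    "u \<in> verts F \<Longrightarrow> v \<in> verts F \<Longrightarrow> same_block G (\<phi> u) (\<phi> v) \<longleftrightarrow> same_block F u v"
    "v \<in> verts F \<Longrightarrow> dec G (\<phi> v) = dec F v"
    "u \<in> verts F \<Longrightarrow> v \<in> verts F \<Longrightarrow> \<phi> u = \<phi> v \<longleftrightarrow> u = v"
proof -
  show b: "bij_betw \<phi> (verts F) (verts G)" using i by (simp add: pf_iso_def)
  then show inj: "inj_on \<phi> (verts F)" and img: "verts G = \<phi> ` verts F" by (auto simp: bij_betw_def)
  show "u \<in> verts F \<Longrightarrow> \<phi> u \<in> verts G"
    "u \<in> verts F \<Longrightarrow> v \<in> verts F \<Longrightarrow> (\<phi> u, \<phi> v) \<in> edges G \<longleftrightarrow> (u, v) \<in> edges F"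
    "v \<in> verts F \<Longrightarrow> dec G (\<phi> v) = dec F v"
    using i img by (auto simp: pf_iso_def)
  show "u \<in> verts F \<Longrightarrow> v \<in> verts F \<Longrightarrow> \<phi> u = \<phi> v \<longleftrightarrow> u = v" using inj by (auto simp: inj_on_def)
  have sub: "\<And>B. B \<in> blocks F \<Longrightarrow> B \<subseteq> verts F"
    using part_forestD(5)[OF F] by (auto simp: partition_on_def)
  have im: "\<phi> u \<in> \<phi> ` B \<longleftrightarrow> u \<in> B" if "B \<in> blocks F" "u \<in> verts F" for u B
    using sub[OF that(1)] that(2) inj by (simp add: inj_on_image_mem_iff)
  have "blocks G = (\<lambda>B. \<phi> ` B) ` blocks F" using i by (simp add: pf_iso_def)
  then show "u \<in> verts F \<Longrightarrow> v \<in> verts F \<Longrightarrow> same_block G (\<phi> u) (\<phi> v) \<longleftrightarrow> same_block F u v"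
    using im by (simp add: same_block_def)
qed

lemma roots_iso:
  assumes F: "part_forest F" and G: "part_forest G" and i: "pf_iso \<phi> F G" and v: "v \<in> verts F"
  shows "\<phi> v \<in> roots G \<longleftrightarrow> v \<in> roots F"
proof -
  note D = pf_isoD[OF F i]
  have "(\<exists>u. (u, \<phi> v) \<in> edges G) \<longleftrightarrow> (\<exists>u. (u, v) \<in> edges F)"
  proof
    assume "\<exists>u. (u, \<phi> v) \<in> edges G"
    then obtain u' where u': "(u', \<phi> v) \<in> edges G" by blast
    then obtain u where "u \<in> verts F" "u' = \<phi> u"
      using part_forestD(2)[OF G u'] D(3) by auto
    thus "\<exists>u. (u, v) \<in> edges F" using D(5) v u' by blast
  next
    assume "\<exists>u. (u, v) \<in> edges F"
    thus "\<exists>u. (u, \<phi> v) \<in> edges G" using D(5) v part_forestD(2)[OF F] by blast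
  qed
  thus ?thesis using v D(4) by (auto simp: roots_def)
qed

lemma roots_iso_image:
  assumes F: "part_forest F" and G: "part_forest G" and i: "pf_iso \<phi> F G"
  shows "roots G = \<phi> ` roots F" "bij_betw \<phi> (roots F) (roots G)"
proof -
  have "roots G = {w \<in> \<phi> ` verts F. w \<in> roots G}"
    using roots_subset[of G] pf_isoD(3)[OF F i] by auto
  also have "\<dots> = \<phi> ` {v \<in> verts F. \<phi> v \<in> roots G}" by blast
  also have "{v \<in> verts F. \<phi> v \<in> roots G} = roots F"
    using roots_iso[OF F G i] roots_subset[of F] by auto
  finally show r: "roots G = \<phi> ` roots F" .
  show "bij_betw \<phi> (roots F) (roots G)"
    unfolding r using inj_on_subset[OF pf_isoD(2)[OF F i] roots_subset] by (simp add: bij_betw_def)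
qed

lemma part_tree_iso:
  assumes "part_forest F" "part_forest G" "pf_iso \<phi> F G" "part_tree F"
  shows "part_tree G"
proof -
  have "same_block G (\<phi> u) (\<phi> v)" if "u \<in> roots F" "v \<in> roots F" for u v
    using that assms(4) pf_isoD(6)[OF assms(1,3), of u v] roots_subset[of F]
    by (auto simp: part_tree_iff)
  thus ?thesis using assms(2) by (auto simp: part_tree_iff roots_iso_image(1)[OF assms(1-3)])
qed

subsection \<open>Restriction\<close>

lemma restrict_simps [simp]:
  "verts (restrict_forest F W) = verts F \<inter> W"
  "(u, v) \<in> edges (restrict_forest F W) \<longleftrightarrow> (u, v) \<in> edges F \<and> u \<in> W \<and> v \<in> W"
  "dec (restrict_forest F W) = dec F"
  "same_block (restrict_forest F W) u v \<longleftrightarrow> same_block F u v \<and> u \<in> W \<and> v \<in> W"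
proof -
  show "same_block (restrict_forest F W) u v \<longleftrightarrow> same_block F u v \<and> u \<in> W \<and> v \<in> W"
  proof
    assume "same_block (restrict_forest F W) u v"
    then obtain B where "B \<in> blocks F" "u \<in> B \<inter> W" "v \<in> B \<inter> W"
      by (auto simp: restrict_forest_def same_block_def)
    thus "same_block F u v \<and> u \<in> W \<and> v \<in> W" by (auto simp: same_block_def)
  next
    assume "same_block F u v \<and> u \<in> W \<and> v \<in> W"
    then obtain B where B: "B \<in> blocks F" "u \<in> B \<inter> W" "v \<in> B \<inter> W"
      by (auto simp: same_block_def)
    hence "B \<inter> W \<in> blocks (restrict_forest F W)" by (auto simp: restrict_forest_def)
    thus "same_block (restrict_forest F W) u v"
      unfolding same_block_def by (rule bexI[rotated]) (use B in simp)
  qed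
qed (auto simp: restrict_forest_def)

lemma part_forest_restrict:
  assumes F: "part_forest F" shows "part_forest (restrict_forest F W)"
proof -
  note D = part_forestD[OF F]
  obtain h :: "_ \<Rightarrow> nat" where h: "\<And>u v. (u, v) \<in> edges F \<Longrightarrow> h u < h v"
    using F by (auto simp: part_forest_def rooted_forest_rank)
  have "rooted_forest (restrict_forest F W)"
    unfolding rooted_forest_rank
  proof (intro conjI allI impI)
    show "edges (restrict_forest F W) \<subseteq> verts (restrict_forest F W) \<times> verts (restrict_forest F W)"
      using D(2,3) by auto
    show "u = u'" if "(u, v) \<in> edges (restrict_forest F W) \<and> (u', v) \<in> edges (restrict_forest F W)" for u u' v
      using that D(4)[of u v u'] by auto
  qed (use D(1) h in auto)
  moreover have "partition_on (verts F \<inter> W) (blocks (restrict_forest F W))"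
    using partition_on_restrict[OF D(5), of W] by (simp add: restrict_forest_def Int_commute)
  moreover have "(u \<in> roots (restrict_forest F W) \<and> v \<in> roots (restrict_forest F W)) \<or>
     (\<exists>p. (p, u) \<in> edges (restrict_forest F W) \<and> (p, v) \<in> edges (restrict_forest F W))"
    if "same_block (restrict_forest F W) u v" for u v
    using that D(6,7,11)[of u v] by (auto simp: roots_def)
  ultimately show ?thesis unfolding part_forest_iff by simp
qed

lemma roots_restrict:
  assumes "part_forest F"
  shows "v \<in> roots (restrict_forest F W) \<longleftrightarrow> v \<in> verts F \<and> v \<in> W \<and> (\<forall>u\<in>W. (u, v) \<notin> edges F)"
  by (auto simp: roots_def)

lemma idealsD:
  assumes "I \<in> ideals F"
  shows "I \<subseteq> verts F" "v \<in> I \<Longrightarrow> (v, w) \<in> edges F \<Longrightarrow> w \<in> I"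
  using assms by (auto simp: ideals_def)

text \<open>A vertex outside an ideal has its parent outside too, so removing the ideal creates no
  root. For a partitioned tree the remaining roots therefore stay in one block, and
  \<open>R\<^sup>I\<close> is formed without merging.\<close>

lemma roots_restrict_compl:
  assumes F: "part_forest F" and I: "I \<in> ideals F"
  shows "roots (restrict_forest F (verts F - I)) = roots F - I"
  using idealsD(2)[OF I] part_forestD(2)[OF F] unfolding roots_def restrict_simps by blast

lemma part_tree_restrict_compl:
  assumes F: "part_tree F" and I: "I \<in> ideals F"
  shows "part_tree (restrict_forest F (verts F - I))"
  using F part_forest_restrict[of F] roots_restrict_compl[OF part_treeD[OF F] I] roots_subset[of F]
  unfolding part_tree_iff by auto

lemma iso_restrict:
  assumes F: "part_forest F" and G: "part_forest G" and i: "pf_iso \<phi> F G"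
    and W: "\<And>v. v \<in> verts F \<Longrightarrow> \<phi> v \<in> W' \<longleftrightarrow> v \<in> W"
  shows "pf_iso \<phi> (restrict_forest F W) (restrict_forest G W')"
proof (rule pf_isoI[OF part_forest_restrict[OF F] part_forest_restrict[OF G]])
  note D = pf_isoD[OF F i]
  have "\<phi> ` (verts F \<inter> W) = verts G \<inter> W'" using D(3) W by auto
  thus "bij_betw \<phi> (verts (restrict_forest F W)) (verts (restrict_forest G W'))"
    using inj_on_subset[OF D(2)] by (auto simp: bij_betw_def)
qed (use pf_isoD[OF F i] W in auto)

subsection \<open>Merging the roots\<close>

lemma merge_simps [simp]:
  "verts (merge_roots F) = verts F" "edges (merge_roots F) = edges F" "dec (merge_roots F) = dec F"
  "roots (merge_roots F) = roots F"
  by (auto simp: merge_roots_def roots_def)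

text \<open>A block that meets the roots consists of roots, so merging absorbs whole blocks and
  breaks none.\<close>

lemma same_block_merge:
  assumes F: "part_forest F"
  shows "same_block (merge_roots F) u v \<longleftrightarrow> same_block F u v \<or> (u \<in> roots F \<and> v \<in> roots F)"
proof -
  have nr: "\<not> B \<subseteq> roots F" if "B \<in> blocks F" "u \<in> B" "u \<notin> roots F" for B u using that by auto
  have rt: "v \<in> roots F" if "B \<in> blocks F" "u \<in> B" "u \<in> roots F" "v \<in> B" for B u v
    using that part_forestD(12)[OF F, of u v] by (auto simp: same_block_def)
  show ?thesis
  proof (cases "u \<in> roots F")
    case True
    thus ?thesis using rt by (auto simp: same_block_def merge_roots_def)
  next
    case False
    thus ?thesis using nr by (auto simp: same_block_def merge_roots_def)
  qed
qed

lemma part_tree_merge: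
  assumes F: "part_forest F" shows "part_tree (merge_roots F)"
proof -
  note D = part_forestD[OF F]
  have "partition_on (verts F) (blocks (merge_roots F))"
  proof (rule partition_onI')
    show "v \<in> verts F \<longleftrightarrow> (\<exists>B\<in>blocks (merge_roots F). v \<in> B)" for v
      using same_block_merge[OF F, of v v] D(6,8) roots_subset[of F] by (auto simp: same_block_def)
    show "{} \<notin> blocks (merge_roots F)"
      by (auto simp: merge_roots_def)
    have "B \<inter> roots F = {}" if "B \<in> blocks F" "\<not> B \<subseteq> roots F" for B
      using that D(12) by (auto simp: same_block_def)
    thus "B = C" if "B \<in> blocks (merge_roots F)" "C \<in> blocks (merge_roots F)" "v \<in> B" "v \<in> C" for B C v
      using that partition_on_unique[OF D(5), of B C v] by (auto simp: merge_roots_def split: if_splits)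
  qed
  thus ?thesis using F D(12) unfolding part_tree_iff part_forest_iff
    by (auto simp: same_block_merge[OF F] rooted_forest_def)
qed

lemma iso_merge:
  assumes F: "part_forest F" and G: "part_forest G" and i: "pf_iso \<phi> F G"
  shows "pf_iso \<phi> (merge_roots F) (merge_roots G)"
  by (rule pf_isoI)
    (use F G part_tree_merge part_treeD pf_isoD[OF F i] roots_iso[OF F G i] in \<open>auto simp: same_block_merge\<close>)

lemma same_block_merge_tree:
  assumes "part_tree F"
  shows "same_block (merge_roots F) u v \<longleftrightarrow> same_block F u v"
  using assms same_block_merge[of F u v] by (auto simp: part_tree_iff)

subsection \<open>Disjoint unions\<close>

lemma disj_union_simps [simp]:
  "verts (disj_union F G) = verts F <+> verts G"
  "(Inl u, Inl v) \<in> edges (disj_union F G) \<longleftrightarrow> (u, v) \<in> edges F"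
  "(Inr x, Inr y) \<in> edges (disj_union F G) \<longleftrightarrow> (x, y) \<in> edges G"
  "(Inl u, Inr y) \<notin> edges (disj_union F G)"
  "(Inr x, Inl v) \<notin> edges (disj_union F G)"
  "dec (disj_union F G) (Inl u) = dec F u"
  "dec (disj_union F G) (Inr x) = dec G x"
  "same_block (disj_union F G) (Inl u) (Inl v) \<longleftrightarrow> same_block F u v"
  "same_block (disj_union F G) (Inr x) (Inr y) \<longleftrightarrow> same_block G x y"
  "\<not> same_block (disj_union F G) (Inl u) (Inr y)"
  "\<not> same_block (disj_union F G) (Inr x) (Inl v)"
  by (auto simp: disj_union_def same_block_def)

lemma roots_disj_union [simp]:
  "Inl u \<in> roots (disj_union F G) \<longleftrightarrow> u \<in> roots F"
  "Inr x \<in> roots (disj_union F G) \<longleftrightarrow> x \<in> roots G"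
  "roots (disj_union F G) = roots F <+> roots G"
proof -
  have 1: "Inl u \<in> roots (disj_union F G) \<longleftrightarrow> u \<in> roots F" for u
    by (auto simp: roots_def disj_union_def)
  have 2: "Inr x \<in> roots (disj_union F G) \<longleftrightarrow> x \<in> roots G" for x
    by (auto simp: roots_def disj_union_def)
  show "Inl u \<in> roots (disj_union F G) \<longleftrightarrow> u \<in> roots F" "Inr x \<in> roots (disj_union F G) \<longleftrightarrow> x \<in> roots G"
    by (rule 1, rule 2)
  show "roots (disj_union F G) = roots F <+> roots G"
  proof (rule set_eqI)
    show "y \<in> roots (disj_union F G) \<longleftrightarrow> y \<in> roots F <+> roots G" for y
      by (cases y) (auto simp: 1 2)
  qed
qed

lemma part_forest_disj_union:
  assumes F: "part_forest F" and G: "part_forest G"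
  shows "part_forest (disj_union F G)"
proof -
  note D = part_forestD[OF F] and E = part_forestD[OF G]
  obtain h :: "_ \<Rightarrow> nat" where h: "\<And>u v. (u, v) \<in> edges F \<Longrightarrow> h u < h v"
    using F by (auto simp: part_forest_def rooted_forest_rank)
  obtain k :: "_ \<Rightarrow> nat" where k: "\<And>u v. (u, v) \<in> edges G \<Longrightarrow> k u < k v"
    using G by (auto simp: part_forest_def rooted_forest_rank)
  have ec: "e \<in> edges (disj_union F G) \<Longrightarrow> (\<exists>u v. e = (Inl u, Inl v) \<and> (u, v) \<in> edges F) \<or>
     (\<exists>u v. e = (Inr u, Inr v) \<and> (u, v) \<in> edges G)" for e
    by (auto simp: disj_union_def)
  have "rooted_forest (disj_union F G)"
    unfolding rooted_forest_rank
  proof (intro conjI allI impI)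
    show "finite (verts (disj_union F G))" using D(1) E(1) by simp
    show "edges (disj_union F G) \<subseteq> verts (disj_union F G) \<times> verts (disj_union F G)"
      by (rule subsetI) (drule ec, use D(2,3) E(2,3) in auto)
    show "u = u'" if "(u, v) \<in> edges (disj_union F G) \<and> (u', v) \<in> edges (disj_union F G)" for u u' v
      using that ec[of "(u, v)"] ec[of "(u', v)"] D(4) E(4) by auto
    show "\<exists>h::_ \<Rightarrow> nat. \<forall>u v. (u, v) \<in> edges (disj_union F G) \<longrightarrow> h u < h v"
    proof (intro exI[of _ "case_sum h k"] allI impI)
      show "case_sum h k u < case_sum h k v" if "(u, v) \<in> edges (disj_union F G)" for u v
        using ec[OF that] h k by auto
    qed
  qed
  moreover have "partition_on (verts F <+> verts G) (blocks (disj_union F G))"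
  proof (rule partition_onI')
    show "v \<in> verts F <+> verts G \<longleftrightarrow> (\<exists>B\<in>blocks (disj_union F G). v \<in> B)" for v
      using partition_onD1[OF D(5)] partition_onD1[OF E(5)] by (auto simp: disj_union_def)
    show "{} \<notin> blocks (disj_union F G)"
      using partition_onD3[OF D(5)] partition_onD3[OF E(5)] by (auto simp: disj_union_def)
    show "B = C" if BC: "B \<in> blocks (disj_union F G)" "C \<in> blocks (disj_union F G)" "v \<in> B" "v \<in> C" for B C v
    proof (cases v)
      case (Inl w)
      then obtain B' C' where "B = Inl ` B'" "C = Inl ` C'" "B' \<in> blocks F" "C' \<in> blocks F" "w \<in> B'" "w \<in> C'"
        using BC by (auto simp: disj_union_def)
      thus ?thesis using partition_on_unique[OF D(5), of B' C' w] by simp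
    next
      case (Inr w)
      then obtain B' C' where "B = Inr ` B'" "C = Inr ` C'" "B' \<in> blocks G" "C' \<in> blocks G" "w \<in> B'" "w \<in> C'"
        using BC by (auto simp: disj_union_def)
      thus ?thesis using partition_on_unique[OF E(5), of B' C' w] by simp
    qed
  qed
  moreover have "(u \<in> roots (disj_union F G) \<and> v \<in> roots (disj_union F G)) \<or>
     (\<exists>p. (p, u) \<in> edges (disj_union F G) \<and> (p, v) \<in> edges (disj_union F G))"
    if "same_block (disj_union F G) u v" for u v
  proof (cases u; cases v)
    fix a b assume *: "u = Inl a" "v = Inl b"
    hence "same_block F a b" using that by simp
    hence "(a \<in> roots F \<and> b \<in> roots F) \<or> (\<exists>p. (p, a) \<in> edges F \<and> (p, b) \<in> edges F)"
      using F by (simp add: part_forest_iff)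
    thus ?thesis using * by (metis disj_union_simps(2) roots_disj_union(1))
  next
    fix a b assume *: "u = Inr a" "v = Inr b"
    hence "same_block G a b" using that by simp
    hence "(a \<in> roots G \<and> b \<in> roots G) \<or> (\<exists>p. (p, a) \<in> edges G \<and> (p, b) \<in> edges G)"
      using G by (simp add: part_forest_iff)
    thus ?thesis using * by (metis disj_union_simps(3) roots_disj_union(2))
  qed (use that in auto)
  ultimately show ?thesis unfolding part_forest_iff by simp
qed

lemma iso_disj_union:
  assumes F: "part_forest F" "part_forest F'" "pf_iso \<phi> F F'"
    and G: "part_forest G" "part_forest G'" "pf_iso \<psi> G G'"
  shows "pf_iso (map_sum \<phi> \<psi>) (disj_union F G) (disj_union F' G')"
proof (rule pf_isoI[OF part_forest_disj_union[OF F(1) G(1)] part_forest_disj_union[OF F(2) G(2)]])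
  note D = pf_isoD[OF F(1,3)] and E = pf_isoD[OF G(1,3)]
  have "inj_on (map_sum \<phi> \<psi>) (verts F <+> verts G)"
    by (rule inj_onI) (auto simp: D(8) E(8))
  moreover have "map_sum \<phi> \<psi> ` (verts F <+> verts G) = \<phi> ` verts F <+> \<psi> ` verts G"
    by (simp add: Plus_def image_Un image_image)
  ultimately show "bij_betw (map_sum \<phi> \<psi>) (verts (disj_union F G)) (verts (disj_union F' G'))"
    by (simp add: bij_betw_def D(3) E(3))
  fix u v assume uv: "u \<in> verts (disj_union F G)" "v \<in> verts (disj_union F G)"
  show "(u, v) \<in> edges (disj_union F G) \<longleftrightarrow> (map_sum \<phi> \<psi> u, map_sum \<phi> \<psi> v) \<in> edges (disj_union F' G')"
    using uv by (auto simp: D(5) E(5))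
  show "same_block (disj_union F G) u v \<longleftrightarrow> same_block (disj_union F' G') (map_sum \<phi> \<psi> u) (map_sum \<phi> \<psi> v)"
    using uv by (auto simp: D(6) E(6))
  show "dec (disj_union F' G') (map_sum \<phi> \<psi> v) = dec (disj_union F G) v"
    using uv by (auto simp: D(7) E(7))
qed

subsection \<open>Isomorphism classes\<close>

text \<open>A copy of a forest along a map injective on its vertices, used to move to
  \<open>nat\<close> and to an initial segment of it. Decorations are pulled back, so the inverse is
  taken on \<open>verts F\<close>.\<close>

definition relabel :: "('v \<Rightarrow> 'w) \<Rightarrow> ('v, 'd) pforest \<Rightarrow> ('w, 'd) pforest" where
  "relabel \<phi> F = \<lparr>verts = \<phi> ` verts F, edges = map_prod \<phi> \<phi> ` edges F,
     blocks = (`) \<phi> ` blocks F, dec = dec F \<circ> inv_into (verts F) \<phi>\<rparr>"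

lemma relabel:
  assumes F: "part_forest F" and inj: "inj_on \<phi> (verts F)"
  shows "part_forest (relabel \<phi> F)" "pf_iso \<phi> F (relabel \<phi> F)"
proof -
  note D = part_forestD[OF F]
  let ?G = "relabel \<phi> F"
  obtain h :: "_ \<Rightarrow> nat" where h: "\<And>u v. (u, v) \<in> edges F \<Longrightarrow> h u < h v"
    using F by (auto simp: part_forest_def rooted_forest_rank)
  have V: "verts ?G = \<phi> ` verts F" by (simp add: relabel_def)
  have E: "\<exists>u v. x = \<phi> u \<and> y = \<phi> v \<and> (u, v) \<in> edges F \<and> u \<in> verts F \<and> v \<in> verts F"
    if "(x, y) \<in> edges ?G" for x y
  proof -
    have "(x, y) \<in> map_prod \<phi> \<phi> ` edges F" using that by (simp add: relabel_def)
    then obtain u v where "x = \<phi> u" "y = \<phi> v" "(u, v) \<in> edges F" by auto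
    thus ?thesis using D(2,3)[of u v] by blast
  qed
  have E': "(\<phi> u, \<phi> v) \<in> edges ?G" if "(u, v) \<in> edges F" for u v
    using that by (auto simp: relabel_def)
  have injD: "u = v" if "\<phi> u = \<phi> v" "u \<in> verts F" "v \<in> verts F" for u v
    using that inj by (auto simp: inj_on_def)
  have E2: "(\<phi> u, \<phi> v) \<in> edges ?G \<longleftrightarrow> (u, v) \<in> edges F" if "u \<in> verts F" "v \<in> verts F" for u v
  proof
    assume "(\<phi> u, \<phi> v) \<in> edges ?G"
    from E[OF this] obtain u' v' where "\<phi> u = \<phi> u'" "\<phi> v = \<phi> v'" "(u', v') \<in> edges F"
      "u' \<in> verts F" "v' \<in> verts F" by blast
    thus "(u, v) \<in> edges F" using that injD[of u u'] injD[of v v'] by simp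
  qed (rule E')
  have rf: "rooted_forest ?G"
    unfolding rooted_forest_rank
  proof (intro conjI allI impI)
    show "finite (verts ?G)" using D(1) by (simp add: V)
    show "edges ?G \<subseteq> verts ?G \<times> verts ?G"
    proof
      fix e assume "e \<in> edges ?G"
      moreover obtain x y where "e = (x, y)" by (cases e)
      ultimately show "e \<in> verts ?G \<times> verts ?G" using E[of x y] by (auto simp: V)
    qed
    show "x = x'" if xx: "(x, y) \<in> edges ?G \<and> (x', y) \<in> edges ?G" for x x' y
    proof -
      obtain u v where 1: "x = \<phi> u" "y = \<phi> v" "(u, v) \<in> edges F" "v \<in> verts F"
        using E[of x y] xx by blast
      obtain u' v' where 2: "x' = \<phi> u'" "y = \<phi> v'" "(u', v') \<in> edges F" "v' \<in> verts F"
        using E[of x' y] xx by blast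
      have "v = v'" using injD[of v v'] 1 2 by simp
      thus ?thesis using D(4)[of u v u'] 1 2 by simp
    qed
    show "\<exists>k::_ \<Rightarrow> nat. \<forall>x y. (x, y) \<in> edges ?G \<longrightarrow> k x < k y"
    proof (intro exI[of _ "h \<circ> inv_into (verts F) \<phi>"] allI impI)
      fix x y assume "(x, y) \<in> edges ?G"
      from E[OF this] show "(h \<circ> inv_into (verts F) \<phi>) x < (h \<circ> inv_into (verts F) \<phi>) y"
        using h inj by (auto simp: inv_into_f_f)
    qed
  qed
  have "{} \<notin> (`) \<phi> ` blocks F" using partition_onD3[OF D(5)] by auto
  hence part: "partition_on (verts ?G) (blocks ?G)"
    using partition_on_inj_image[OF D(5) inj] by (simp add: relabel_def)
  have sb: "\<exists>u v. x = \<phi> u \<and> y = \<phi> v \<and> same_block F u v" if "same_block ?G x y" for x y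
    using that by (auto simp: same_block_def relabel_def)
  have r: "\<phi> u \<in> roots ?G" if u: "u \<in> roots F" for u
  proof -
    have "(x, \<phi> u) \<notin> edges ?G" for x
    proof
      assume "(x, \<phi> u) \<in> edges ?G"
      from E[OF this] obtain u' v' where "\<phi> u = \<phi> v'" "(u', v') \<in> edges F" "v' \<in> verts F" by blast
      thus False using u injD[of u v'] roots_subset[of F] by (auto simp: roots_def)
    qed
    thus ?thesis using u by (auto simp: roots_def V)
  qed
  show G: "part_forest ?G"
    unfolding part_forest_iff
  proof (intro conjI allI impI rf part)
    fix x y assume "same_block ?G x y"
    from sb[OF this] obtain u v where uv: "x = \<phi> u" "y = \<phi> v" "same_block F u v" by blast
    hence "(u \<in> roots F \<and> v \<in> roots F) \<or> (\<exists>p. (p, u) \<in> edges F \<and> (p, v) \<in> edges F)"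
      using F by (simp add: part_forest_iff)
    thus "(x \<in> roots ?G \<and> y \<in> roots ?G) \<or> (\<exists>p. (p, x) \<in> edges ?G \<and> (p, y) \<in> edges ?G)"
    proof
      assume "\<exists>p. (p, u) \<in> edges F \<and> (p, v) \<in> edges F"
      then obtain p where "(p, u) \<in> edges F" "(p, v) \<in> edges F" by blast
      hence "(\<phi> p, x) \<in> edges ?G \<and> (\<phi> p, y) \<in> edges ?G" using E' uv by simp
      thus ?thesis by blast
    qed (use r uv in simp)
  qed
  show "pf_iso \<phi> F ?G"
    unfolding pf_iso_def using inj E2
    by (auto simp: bij_betw_def relabel_def inv_into_f_f)
qed

lemma pf_isomorphicI: "pf_iso \<phi> F G \<Longrightarrow> pf_isomorphic F G"
  by (auto simp: pf_isomorphic_def)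

lemma pf_isomorphic_sym: "part_tree F \<Longrightarrow> pf_isomorphic F G \<Longrightarrow> pf_isomorphic G F"
  unfolding pf_isomorphic_def by (blast dest: pf_iso_sym)

lemma pf_isomorphic_trans:
  "part_tree F \<Longrightarrow> pf_isomorphic F G \<Longrightarrow> pf_isomorphic G H \<Longrightarrow> pf_isomorphic F H"
  unfolding pf_isomorphic_def by (blast dest: pf_iso_trans)

text \<open>Makes the choice in \<open>ptree_class\<close> meaningful for every vertex type: a
  finite vertex set embeds in \<open>nat\<close>.\<close>

lemma ex_nat_copy:
  assumes F: "part_tree F"
  shows "\<exists>G::(nat, 'd) pforest. part_tree G \<and> pf_isomorphic F G"
proof -
  obtain \<phi> :: "'a \<Rightarrow> nat" where inj: "inj_on \<phi> (verts F)"
    using finite_imp_inj_to_nat_seg[OF part_forestD(1)[OF part_treeD[OF F]]] by blast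
  note R = relabel[OF part_treeD[OF F] inj]
  show ?thesis using R(2) part_tree_iso[OF part_treeD[OF F] R F] by (blast intro: pf_isomorphicI)
qed

lemma ptree_class_some:
  assumes F: "part_tree F"
  obtains G where "part_tree G" "pf_isomorphic F G" "ptree_class F = abs_ptree G"
  using someI_ex[OF ex_nat_copy[OF F]] by (auto simp: ptree_class_def)

lemma part_tree_rep: "part_tree (rep_ptree T)"
  using Quotient3_rep_reflp[OF Quotient3_ptree, of T] by simp

lemmas part_forest_rep = part_treeD[OF part_tree_rep]

lemma abs_ptree_eq: "part_tree F \<Longrightarrow> part_tree G \<Longrightarrow> pf_isomorphic F G \<Longrightarrow> abs_ptree F = abs_ptree G"
  using Quotient3_rel_abs[OF Quotient3_ptree, of F G] by simp

lemma rep_abs_ptree: "part_tree F \<Longrightarrow> pf_isomorphic (rep_ptree (abs_ptree F)) F"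
  using Quotient3_rep_abs[OF Quotient3_ptree, of F] pf_iso_refl[of F] by (auto simp: pf_isomorphic_def)

lemma ptree_class_eq:
  assumes F: "part_tree F" and G: "part_tree G" and i: "pf_isomorphic F G"
  shows "ptree_class F = ptree_class G"
proof -
  obtain F' where F': "part_tree F'" "pf_isomorphic F F'" "ptree_class F = abs_ptree F'"
    using ptree_class_some[OF F] .
  obtain G' where G': "part_tree G'" "pf_isomorphic G G'" "ptree_class G = abs_ptree G'"
    using ptree_class_some[OF G] .
  have "pf_isomorphic F' F" by (rule pf_isomorphic_sym[OF F F'(2)])
  hence "pf_isomorphic F' G" using i by (rule pf_isomorphic_trans[OF F'(1)])
  hence "pf_isomorphic F' G'" using G'(2) by (rule pf_isomorphic_trans[OF F'(1)])
  thus ?thesis using abs_ptree_eq F' G' by simp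
qed

lemma ptree_class_eqI:
  assumes "part_tree F" "part_tree G" "pf_iso \<phi> F G"
  shows "ptree_class F = ptree_class G"
  using ptree_class_eq[OF assms(1,2)] pf_isomorphicI[OF assms(3)] by blast

text \<open>Through this isomorphism the invariants of a class, which are defined on
  \<open>rep_ptree\<close>, are computed on any forest at hand.\<close>

lemma rep_ptree_class:
  assumes F: "part_tree F" obtains \<phi> where "pf_iso \<phi> F (rep_ptree (ptree_class F))"
proof -
  obtain G where G: "part_tree G" "pf_isomorphic F G" "ptree_class F = abs_ptree G"
    using ptree_class_some[OF F] .
  have "pf_isomorphic G (rep_ptree (abs_ptree G))"
    by (rule pf_isomorphic_sym[OF part_tree_rep rep_abs_ptree[OF G(1)]])
  hence "pf_isomorphic F (rep_ptree (ptree_class F))"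
    using pf_isomorphic_trans[OF F G(2)] G(3) by simp
  thus ?thesis using that by (auto simp: pf_isomorphic_def)
qed

lemma ptree_class_rep [simp]: "ptree_class (rep_ptree T) = T"
proof -
  obtain G where G: "part_tree G" "pf_isomorphic (rep_ptree T) G" "ptree_class (rep_ptree T) = abs_ptree G"
    using ptree_class_some[OF part_tree_rep] .
  have "abs_ptree (rep_ptree T) = abs_ptree G" by (rule abs_ptree_eq[OF part_tree_rep G(1,2)])
  thus ?thesis using G(3) Quotient3_abs_rep[OF Quotient3_ptree] by metis
qed

definition nroots :: "'d ptree \<Rightarrow> nat" where "nroots T = card (roots (rep_ptree T))"

definition nverts :: "'d ptree \<Rightarrow> nat" where "nverts T = card (verts (rep_ptree T))"

lemma nroots_class: "part_tree F \<Longrightarrow> nroots (ptree_class F) = card (roots F)"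
proof -
  assume F: "part_tree F"
  obtain \<phi> where "pf_iso \<phi> F (rep_ptree (ptree_class F))" by (rule rep_ptree_class[OF F])
  thus ?thesis unfolding nroots_def
    using bij_betw_same_card[OF roots_iso_image(2)[OF part_treeD[OF F] part_forest_rep]] by metis
qed

lemma nverts_class: "part_tree F \<Longrightarrow> nverts (ptree_class F) = card (verts F)"
proof -
  assume F: "part_tree F"
  obtain \<phi> where "pf_iso \<phi> F (rep_ptree (ptree_class F))" by (rule rep_ptree_class[OF F])
  thus ?thesis unfolding nverts_def
    using bij_betw_same_card[OF pf_isoD(1)[OF part_treeD[OF F]]] by metis
qed

lemma PT_class: "part_tree F \<Longrightarrow> ptree_class F \<in> PT D \<longleftrightarrow> dec F ` verts F \<subseteq> D"
proof -
  assume F: "part_tree F"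
  obtain \<phi> where i: "pf_iso \<phi> F (rep_ptree (ptree_class F))" by (rule rep_ptree_class[OF F])
  note J = pf_isoD[OF part_treeD[OF F] i]
  have "dec (rep_ptree (ptree_class F)) ` verts (rep_ptree (ptree_class F)) = dec F ` verts F"
    unfolding J(3) image_image using J(7) by simp
  thus ?thesis by (simp add: PT_def)
qed

lemma PT1_iff: "T \<in> PT1 D \<longleftrightarrow> T \<in> PT D \<and> nroots T = 1"
  by (simp add: PT1_def nroots_def)

lemma finite_roots: "part_forest F \<Longrightarrow> finite (roots F)"
  by (rule finite_subset[OF roots_subset part_forestD(1)])

text \<open>A vertex of least rank has no parent.\<close>

lemma roots_empty_iff:
  assumes F: "part_forest F" shows "roots F = {} \<longleftrightarrow> verts F = {}"
proof
  assume r: "roots F = {}"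
  obtain h :: "_ \<Rightarrow> nat" where h: "\<And>u v. (u, v) \<in> edges F \<Longrightarrow> h u < h v"
    using F by (auto simp: part_forest_def rooted_forest_rank)
  show "verts F = {}"
  proof (rule ccontr)
    assume "verts F \<noteq> {}"
    then obtain v0 where "v0 \<in> verts F" by blast
    then obtain v where v: "v \<in> verts F" "\<And>w. w \<in> verts F \<Longrightarrow> h v \<le> h w"
      using exists_least_iff[of "\<lambda>n. \<exists>v\<in>verts F. h v = n"] by (metis leI)
    then obtain u where u: "(u, v) \<in> edges F" using r by (auto simp: roots_def)
    show False using v(2)[OF part_forestD(2)[OF F u]] h[OF u] by simp
  qed
qed (auto simp: roots_def)

lemma empty_forest_simps [simp]: "verts empty_forest = {}" "edges empty_forest = {}" "blocks empty_forest = {}"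
  by (simp_all add: empty_forest_def)

lemma ptree_class_empty:
  assumes F: "part_tree F" and V: "verts F = {}"
  shows "ptree_class F = empty_ptree"
  unfolding empty_ptree_def
proof (rule ptree_class_eqI[OF F part_tree_empty_forest])
  show "pf_iso (\<lambda>_. 0) F empty_forest"
    by (rule pf_isoI[OF part_treeD[OF F] part_treeD[OF part_tree_empty_forest]])
      (simp_all add: V bij_betw_def)
qed

lemma nroots_eq_0: "nroots T = 0 \<longleftrightarrow> T = empty_ptree"
proof
  assume "nroots T = 0"
  hence "verts (rep_ptree T) = {}"
    using roots_empty_iff[OF part_forest_rep, of T] finite_roots[OF part_forest_rep, of T] by (simp add: nroots_def)
  thus "T = empty_ptree" using ptree_class_empty[OF part_tree_rep] by simp
qed (auto simp: empty_ptree_def nroots_class[OF part_tree_empty_forest] roots_def)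

lemma nroots_empty [simp]: "nroots empty_ptree = 0"
  by (simp add: nroots_eq_0)

lemma empty_in_PT: "empty_ptree \<in> PT D"
  by (simp add: empty_ptree_def PT_class[OF part_tree_empty_forest])

lemma ptree_class_empty_iff:
  assumes F: "part_tree F" shows "ptree_class F = empty_ptree \<longleftrightarrow> verts F = {}"
proof
  assume "ptree_class F = empty_ptree"
  hence "card (roots F) = 0" using nroots_class[OF F] nroots_eq_0 by metis
  thus "verts F = {}"
    using finite_roots[OF part_treeD[OF F]] roots_empty_iff[OF part_treeD[OF F]] by simp
qed (rule ptree_class_empty[OF F])

subsection \<open>Finitely many trees of given size\<close>

text \<open>A copy on the first \<open>n\<close> numbers is given by its edges, blocks and
  decoration, each taken from a finite set. In the applications \<open>E\<close> consists of the
  decorations of given trees, whatever the size of \<open>D\<close>.\<close>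

lemma finite_ptrees:
  assumes E: "finite E" shows "finite {T :: 'd ptree. nverts T = n \<and> T \<in> PT E}"
proof -
  let ?mk = "\<lambda>(R, B, f). ptree_class \<lparr>verts = {..<n}, edges = R, blocks = B, dec = f\<rparr> :: 'd ptree"
  let ?P = "Pow ({..<n} \<times> {..<n}) \<times> Pow (Pow {..<n}) \<times> ({..<n} \<rightarrow>\<^sub>E E)"
  have "finite ?P" using E by (intro finite_cartesian_product finite_PiE) auto
  moreover have "{T :: 'd ptree. nverts T = n \<and> T \<in> PT E} \<subseteq> ?mk ` ?P"
  proof
    fix T :: "'d ptree" assume "T \<in> {T. nverts T = n \<and> T \<in> PT E}"
    hence n: "card (verts (rep_ptree T)) = n" and PT: "dec (rep_ptree T) ` verts (rep_ptree T) \<subseteq> E"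
      by (auto simp: nverts_def PT_def)
    let ?F = "rep_ptree T"
    have "finite (verts ?F)" by (rule part_forestD(1)[OF part_forest_rep])
    then obtain \<phi> where b: "bij_betw \<phi> (verts ?F) {0..<n}"
      using ex_bij_betw_finite_nat n by blast
    hence inj: "inj_on \<phi> (verts ?F)" and im: "\<phi> ` verts ?F = {..<n}"
      by (auto simp: bij_betw_def atLeast0LessThan)
    note R = relabel[OF part_forest_rep inj]
    let ?G = "relabel \<phi> ?F"
    \<comment> \<open>Values outside the vertices are cut off, so that decorations range over a
      finite function space.\<close>
    let ?f = "restrict (dec ?G) {..<n}"
    let ?H = "\<lparr>verts = {..<n}, edges = edges ?G, blocks = blocks ?G, dec = ?f\<rparr>"
    have V: "verts ?G = {..<n}" using im by (simp add: relabel_def)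
    have H: "part_forest ?H"
      using R(1) V unfolding part_forest_def rooted_forest_def by (simp add: roots_def)
    have i: "pf_iso \<phi> ?F ?H"
      using R(2) V im unfolding pf_iso_def by auto
    have "part_tree ?H" by (rule part_tree_iso[OF part_forest_rep H i part_tree_rep])
    hence T: "T = ptree_class ?H" using ptree_class_eqI[OF part_tree_rep _ i] by simp
    have "edges ?G \<subseteq> {..<n} \<times> {..<n}" using part_forestD(2,3)[OF R(1)] V by auto
    moreover have "blocks ?G \<subseteq> Pow {..<n}" using partition_onD1[OF part_forestD(5)[OF R(1)]] V by auto
    moreover have "dec ?G v \<in> E" if "v < n" for v
    proof -
      have "v \<in> \<phi> ` verts ?F" using that im by simp
      then obtain u where "u \<in> verts ?F" "v = \<phi> u" by blast
      thus ?thesis using pf_isoD(7)[OF part_forest_rep R(2)] PT by auto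
    qed
    hence "?f \<in> {..<n} \<rightarrow>\<^sub>E E" by auto
    ultimately have P: "(edges ?G, blocks ?G, ?f) \<in> ?P" by blast
    have "T = ?mk (edges ?G, blocks ?G, ?f)" unfolding split_conv by (rule T)
    thus "T \<in> ?mk ` ?P" using P by (rule image_eqI)
  qed
  ultimately show ?thesis by (meson finite_surj)
qed

section \<open>The Hopf algebra structure of the dual\<close>

lemma lookup_pscale [simp]: "Poly_Mapping.lookup (pscale c x) a = c * Poly_Mapping.lookup x a"
  by (simp add: pscale_def Poly_Mapping.map.rep_eq when_def)

lemma pscale_one [simp]: "pscale 1 x = x"
  by (rule poly_mapping_eqI) simp

lemma lin_ext_single [simp]: "lin_ext m (Poly_Mapping.single a 1) = m a"
  by (simp add: lin_ext_def)

lemma bilin_ext_single [simp]: "bilin_ext m (Poly_Mapping.single a 1) (Poly_Mapping.single b 1) = m a b"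
  by (simp add: bilin_ext_def)

lemma evaluate_superset:
  "finite S \<Longrightarrow> Poly_Mapping.keys x \<subseteq> S \<Longrightarrow> evaluate f x = (\<Sum>a\<in>S. Poly_Mapping.lookup x a * f a)"
  unfolding evaluate_def by (rule sum.mono_neutral_left) (auto simp: in_keys_iff)

lemma evaluate_add: "evaluate f (x + y) = evaluate f x + evaluate f y"
proof -
  let ?S = "Poly_Mapping.keys x \<union> Poly_Mapping.keys y"
  have S: "finite ?S" by simp
  have 1: "evaluate f x = (\<Sum>a\<in>?S. Poly_Mapping.lookup x a * f a)" by (rule evaluate_superset[OF S]) simp
  have 2: "evaluate f y = (\<Sum>a\<in>?S. Poly_Mapping.lookup y a * f a)" by (rule evaluate_superset[OF S]) simp
  have 3: "evaluate f (x + y) = (\<Sum>a\<in>?S. Poly_Mapping.lookup (x + y) a * f a)"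
    by (rule evaluate_superset[OF S]) (rule keys_add)
  show ?thesis unfolding 1 2 3 by (simp add: lookup_add ring_distribs sum.distrib)
qed

lemma evaluate_single [simp]: "evaluate f (Poly_Mapping.single a 1) = f a"
  by (simp add: evaluate_def)

lemma evaluate_sum: "evaluate f (\<Sum>i\<in>I. x i) = (\<Sum>i\<in>I. evaluate f (x i))"
proof (induction I rule: infinite_finite_induct)
  case (insert i I)
  thus ?case by (simp add: evaluate_add)
qed (simp_all add: evaluate_def)

text \<open>The classes of \<open>R\<^sup>I(F)\<close> and \<open>P\<^sup>I(F)\<close>, and the product \<open>T \<cdot> T'\<close>.\<close>

definition lower :: "('v, 'd) pforest \<Rightarrow> 'v set \<Rightarrow> 'd ptree" where
  "lower F I = ptree_class (restrict_forest F (verts F - I))"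

definition upper :: "('v, 'd) pforest \<Rightarrow> 'v set \<Rightarrow> 'd ptree" where
  "upper F I = ptree_class (merge_roots (restrict_forest F I))"

definition tmul :: "'d ptree \<Rightarrow> 'd ptree \<Rightarrow> 'd ptree" where
  "tmul T T' = ptree_class (merge_roots (disj_union (rep_ptree T) (rep_ptree T')))"

lemma part_tree_upper: "part_forest F \<Longrightarrow> part_tree (merge_roots (restrict_forest F I))"
  by (intro part_tree_merge part_forest_restrict)

lemma part_tree_tmul: "part_forest F \<Longrightarrow> part_forest G \<Longrightarrow> part_tree (merge_roots (disj_union F G))"
  by (intro part_tree_merge part_forest_disj_union)

lemma finite_ideals: "part_forest F \<Longrightarrow> finite (ideals F)"
  using part_forestD(1) by (auto simp: ideals_def intro: finite_subset[of _ "Pow (verts F)"])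

lemma dual_mult_rep:
  "dual_mult f g T = (\<Sum>I\<in>ideals (rep_ptree T). f (lower (rep_ptree T) I) * g (upper (rep_ptree T) I))"
  by (simp add: dual_mult_def CP_comult_def Let_def evaluate_sum tens_def lower_def upper_def)

lemma bij_ideals:
  assumes F: "part_forest F" and G: "part_forest G" and i: "pf_iso \<phi> F G"
  shows "bij_betw ((`) \<phi>) (ideals F) (ideals G)"
proof (rule bij_betw_imageI)
  note D = pf_isoD[OF F i]
  show "inj_on ((`) \<phi>) (ideals F)"
    by (rule inj_on_subset[OF inj_on_image_Pow[OF D(2)]]) (auto simp: ideals_def)
  show "(`) \<phi> ` ideals F = ideals G"
  proof (intro equalityI subsetI)
    fix J assume "J \<in> (`) \<phi> ` ideals F"
    then obtain I where I: "I \<in> ideals F" "J = \<phi> ` I" by blast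
    show "J \<in> ideals G"
      unfolding ideals_def
    proof (intro CollectI conjI allI impI)
      show "J \<subseteq> verts G" using idealsD(1)[OF I(1)] D(3) I(2) by auto
      fix x y assume xy: "x \<in> J \<and> (x, y) \<in> edges G"
      then obtain u where u: "u \<in> I" "x = \<phi> u" using I(2) by blast
      have "y \<in> verts G" using part_forestD(3)[OF G] xy by blast
      then obtain v where v: "v \<in> verts F" "y = \<phi> v" using D(3) by auto
      have "u \<in> verts F" using u idealsD(1)[OF I(1)] by blast
      hence "(u, v) \<in> edges F" using D(5)[of u v] xy u v by simp
      hence "v \<in> I" by (rule idealsD(2)[OF I(1) u(1)])
      thus "y \<in> J" using I(2) v by blast
    qed
  next
    fix J assume J: "J \<in> ideals G"
    let ?I = "{v \<in> verts F. \<phi> v \<in> J}"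
    have "J \<subseteq> \<phi> ` verts F" using idealsD(1)[OF J] D(3) by simp
    hence "J = \<phi> ` ?I" by blast
    moreover have "?I \<in> ideals F"
      unfolding ideals_def
    proof (rule CollectI, intro conjI allI impI)
      fix u v assume uv: "u \<in> ?I \<and> (u, v) \<in> edges F"
      have v: "v \<in> verts F" using part_forestD(3)[OF F] uv by blast
      have "(\<phi> u, \<phi> v) \<in> edges G" using D(5)[of u v] uv v by simp
      hence "\<phi> v \<in> J" using idealsD(2)[OF J] uv by blast
      thus "v \<in> {v \<in> verts F. \<phi> v \<in> J}" using v by simp
    qed blast
    ultimately show "J \<in> (`) \<phi> ` ideals F" by blast
  qed
qed

lemma lower_iso:
  assumes F: "part_tree F" and G: "part_tree G" and i: "pf_iso \<phi> F G" and I: "I \<in> ideals F"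
  shows "lower G (\<phi> ` I) = lower F I"
  unfolding lower_def
proof (rule ptree_class_eqI[symmetric])
  note D = pf_isoD[OF part_treeD[OF F] i]
  have I': "\<phi> ` I \<in> ideals G" using bij_ideals[OF part_treeD[OF F] part_treeD[OF G] i] I by (auto simp: bij_betw_def)
  show "part_tree (restrict_forest F (verts F - I))" by (rule part_tree_restrict_compl[OF F I])
  show "part_tree (restrict_forest G (verts G - \<phi> ` I))" by (rule part_tree_restrict_compl[OF G I'])
  show "pf_iso \<phi> (restrict_forest F (verts F - I)) (restrict_forest G (verts G - \<phi> ` I))"
  proof (rule iso_restrict[OF part_treeD[OF F] part_treeD[OF G] i])
    show "\<phi> v \<in> verts G - \<phi> ` I \<longleftrightarrow> v \<in> verts F - I" if "v \<in> verts F" for v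
      using that D(4) inj_on_image_mem_iff[OF D(2) that idealsD(1)[OF I]] by simp
  qed
qed

lemma upper_iso:
  assumes F: "part_tree F" and G: "part_tree G" and i: "pf_iso \<phi> F G" and I: "I \<in> ideals F"
  shows "upper G (\<phi> ` I) = upper F I"
  unfolding upper_def
proof (rule ptree_class_eqI[symmetric])
  note F' = part_treeD[OF F] and G' = part_treeD[OF G]
  note D = pf_isoD[OF F' i]
  show "part_tree (merge_roots (restrict_forest F I))" "part_tree (merge_roots (restrict_forest G (\<phi> ` I)))"
    by (rule part_tree_upper[OF F'], rule part_tree_upper[OF G'])
  show "pf_iso \<phi> (merge_roots (restrict_forest F I)) (merge_roots (restrict_forest G (\<phi> ` I)))"
    by (intro iso_merge part_forest_restrict F' G' iso_restrict[OF F' G' i] inj_on_image_mem_iff[OF D(2) _ idealsD(1)[OF I]])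
qed

text \<open>Iterated products are evaluated on restrictions and merged forests, which are not
  themselves of the form \<open>rep_ptree T\<close>; the sum over ideals is invariant under
  isomorphism, so it may be taken there.\<close>

lemma dual_mult_class:
  assumes F: "part_tree F"
  shows "dual_mult f g (ptree_class F) = (\<Sum>I\<in>ideals F. f (lower F I) * g (upper F I))"
proof -
  obtain \<phi> where i: "pf_iso \<phi> F (rep_ptree (ptree_class F))" by (rule rep_ptree_class[OF F])
  note L = lower_iso[OF F part_tree_rep i] and U = upper_iso[OF F part_tree_rep i]
  show ?thesis
    unfolding dual_mult_rep
    by (rule sum.reindex_bij_betw[OF bij_ideals[OF part_treeD[OF F] part_forest_rep i], symmetric, THEN trans])
      (simp add: L U)
qed

lemma ptree_class_same:
  assumes F: "part_tree F" and G: "part_tree G" and V: "verts F = verts G"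
    and E: "\<And>u v. u \<in> verts G \<Longrightarrow> v \<in> verts G \<Longrightarrow> (u, v) \<in> edges F \<longleftrightarrow> (u, v) \<in> edges G"
    and S: "\<And>u v. u \<in> verts G \<Longrightarrow> v \<in> verts G \<Longrightarrow> same_block F u v \<longleftrightarrow> same_block G u v"
    and D: "\<And>v. v \<in> verts G \<Longrightarrow> dec F v = dec G v"
  shows "ptree_class F = ptree_class G"
proof (rule ptree_class_eqI[OF F G])
  show "pf_iso (\<lambda>x. x) F G"
    by (rule pf_isoI[OF part_treeD[OF F] part_treeD[OF G]]) (simp_all add: V E S D bij_betw_def)
qed

lemma tmul_class:
  assumes F: "part_tree F" and G: "part_tree G"
  shows "tmul (ptree_class F) (ptree_class G) = ptree_class (merge_roots (disj_union F G))"
proof -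
  note F' = part_treeD[OF F] and G' = part_treeD[OF G]
  obtain \<phi> where i: "pf_iso \<phi> F (rep_ptree (ptree_class F))" by (rule rep_ptree_class[OF F])
  obtain \<psi> where j: "pf_iso \<psi> G (rep_ptree (ptree_class G))" by (rule rep_ptree_class[OF G])
  have "pf_iso (map_sum \<phi> \<psi>) (merge_roots (disj_union F G))
      (merge_roots (disj_union (rep_ptree (ptree_class F)) (rep_ptree (ptree_class G))))"
    by (intro iso_merge iso_disj_union part_forest_disj_union F' G' part_forest_rep i j)
  thus ?thesis
    unfolding tmul_def
    by (intro ptree_class_eqI[symmetric] part_tree_tmul F' G' part_forest_rep)
qed

lemma dual_comult_apply: "dual_comult f (T, T') = f (tmul T T')"
  by (simp add: dual_comult_def CP_mult_def tmul_def)

lemma dual_unit_eq: "dual_unit = delta empty_ptree"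
  by (simp add: dual_unit_def CP_counit_def delta_def fun_eq_iff)

lemma dual_counit_apply: "dual_counit f = f empty_ptree"
  by (simp add: dual_counit_def CP_unit_def)

definition decs :: "'d ptree \<Rightarrow> 'd set" where "decs T = dec (rep_ptree T) ` verts (rep_ptree T)"

lemma PT_iff: "T \<in> PT D \<longleftrightarrow> decs T \<subseteq> D" by (simp add: PT_def decs_def)

lemma finite_decs: "finite (decs T)"
  unfolding decs_def by (intro finite_imageI part_forestD(1)[OF part_forest_rep])

lemma decs_class: "part_tree F \<Longrightarrow> decs (ptree_class F) = dec F ` verts F"
  using PT_class[of F] unfolding PT_iff by blast

lemma nroots_tmul: "nroots (tmul T T') = nroots T + nroots T'"
  unfolding tmul_def nroots_class[OF part_tree_tmul[OF part_forest_rep part_forest_rep]]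
  by (simp add: nroots_def card_Plus finite_roots part_forest_rep)

lemma nverts_tmul: "nverts (tmul T T') = nverts T + nverts T'"
  unfolding tmul_def nverts_class[OF part_tree_tmul[OF part_forest_rep part_forest_rep]]
  by (simp add: nverts_def card_Plus part_forestD(1)[OF part_forest_rep])

lemma decs_tmul: "decs (tmul T T') = decs T \<union> decs T'"
  unfolding tmul_def decs_class[OF part_tree_tmul[OF part_forest_rep part_forest_rep]]
  by (simp add: decs_def Plus_def image_Un image_image)

lemma PT_tmul: "tmul T T' \<in> PT D \<longleftrightarrow> T \<in> PT D \<and> T' \<in> PT D"
  by (auto simp: PT_iff decs_tmul)

lemma nverts_lower:
  assumes F: "part_tree F" and I: "I \<in> ideals F" shows "nverts (lower F I) = card (verts F - I)"
  unfolding lower_def nverts_class[OF part_tree_restrict_compl[OF F I]]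
  by (simp add: Int_absorb1)

lemma nverts_upper:
  assumes F: "part_tree F" and I: "I \<in> ideals F" shows "nverts (upper F I) = card I"
  unfolding upper_def nverts_class[OF part_tree_upper[OF part_treeD[OF F]]]
  using idealsD(1)[OF I] by (simp add: Int_absorb1)

lemma nverts_lower_upper:
  assumes F: "part_tree F" and I: "I \<in> ideals F"
  shows "nverts (lower F I) + nverts (upper F I) = nverts (ptree_class F)"
  unfolding nverts_lower[OF assms] nverts_upper[OF assms] nverts_class[OF F]
  using idealsD(1)[OF I] part_forestD(1)[OF part_treeD[OF F]]
  by (simp add: card_Diff_subset finite_subset card_mono)

lemma decs_lower_upper:
  assumes F: "part_tree F" and I: "I \<in> ideals F"
  shows "decs (lower F I) \<union> decs (upper F I) = decs (ptree_class F)"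
proof -
  have "decs (lower F I) = dec F ` (verts F - I)"
    unfolding lower_def decs_class[OF part_tree_restrict_compl[OF F I]] by (simp add: Int_absorb1)
  moreover have "decs (upper F I) = dec F ` I"
    unfolding upper_def decs_class[OF part_tree_upper[OF part_treeD[OF F]]]
    using idealsD(1)[OF I] by (simp add: Int_absorb1)
  ultimately show ?thesis using idealsD(1)[OF I] by (auto simp: decs_class[OF F])
qed

lemma lower_eq_empty:
  assumes F: "part_tree F" and I: "I \<in> ideals F"
  shows "lower F I = empty_ptree \<longleftrightarrow> I = verts F"
  unfolding lower_def ptree_class_empty_iff[OF part_tree_restrict_compl[OF F I]]
  using idealsD(1)[OF I] by auto

lemma upper_eq_empty:
  assumes F: "part_tree F" and I: "I \<in> ideals F"
  shows "upper F I = empty_ptree \<longleftrightarrow> I = {}"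
  unfolding upper_def ptree_class_empty_iff[OF part_tree_upper[OF part_treeD[OF F]]]
  using idealsD(1)[OF I] by auto

lemma trivial_ideals: "part_forest F \<Longrightarrow> {} \<in> ideals F" "part_forest F \<Longrightarrow> verts F \<in> ideals F"
  using part_forestD(3)[of F] by (auto simp: ideals_def)

lemma lower_empty: "part_tree F \<Longrightarrow> lower F {} = ptree_class F"
  unfolding lower_def
  by (rule ptree_class_same[OF part_tree_restrict_compl]) (simp_all add: trivial_ideals part_treeD)

text \<open>The roots of a partitioned tree already share a block, so merging them changes
  nothing.\<close>

lemma upper_verts: "part_tree F \<Longrightarrow> upper F (verts F) = ptree_class F"
  unfolding upper_def
proof (rule ptree_class_same)
  assume F: "part_tree F"
  note F' = part_treeD[OF F]
  show "part_tree (merge_roots (restrict_forest F (verts F)))" by (rule part_tree_upper[OF F'])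
  show "same_block (merge_roots (restrict_forest F (verts F))) u v \<longleftrightarrow> same_block F u v"
    if "u \<in> verts F" "v \<in> verts F" for u v
  proof -
    have "w \<in> roots (restrict_forest F (verts F)) \<longleftrightarrow> w \<in> roots F" if "w \<in> verts F" for w
      using that part_forestD(2)[OF F'] by (auto simp: roots_def)
    thus ?thesis using that F by (auto simp: same_block_merge[OF part_forest_restrict[OF F']] part_tree_iff)
  qed
qed simp_all

lemma tmul_empty_right: "tmul T empty_ptree = T"
proof -
  let ?F = "rep_ptree T"
  have E: "part_tree (empty_forest :: (nat, 'a) pforest)" by (rule part_tree_empty_forest)
  note P = part_forest_disj_union[OF part_forest_rep part_treeD[OF E]]
  note M = part_tree_tmul[OF part_forest_rep part_treeD[OF E]]
  have "pf_iso Inl ?F (merge_roots (disj_union ?F (empty_forest :: (nat, 'a) pforest)))"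
  proof (rule pf_isoI[OF part_forest_rep part_treeD[OF M]])
    show "same_block ?F u v \<longleftrightarrow>
      same_block (merge_roots (disj_union ?F (empty_forest :: (nat, 'a) pforest))) (Inl u) (Inl v)" for u v
      using part_tree_rep[of T] by (auto simp: same_block_merge[OF P] part_tree_iff)
  qed (auto simp: bij_betw_def)
  from ptree_class_eqI[OF part_tree_rep M this] show ?thesis
    using tmul_class[OF part_tree_rep[of T] E] by (simp add: empty_ptree_def)
qed

lemma tmul_empty_left: "tmul empty_ptree T = T"
proof -
  let ?F = "rep_ptree T"
  have E: "part_tree (empty_forest :: (nat, 'a) pforest)" by (rule part_tree_empty_forest)
  note P = part_forest_disj_union[OF part_treeD[OF E] part_forest_rep]
  note M = part_tree_tmul[OF part_treeD[OF E] part_forest_rep]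
  have "pf_iso Inr ?F (merge_roots (disj_union (empty_forest :: (nat, 'a) pforest) ?F))"
  proof (rule pf_isoI[OF part_forest_rep part_treeD[OF M]])
    show "same_block ?F u v \<longleftrightarrow>
      same_block (merge_roots (disj_union (empty_forest :: (nat, 'a) pforest) ?F)) (Inr u) (Inr v)" for u v
      using part_tree_rep[of T] by (auto simp: same_block_merge[OF P] part_tree_iff)
  qed (auto simp: bij_betw_def)
  from ptree_class_eqI[OF part_tree_rep M this] show ?thesis
    using tmul_class[OF E part_tree_rep[of T]] by (simp add: empty_ptree_def)
qed

lemma finite_ptrees_le:
  assumes "finite E" shows "finite {T. nverts T \<le> n \<and> T \<in> PT E}"
proof -
  have "{T. nverts T \<le> n \<and> T \<in> PT E} = (\<Union>k\<le>n. {T. nverts T = k \<and> T \<in> PT E})" by auto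
  thus ?thesis using finite_ptrees[OF assms] by simp
qed

text \<open>A tree in the support is cut into some \<open>a\<close> and \<open>b\<close> from the
  two supports; its number of vertices and its decorations are then those of \<open>a\<close> and
  \<open>b\<close> together. Bounding the decorations as well keeps the set finite for infinite
  \<open>D\<close>.\<close>

lemma dual_mult_closed:
  fixes f g :: "'d ptree \<Rightarrow> 'k::field"
  assumes f: "f \<in> fin_supp_on (PT D)" and g: "g \<in> fin_supp_on (PT D)"
  shows "dual_mult f g \<in> fin_supp_on (PT D)"
proof -
  have ex: "\<exists>I\<in>ideals (rep_ptree T). f (lower (rep_ptree T) I) \<noteq> 0 \<and> g (upper (rep_ptree T) I) \<noteq> 0"
    if "dual_mult f g T \<noteq> 0" for T
  proof (rule ccontr)
    assume "\<not> ?thesis"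
    hence "dual_mult f g T = 0" unfolding dual_mult_rep by (intro sum.neutral) auto
    thus False using that by simp
  qed
  let ?S = "\<Union>a\<in>{a. f a \<noteq> 0}. \<Union>b\<in>{b. g b \<noteq> 0}. {T. nverts T = nverts a + nverts b \<and> T \<in> PT (decs a \<union> decs b)}"
  have "{T. dual_mult f g T \<noteq> 0} \<subseteq> ?S"
  proof
    fix T assume "T \<in> {T. dual_mult f g T \<noteq> 0}"
    then obtain I where I: "I \<in> ideals (rep_ptree T)" and "f (lower (rep_ptree T) I) \<noteq> 0" "g (upper (rep_ptree T) I) \<noteq> 0"
      using ex by blast
    moreover have "nverts T = nverts (lower (rep_ptree T) I) + nverts (upper (rep_ptree T) I)"
      using nverts_lower_upper[OF part_tree_rep I] by simp
    moreover have "T \<in> PT (decs (lower (rep_ptree T) I) \<union> decs (upper (rep_ptree T) I))"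
      using decs_lower_upper[OF part_tree_rep I] by (simp add: PT_iff)
    ultimately show "T \<in> ?S" by blast
  qed
  moreover have "finite ?S"
    using f g by (intro finite_UN_I finite_ptrees finite_UnI finite_decs) (auto simp: fin_supp_on_iff)
  moreover have "T \<in> PT D" if nz: "dual_mult f g T \<noteq> 0" for T
  proof -
    obtain I where I: "I \<in> ideals (rep_ptree T)" "f (lower (rep_ptree T) I) \<noteq> 0" "g (upper (rep_ptree T) I) \<noteq> 0"
      using ex[OF nz] by blast
    hence "decs (lower (rep_ptree T) I) \<subseteq> D" "decs (upper (rep_ptree T) I) \<subseteq> D"
      using f g by (auto simp: fin_supp_on_iff PT_iff[symmetric])
    thus ?thesis unfolding PT_iff using decs_lower_upper[OF part_tree_rep I(1)] by (metis Un_least ptree_class_rep)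
  qed
  ultimately show ?thesis by (auto simp: fin_supp_on_iff intro: finite_subset)
qed

text \<open>The factors of a tree have no more vertices and no other decorations than the
  tree.\<close>

lemma dual_comult_closed:
  fixes f :: "'d ptree \<Rightarrow> 'k::field"
  assumes f: "f \<in> fin_supp_on (PT D)"
  shows "dual_comult f \<in> fin_supp_on (PT D \<times> PT D)"
proof -
  let ?P = "\<lambda>U. {T. nverts T \<le> nverts U \<and> T \<in> PT (decs U)}"
  have "{p. dual_comult f p \<noteq> 0} \<subseteq> (\<Union>U\<in>{U. f U \<noteq> 0}. ?P U \<times> ?P U)"
  proof
    fix p assume p: "p \<in> {p. dual_comult f p \<noteq> 0}"
    obtain T T' where pT: "p = (T, T')" by (cases p)
    have nz: "f (tmul T T') \<noteq> 0" using p by (simp add: pT dual_comult_apply)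
    have "p \<in> ?P (tmul T T') \<times> ?P (tmul T T')" by (simp add: pT nverts_tmul decs_tmul PT_iff)
    thus "p \<in> (\<Union>U\<in>{U. f U \<noteq> 0}. ?P U \<times> ?P U)" using nz by blast
  qed
  moreover have "finite (\<Union>U\<in>{U. f U \<noteq> 0}. ?P U \<times> ?P U)"
    using f by (intro finite_UN_I finite_cartesian_product finite_ptrees_le finite_decs) (auto simp: fin_supp_on_iff)
  moreover have "p \<in> PT D \<times> PT D" if nz: "dual_comult f p \<noteq> 0" for p
  proof -
    obtain T T' where pT: "p = (T, T')" by (cases p)
    have "tmul T T' \<in> PT D" using f nz by (simp add: pT dual_comult_apply fin_supp_on_iff)
    thus ?thesis by (simp add: pT PT_tmul)
  qed
  ultimately show ?thesis by (auto simp: fin_supp_on_iff intro: finite_subset)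
qed

subsection \<open>Associativity\<close>

text \<open>Three layers: \<open>I\<close> on top, \<open>J\<close> in the middle and the remainder
  at the bottom, where \<open>I\<close> and \<open>I \<union> J\<close> are ideals. Cutting
  \<open>I\<close> first and then \<open>J\<close>, or \<open>I \<union> J\<close> first and then
  \<open>I\<close> inside it, gives the same three trees.\<close>

context
  fixes F :: "('v, 'd) pforest" and I J
  assumes F: "part_forest F" and I: "I \<in> ideals F" and J: "J \<subseteq> verts F" and IJ: "I \<inter> J = {}"
    and K: "I \<union> J \<in> ideals F"
begin

text \<open>No edge leads from the ideal \<open>I\<close> to a vertex outside it, so merging before
  or after the removal of \<open>I\<close> concerns the same vertices of \<open>J\<close>.\<close>

lemma root_in_J: "v \<in> J \<Longrightarrow> (\<forall>u\<in>J. (u, v) \<notin> edges F) \<longleftrightarrow> (\<forall>u\<in>I \<union> J. (u, v) \<notin> edges F)"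
  using idealsD(2)[OF I, of _ v] IJ by blast

lemma lower_lower:
  assumes F': "part_tree F"
  shows "lower (restrict_forest F (verts F - I)) J = lower F (I \<union> J)"
proof -
  have J': "J \<in> ideals (restrict_forest F (verts F - I))"
    using J IJ idealsD(2)[OF K] unfolding ideals_def by auto
  show ?thesis
    unfolding lower_def
    by (rule ptree_class_same[OF part_tree_restrict_compl[OF part_tree_restrict_compl[OF F' I] J']
          part_tree_restrict_compl[OF F' K]]) (use J in auto)
qed

text \<open>The middle layer: on the left the roots of \<open>J\<close> are merged after
  \<open>I\<close> has gone, on the right those of \<open>I \<union> J\<close> before it goes.
  \<open>root_in_J\<close> identifies the two sets of roots within \<open>J\<close>.\<close>

lemma upper_lower:
  "upper (restrict_forest F (verts F - I)) J = lower (merge_roots (restrict_forest F (I \<union> J))) I"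
proof -
  let ?R = "restrict_forest F (verts F - I)" and ?M = "merge_roots (restrict_forest F (I \<union> J))"
  have M: "part_tree ?M" by (rule part_tree_upper[OF F])
  have R: "part_forest ?R" by (rule part_forest_restrict[OF F])
  have I': "I \<in> ideals ?M" using idealsD[OF I] unfolding ideals_def by auto
  show ?thesis
    unfolding lower_def upper_def
  proof (rule ptree_class_same[OF part_tree_upper[OF R] part_tree_restrict_compl[OF M I']])
    have V: "verts F \<inter> (verts F - I) \<inter> J = J" using J IJ by auto
    have V': "verts ?M \<inter> (verts ?M - I) = J" using J IJ by auto
    show "verts (merge_roots (restrict_forest ?R J)) = verts (restrict_forest ?M (verts ?M - I))"
      using V V' by simp
    fix u v assume "u \<in> verts (restrict_forest ?M (verts ?M - I))" "v \<in> verts (restrict_forest ?M (verts ?M - I))"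
    hence uv: "u \<in> J" "v \<in> J" using V' by auto
    have mem: "w \<in> verts F" "w \<notin> I" if "w \<in> J" for w using that J IJ by auto
    show "(u, v) \<in> edges (merge_roots (restrict_forest ?R J)) \<longleftrightarrow> (u, v) \<in> edges (restrict_forest ?M (verts ?M - I))"
      using uv mem by simp
    show "dec (merge_roots (restrict_forest ?R J)) v = dec (restrict_forest ?M (verts ?M - I)) v" by simp
    have r1: "w \<in> roots (restrict_forest ?R J) \<longleftrightarrow> (\<forall>u\<in>J. (u, w) \<notin> edges F)" if "w \<in> J" for w
      unfolding roots_restrict[OF R] using that mem by auto
    have r2: "w \<in> roots (restrict_forest F (I \<union> J)) \<longleftrightarrow> (\<forall>u\<in>I \<union> J. (u, w) \<notin> edges F)" if "w \<in> J" for w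
      unfolding roots_restrict[OF F] using that mem by simp
    show "same_block (merge_roots (restrict_forest ?R J)) u v \<longleftrightarrow> same_block (restrict_forest ?M (verts ?M - I)) u v"
      unfolding same_block_merge[OF part_forest_restrict[OF R]] restrict_simps same_block_merge[OF part_forest_restrict[OF F]]
        r1[OF uv(1)] r1[OF uv(2)] r2[OF uv(1)] r2[OF uv(2)] root_in_J[OF uv(1)] root_in_J[OF uv(2)]
      using uv mem by simp
  qed
qed

lemma upper_upper: "upper (merge_roots (restrict_forest F (I \<union> J))) I = upper F I"
proof -
  let ?M = "merge_roots (restrict_forest F (I \<union> J))"
  have M: "part_forest ?M" by (rule part_treeD[OF part_tree_upper[OF F]])
  show ?thesis
    unfolding upper_def
  proof (rule ptree_class_same[OF part_tree_upper[OF M] part_tree_upper[OF F]])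
    have mem: "w \<in> verts F" if "w \<in> I" for w using that idealsD(1)[OF I] by auto
    show "verts (merge_roots (restrict_forest ?M I)) = verts (merge_roots (restrict_forest F I))" by auto
    fix u v assume "u \<in> verts (merge_roots (restrict_forest F I))" "v \<in> verts (merge_roots (restrict_forest F I))"
    hence uv: "u \<in> I" "v \<in> I" by auto
    show "(u, v) \<in> edges (merge_roots (restrict_forest ?M I)) \<longleftrightarrow> (u, v) \<in> edges (merge_roots (restrict_forest F I))"
      using uv by auto
    show "dec (merge_roots (restrict_forest ?M I)) v = dec (merge_roots (restrict_forest F I)) v" by simp
    have r: "w \<in> roots (restrict_forest ?M I) \<longleftrightarrow> (\<forall>u\<in>I. (u, w) \<notin> edges F)"
      "w \<in> roots (restrict_forest F I) \<longleftrightarrow> (\<forall>u\<in>I. (u, w) \<notin> edges F)"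
      "w \<in> roots (restrict_forest F (I \<union> J)) \<longleftrightarrow> (\<forall>u\<in>I \<union> J. (u, w) \<notin> edges F)" if "w \<in> I" for w
      unfolding roots_restrict[OF F] roots_restrict[OF M] using that mem by auto
    show "same_block (merge_roots (restrict_forest ?M I)) u v \<longleftrightarrow> same_block (merge_roots (restrict_forest F I)) u v"
      unfolding same_block_merge[OF part_forest_restrict[OF M]] restrict_simps
        same_block_merge[OF part_forest_restrict[OF F]] r[OF uv(1)] r[OF uv(2)]
      using uv by auto
  qed
qed

end

text \<open>Pairs (I, J) with \<open>J\<close> an ideal of what \<open>I\<close> leaves correspond
  to pairs (K, I) of an ideal \<open>K\<close> and an ideal \<open>I\<close> of the part above that
  cut, by \<open>K = I \<union> J\<close>.\<close>

lemma dual_mult_assoc: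
  fixes f g h :: "'d ptree \<Rightarrow> 'k::field"
  shows "dual_mult (dual_mult f g) h = dual_mult f (dual_mult g h)"
proof
  fix T :: "'d ptree"
  let ?F = "rep_ptree T"
  let ?R = "\<lambda>I. restrict_forest ?F (verts ?F - I)" and ?M = "\<lambda>K. merge_roots (restrict_forest ?F K)"
  note F = part_tree_rep[of T] and F' = part_forest_rep[of T]
  have "dual_mult (dual_mult f g) h T =
      (\<Sum>I\<in>ideals ?F. \<Sum>J\<in>ideals (?R I). f (lower (?R I) J) * g (upper (?R I) J) * h (upper ?F I))"
    unfolding dual_mult_rep[of _ _ T]
    by (intro sum.cong refl)
      (simp add: lower_def[of ?F] dual_mult_class[OF part_tree_restrict_compl[OF F]] sum_distrib_right)
  also have "\<dots> = (\<Sum>(I, J)\<in>Sigma (ideals ?F) (\<lambda>I. ideals (?R I)). f (lower (?R I) J) * g (upper (?R I) J) * h (upper ?F I))"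
    by (rule sum.Sigma) (auto intro: finite_ideals F' part_forest_restrict)
  also have "\<dots> = (\<Sum>(K, I)\<in>Sigma (ideals ?F) (\<lambda>K. ideals (?M K)). f (lower ?F K) * (g (lower (?M K) I) * h (upper (?M K) I)))"
  proof (rule sum.reindex_bij_witness[where i = "\<lambda>(K, I). (I, K - I)" and j = "\<lambda>(I, J). (I \<union> J, I)"])
    fix p assume "p \<in> Sigma (ideals ?F) (\<lambda>I. ideals (?R I))"
    then obtain I J where p: "p = (I, J)" and I: "I \<in> ideals ?F" and J: "J \<in> ideals (?R I)" by auto
    have J1: "J \<subseteq> verts ?F" and J2: "I \<inter> J = {}" using idealsD(1)[OF J] by auto
    have K: "I \<union> J \<in> ideals ?F"
      unfolding ideals_def
    proof (intro CollectI conjI allI impI)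
      show "I \<union> J \<subseteq> verts ?F" using idealsD(1)[OF I] J1 by simp
      fix v w assume vw: "v \<in> I \<union> J \<and> (v, w) \<in> edges ?F"
      show "w \<in> I \<union> J"
      proof (cases "v \<in> I \<or> w \<in> I")
        case True
        thus ?thesis using idealsD(2)[OF I] vw by blast
      next
        case False
        hence "(v, w) \<in> edges (?R I)" using vw J1 part_forestD(3)[OF F'] by auto
        thus ?thesis using idealsD(2)[OF J] vw False by blast
      qed
    qed
    show "(case (case p of (I, J) \<Rightarrow> (I \<union> J, I)) of (K, I) \<Rightarrow> (I, K - I)) = p"
      using J2 by (auto simp: p)
    have "I \<in> ideals (?M (I \<union> J))" using idealsD[OF I] by (auto simp: ideals_def)
    thus "(case p of (I, J) \<Rightarrow> (I \<union> J, I)) \<in> Sigma (ideals ?F) (\<lambda>K. ideals (?M K))"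
      using K by (simp add: p)
    show "(case (case p of (I, J) \<Rightarrow> (I \<union> J, I)) of (K, I) \<Rightarrow> f (lower ?F K) * (g (lower (?M K) I) * h (upper (?M K) I)))
       = (case p of (I, J) \<Rightarrow> f (lower (?R I) J) * g (upper (?R I) J) * h (upper ?F I))"
      using lower_lower[OF F' I J1 J2 K F] upper_lower[OF F' I J1 J2 K] upper_upper[OF F' I J1 J2 K]
      by (simp add: p mult.assoc)
  next
    fix q assume "q \<in> Sigma (ideals ?F) (\<lambda>K. ideals (?M K))"
    then obtain K I where q: "q = (K, I)" and K: "K \<in> ideals ?F" and I: "I \<in> ideals (?M K)" by auto
    have IK: "I \<subseteq> K" using idealsD(1)[OF I] by auto
    show "(case (case q of (K, I) \<Rightarrow> (I, K - I)) of (I, J) \<Rightarrow> (I \<union> J, I)) = q"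
      using IK by (auto simp: q)
    have "I \<in> ideals ?F"
      unfolding ideals_def
    proof (intro CollectI conjI allI impI)
      show "I \<subseteq> verts ?F" using IK idealsD(1)[OF K] by simp
      fix v w assume vw: "v \<in> I \<and> (v, w) \<in> edges ?F"
      hence "w \<in> K" using idealsD(2)[OF K] IK by blast
      hence "(v, w) \<in> edges (?M K)" using vw IK by auto
      thus "w \<in> I" using idealsD(2)[OF I] vw by blast
    qed
    moreover have "K - I \<in> ideals (?R I)"
      using idealsD[OF K] by (auto simp: ideals_def)
    ultimately show "(case q of (K, I) \<Rightarrow> (I, K - I)) \<in> Sigma (ideals ?F) (\<lambda>I. ideals (?R I))"
      by (simp add: q)
  qed
  also have "\<dots> = (\<Sum>K\<in>ideals ?F. \<Sum>I\<in>ideals (?M K). f (lower ?F K) * (g (lower (?M K) I) * h (upper (?M K) I)))"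
    by (rule sum.Sigma[symmetric]) (auto intro: finite_ideals F' part_treeD[OF part_tree_upper[OF F']])
  also have "\<dots> = dual_mult f (dual_mult g h) T"
    unfolding dual_mult_rep[of _ _ T]
    by (intro sum.cong refl)
      (simp add: upper_def[of ?F] dual_mult_class[OF part_tree_upper[OF F']] sum_distrib_left)
  finally show "dual_mult (dual_mult f g) h T = dual_mult f (dual_mult g h) T" .
qed

section \<open>Unit and bilinearity of the dual product\<close>

lemma dual_mult_unit_left:
  fixes f :: "'d ptree \<Rightarrow> 'k::field"
  shows "dual_mult (delta empty_ptree) f = f"
proof
  fix T :: "'d ptree"
  let ?F = "rep_ptree T"
  have "dual_mult (delta empty_ptree) f T = (\<Sum>I\<in>ideals ?F. if I = verts ?F then f T else 0)"
    unfolding dual_mult_rep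
    by (intro sum.cong refl) (auto simp: delta_def lower_eq_empty[OF part_tree_rep] upper_verts[OF part_tree_rep])
  thus "dual_mult (delta empty_ptree) f T = f T"
    by (simp add: finite_ideals[OF part_forest_rep] trivial_ideals[OF part_forest_rep])
qed

lemma dual_mult_unit_right:
  fixes f :: "'d ptree \<Rightarrow> 'k::field"
  shows "dual_mult f (delta empty_ptree) = f"
proof
  fix T :: "'d ptree"
  let ?F = "rep_ptree T"
  have "dual_mult f (delta empty_ptree) T = (\<Sum>I\<in>ideals ?F. if I = {} then f T else 0)"
    unfolding dual_mult_rep
    by (intro sum.cong refl) (auto simp: delta_def upper_eq_empty[OF part_tree_rep] lower_empty[OF part_tree_rep])
  thus "dual_mult f (delta empty_ptree) T = f T"
    by (simp add: finite_ideals[OF part_forest_rep] trivial_ideals[OF part_forest_rep])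
qed

lemma dual_mult_add_left: "dual_mult (f + f') g = dual_mult f g + dual_mult f' g"
  and dual_mult_add_right: "dual_mult f (g + g') = dual_mult f g + dual_mult f g'"
  and dual_mult_scale_left: "dual_mult (fscale c f) g = fscale c (dual_mult f g)"
  and dual_mult_scale_right: "dual_mult f (fscale c g) = fscale c (dual_mult f g)"
  by (simp_all add: fun_eq_iff dual_mult_rep fun_apply sum.distrib sum_distrib_left algebra_simps)

lemma unital_algebra_dual: "unital_algebra fscale (fin_supp_on (PT D)) dual_mult (delta empty_ptree)"
  by unfold_locales
    (auto simp: subspace_fin_supp_on dual_mult_closed linear_on_def dual_mult_add_left dual_mult_add_right
      dual_mult_scale_left dual_mult_scale_right fin_supp_on_delta empty_in_PT
      dual_mult_unit_left dual_mult_unit_right dual_mult_assoc)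

subsection \<open>Compatibility with the coproduct\<close>

context
  fixes F :: "('v, 'd) pforest" and G :: "('w, 'd) pforest" and I J
  assumes F: "part_tree F" and G: "part_tree G" and I: "I \<in> ideals F" and J: "J \<in> ideals G"
begin

lemma Plus_ideal: "I <+> J \<in> ideals (merge_roots (disj_union F G))"
  unfolding ideals_def
proof (intro CollectI conjI allI impI)
  show "I <+> J \<subseteq> verts (merge_roots (disj_union F G))" using idealsD(1)[OF I] idealsD(1)[OF J] by auto
  fix x y assume xy: "x \<in> I <+> J \<and> (x, y) \<in> edges (merge_roots (disj_union F G))"
  show "y \<in> I <+> J"
    by (cases x; cases y) (use xy idealsD(2)[OF I] idealsD(2)[OF J] in auto)
qed

lemma lower_Plus: "lower (merge_roots (disj_union F G)) (I <+> J) = tmul (lower F I) (lower G J)"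
proof -
  note F' = part_treeD[OF F] and G' = part_treeD[OF G]
  let ?M = "merge_roots (disj_union F G)"
  let ?A = "restrict_forest F (verts F - I)" and ?B = "restrict_forest G (verts G - J)"
  note FG = part_forest_disj_union[OF F' G'] and AB = part_forest_disj_union[OF part_forest_restrict[OF F'] part_forest_restrict[OF G']]
  have A: "part_tree ?A" and B: "part_tree ?B" by (rule part_tree_restrict_compl[OF F I], rule part_tree_restrict_compl[OF G J])
  show ?thesis
    unfolding lower_def tmul_class[OF A B]
  proof (rule ptree_class_same[OF part_tree_restrict_compl[OF part_tree_tmul[OF F' G'] Plus_ideal]
        part_tree_tmul[OF part_treeD[OF A] part_treeD[OF B]]])
    show "verts (restrict_forest ?M (verts ?M - (I <+> J))) = verts (merge_roots (disj_union ?A ?B))" by auto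
    fix u v assume uv: "u \<in> verts (merge_roots (disj_union ?A ?B))" "v \<in> verts (merge_roots (disj_union ?A ?B))"
    show "(u, v) \<in> edges (restrict_forest ?M (verts ?M - (I <+> J))) \<longleftrightarrow> (u, v) \<in> edges (merge_roots (disj_union ?A ?B))"
      by (cases u; cases v) (use uv in auto)
    show "same_block (restrict_forest ?M (verts ?M - (I <+> J))) u v \<longleftrightarrow> same_block (merge_roots (disj_union ?A ?B)) u v"
      unfolding restrict_simps same_block_merge[OF FG] same_block_merge[OF AB]
        roots_disj_union(3) roots_restrict_compl[OF F' I] roots_restrict_compl[OF G' J]
      by (cases u; cases v) (use uv in auto)
    show "dec (restrict_forest ?M (verts ?M - (I <+> J))) v = dec (merge_roots (disj_union ?A ?B)) v"
      by (cases v) auto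
  qed
qed

lemma upper_Plus: "upper (merge_roots (disj_union F G)) (I <+> J) = tmul (upper F I) (upper G J)"
proof -
  note F' = part_treeD[OF F] and G' = part_treeD[OF G]
  let ?M = "merge_roots (disj_union F G)" and ?RF = "restrict_forest F I" and ?RG = "restrict_forest G J"
  let ?A = "merge_roots ?RF" and ?B = "merge_roots ?RG"
  note RF = part_forest_restrict[OF F', of I] and RG = part_forest_restrict[OF G', of J]
  note FG = part_forest_disj_union[OF F' G']
  have M: "part_forest ?M" by (rule part_treeD[OF part_tree_tmul[OF F' G']])
  have A: "part_tree ?A" and B: "part_tree ?B" by (rule part_tree_upper[OF F'], rule part_tree_upper[OF G'])
  note AB = part_forest_disj_union[OF part_treeD[OF A] part_treeD[OF B]]
  \<comment> \<open>In the product the roots were merged before the restriction; by these inclusions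
    the later merging of the restricted roots absorbs that.\<close>
  have sub: "roots F \<inter> I \<subseteq> roots ?RF" "roots G \<inter> J \<subseteq> roots ?RG"
    by (auto simp: roots_def)
  have r: "roots (restrict_forest ?M (I <+> J)) = roots ?RF <+> roots ?RG"
  proof (rule set_eqI)
    show "x \<in> roots (restrict_forest ?M (I <+> J)) \<longleftrightarrow> x \<in> roots ?RF <+> roots ?RG" for x
      by (cases x) (auto simp: roots_def)
  qed
  show ?thesis
    unfolding upper_def tmul_class[OF A B]
  proof (rule ptree_class_same[OF part_tree_upper[OF M] part_tree_tmul[OF part_treeD[OF A] part_treeD[OF B]]])
    show "verts (merge_roots (restrict_forest ?M (I <+> J))) = verts (merge_roots (disj_union ?A ?B))" by auto
    fix u v assume uv: "u \<in> verts (merge_roots (disj_union ?A ?B))" "v \<in> verts (merge_roots (disj_union ?A ?B))"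
    show "(u, v) \<in> edges (merge_roots (restrict_forest ?M (I <+> J))) \<longleftrightarrow> (u, v) \<in> edges (merge_roots (disj_union ?A ?B))"
      by (cases u; cases v) (use uv in auto)
    show "same_block (merge_roots (restrict_forest ?M (I <+> J))) u v \<longleftrightarrow> same_block (merge_roots (disj_union ?A ?B)) u v"
      unfolding same_block_merge[OF part_forest_restrict[OF M]] restrict_simps same_block_merge[OF FG] r
        same_block_merge[OF AB] roots_disj_union(3) merge_simps
      by (cases u; cases v) (use uv sub in \<open>auto simp: same_block_merge[OF RF] same_block_merge[OF RG]\<close>)
    show "dec (merge_roots (restrict_forest ?M (I <+> J))) v = dec (merge_roots (disj_union ?A ?B)) v"
      by (cases v) auto
  qed
qed

end

text \<open>Every ideal of a disjoint union is a sum \<open>I <+> J\<close> of ideals, and both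
  parts of the cut are products. This is the multiplicativity of the coproduct, read in the
  dual.\<close>

lemma dual_mult_tmul:
  "dual_mult f g (tmul T T') = (\<Sum>(I, J)\<in>ideals (rep_ptree T) \<times> ideals (rep_ptree T').
     f (tmul (lower (rep_ptree T) I) (lower (rep_ptree T') J)) * g (tmul (upper (rep_ptree T) I) (upper (rep_ptree T') J)))"
proof -
  let ?F = "rep_ptree T" and ?G = "rep_ptree T'"
  note F = part_tree_rep[of T] and G = part_tree_rep[of T']
  let ?M = "merge_roots (disj_union ?F ?G)"
  have "dual_mult f g (tmul T T') = (\<Sum>K\<in>ideals ?M. f (lower ?M K) * g (upper ?M K))"
    unfolding tmul_def by (rule dual_mult_class[OF part_tree_tmul[OF part_forest_rep part_forest_rep]])
  also have "\<dots> = (\<Sum>(I, J)\<in>ideals ?F \<times> ideals ?G. f (lower ?M (I <+> J)) * g (upper ?M (I <+> J)))"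
  proof (rule sum.reindex_bij_witness[where i = "\<lambda>(I, J). I <+> J" and j = "\<lambda>K. (Inl -` K, Inr -` K)"])
    fix K assume K: "K \<in> ideals ?M"
    show eq: "(case (Inl -` K, Inr -` K) of (I, J) \<Rightarrow> I <+> J) = K"
    proof (rule set_eqI)
      show "x \<in> (case (Inl -` K, Inr -` K) of (I, J) \<Rightarrow> I <+> J) \<longleftrightarrow> x \<in> K" for x
        by (cases x) auto
    qed
    have "Inl -` K \<in> ideals ?F"
      unfolding ideals_def
    proof (intro CollectI conjI allI impI)
      show "Inl -` K \<subseteq> verts ?F" using idealsD(1)[OF K] by auto
      fix v w assume "v \<in> Inl -` K \<and> (v, w) \<in> edges ?F"
      thus "w \<in> Inl -` K" using idealsD(2)[OF K, of "Inl v" "Inl w"] by simp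
    qed
    moreover have "Inr -` K \<in> ideals ?G"
      unfolding ideals_def
    proof (intro CollectI conjI allI impI)
      show "Inr -` K \<subseteq> verts ?G" using idealsD(1)[OF K] by auto
      fix v w assume "v \<in> Inr -` K \<and> (v, w) \<in> edges ?G"
      thus "w \<in> Inr -` K" using idealsD(2)[OF K, of "Inr v" "Inr w"] by simp
    qed
    ultimately show "(Inl -` K, Inr -` K) \<in> ideals ?F \<times> ideals ?G" by simp
    show "(case (Inl -` K, Inr -` K) of (I, J) \<Rightarrow> f (lower ?M (I <+> J)) * g (upper ?M (I <+> J))) = f (lower ?M K) * g (upper ?M K)"
      using eq by simp
  next
    fix p assume "p \<in> ideals ?F \<times> ideals ?G"
    then obtain I J where p: "p = (I, J)" and I: "I \<in> ideals ?F" and J: "J \<in> ideals ?G" by auto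
    show "(Inl -` (case p of (I, J) \<Rightarrow> I <+> J), Inr -` (case p of (I, J) \<Rightarrow> I <+> J)) = p" by (auto simp: p)
    show "(case p of (I, J) \<Rightarrow> I <+> J) \<in> ideals ?M" unfolding p prod.case by (rule Plus_ideal[OF F G I J])
  qed
  also have "\<dots> = (\<Sum>(I, J)\<in>ideals ?F \<times> ideals ?G. f (tmul (lower ?F I) (lower ?G J)) * g (tmul (upper ?F I) (upper ?G J)))"
    by (rule sum.cong) (auto simp: lower_Plus[OF F G] upper_Plus[OF F G])
  finally show ?thesis .
qed

lemma fin_supp_pair_expand:
  fixes X :: "'a \<times> 'b \<Rightarrow> 'k::field"
  assumes "finite {p. X p \<noteq> 0}"
  shows "(\<Sum>p | X p \<noteq> 0. X p * (delta (fst p) a * delta (snd p) b)) = X (a, b)"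
proof -
  have "(\<Sum>p | X p \<noteq> 0. X p * (delta (fst p) a * delta (snd p) b)) = (\<Sum>p | X p \<noteq> 0. if p = (a, b) then X p else 0)"
    by (rule sum.cong) (auto simp: delta_def prod_eq_iff)
  thus ?thesis using assms by simp
qed

text \<open>\<open>tens_mult\<close> is defined by expansion in basis pairs; collapsing the two
  expansions leaves a sum over pairs of ideals, the shape of \<open>dual_mult_tmul\<close>.\<close>

lemma tens_mult_apply:
  fixes X Y :: "'d ptree \<times> 'd ptree \<Rightarrow> 'k::field"
  assumes X: "finite {p. X p \<noteq> 0}" and Y: "finite {p. Y p \<noteq> 0}"
  shows "tens_mult dual_mult X Y (T, T') = (\<Sum>(I, J)\<in>ideals (rep_ptree T) \<times> ideals (rep_ptree T').
     X (lower (rep_ptree T) I, lower (rep_ptree T') J) * Y (upper (rep_ptree T) I, upper (rep_ptree T') J))"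
proof -
  let ?F = "rep_ptree T" and ?G = "rep_ptree T'"
  let ?x = "\<lambda>p I J. X p * (delta (fst p) (lower ?F I) * delta (snd p) (lower ?G J))"
  let ?y = "\<lambda>q I J. Y q * (delta (fst q) (upper ?F I) * delta (snd q) (upper ?G J))"
  have summand: "fscale (X p * Y q) (tens (dual_mult (delta (fst p)) (delta (fst q))) (dual_mult (delta (snd p)) (delta (snd q)))) (T, T')
    = (\<Sum>z\<in>ideals ?F \<times> ideals ?G. ?x p (fst z) (snd z) * ?y q (fst z) (snd z))" for p q
  proof -
    have prod: "(\<Sum>I\<in>ideals ?F. a I) * (\<Sum>J\<in>ideals ?G. c J) = (\<Sum>z\<in>ideals ?F \<times> ideals ?G. a (fst z) * c (snd z))"
      for a c :: "nat set \<Rightarrow> 'k"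
      by (simp add: sum_product sum.cartesian_product case_prod_unfold)
    have "fscale (X p * Y q) (tens (dual_mult (delta (fst p)) (delta (fst q))) (dual_mult (delta (snd p)) (delta (snd q)))) (T, T')
      = (\<Sum>z\<in>ideals ?F \<times> ideals ?G. X p * Y q *
          ((delta (fst p) (lower ?F (fst z)) * delta (fst q) (upper ?F (fst z))) *
           (delta (snd p) (lower ?G (snd z)) * delta (snd q) (upper ?G (snd z)))))"
      unfolding fscale_apply tens_def dual_mult_rep prod.case prod by (rule sum_distrib_left)
    also have "\<dots> = (\<Sum>z\<in>ideals ?F \<times> ideals ?G. ?x p (fst z) (snd z) * ?y q (fst z) (snd z))"
      by (rule sum.cong) (simp_all add: mult_ac)
    finally show ?thesis .
  qed
  have "tens_mult dual_mult X Y (T, T') = (\<Sum>p | X p \<noteq> 0. \<Sum>q | Y q \<noteq> 0.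
      fscale (X p * Y q) (tens (dual_mult (delta (fst p)) (delta (fst q))) (dual_mult (delta (snd p)) (delta (snd q)))) (T, T'))"
    by (simp add: tens_mult_def sum_fun_apply case_prod_unfold)
  also have "\<dots> = (\<Sum>p | X p \<noteq> 0. \<Sum>q | Y q \<noteq> 0. \<Sum>z\<in>ideals ?F \<times> ideals ?G. ?x p (fst z) (snd z) * ?y q (fst z) (snd z))"
    unfolding summand ..
  also have "\<dots> = (\<Sum>z\<in>ideals ?F \<times> ideals ?G. \<Sum>p | X p \<noteq> 0. \<Sum>q | Y q \<noteq> 0. ?x p (fst z) (snd z) * ?y q (fst z) (snd z))"
    by (subst sum.swap[of _ "ideals ?F \<times> ideals ?G"], subst sum.swap[of _ "ideals ?F \<times> ideals ?G"]) (rule refl)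
  also have "\<dots> = (\<Sum>z\<in>ideals ?F \<times> ideals ?G. (\<Sum>p | X p \<noteq> 0. ?x p (fst z) (snd z)) * (\<Sum>q | Y q \<noteq> 0. ?y q (fst z) (snd z)))"
    by (simp add: sum_product)
  also have "\<dots> = (\<Sum>(I, J)\<in>ideals ?F \<times> ideals ?G. X (lower ?F I, lower ?G J) * Y (upper ?F I, upper ?G J))"
    unfolding fin_supp_pair_expand[OF X] fin_supp_pair_expand[OF Y] by (simp add: case_prod_unfold)
  finally show ?thesis .
qed

lemma tmul_eq_empty: "tmul T T' = empty_ptree \<longleftrightarrow> T = empty_ptree \<and> T' = empty_ptree"
  using nroots_eq_0[of "tmul T T'"] nroots_eq_0[of T] nroots_eq_0[of T'] by (simp add: nroots_tmul)

lemma alg_hom_dual_comult: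
  "alg_hom fscale (fin_supp_on (PT D)) dual_mult (dual_unit :: 'd ptree \<Rightarrow> 'k::field)
     fscale (fin_supp_on (PT D \<times> PT D)) (tens_mult dual_mult) (tens dual_unit dual_unit) dual_comult"
  unfolding alg_hom_def
proof (intro conjI ballI)
  show "linear_on (fin_supp_on (PT D)) fscale fscale (dual_comult :: ('d ptree \<Rightarrow> 'k) \<Rightarrow> _)"
    by (auto simp: linear_on_def fun_eq_iff dual_comult_apply fun_apply)
  show "dual_comult f \<in> fin_supp_on (PT D \<times> PT D)" if "f \<in> fin_supp_on (PT D)" for f :: "'d ptree \<Rightarrow> 'k"
    by (rule dual_comult_closed[OF that])
  show "dual_comult (dual_unit :: 'd ptree \<Rightarrow> 'k) = tens dual_unit dual_unit"
    by (auto simp: fun_eq_iff dual_comult_apply dual_unit_eq tens_def delta_def tmul_eq_empty)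
  fix f g :: "'d ptree \<Rightarrow> 'k" assume f: "f \<in> fin_supp_on (PT D)" and g: "g \<in> fin_supp_on (PT D)"
  have "finite {p. dual_comult f p \<noteq> 0}" "finite {p. dual_comult g p \<noteq> 0}"
    using dual_comult_closed[OF f] dual_comult_closed[OF g] by (simp_all add: fin_supp_on_iff)
  thus "dual_comult (dual_mult f g) = tens_mult dual_mult (dual_comult f) (dual_comult g)"
    by (simp add: fun_eq_iff dual_comult_apply dual_mult_tmul tens_mult_apply)
qed

text \<open>The only ideal of the empty tree is the empty one, so the coefficient of a product there
  is the product of the coefficients.\<close>

lemma alg_hom_dual_counit:
  "alg_hom fscale (fin_supp_on (PT D)) dual_mult (dual_unit :: 'd ptree \<Rightarrow> 'k::field) (*) UNIV (*) 1 dual_counit"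
  unfolding alg_hom_def
proof (intro conjI ballI)
  let ?e = "empty_ptree :: 'd ptree"
  let ?F = "rep_ptree ?e"
  have V: "verts ?F = {}" using ptree_class_empty_iff[OF part_tree_rep, of ?e] by simp
  have "ideals ?F = {{}}" by (auto simp: ideals_def V)
  hence "dual_mult f g ?e = f ?e * g ?e" for f g :: "'d ptree \<Rightarrow> 'k"
    unfolding dual_mult_rep using lower_empty[OF part_tree_rep, of ?e] upper_verts[OF part_tree_rep, of ?e] V by simp
  thus "dual_counit (dual_mult f g) = dual_counit f * dual_counit g" for f g :: "'d ptree \<Rightarrow> 'k"
    by (simp add: dual_counit_apply)
  show "dual_counit (dual_unit :: 'd ptree \<Rightarrow> 'k) = 1" by (simp add: dual_counit_apply dual_unit_eq delta_def)
qed (simp_all add: linear_on_def dual_counit_apply fun_apply)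

section \<open>Counting isomorphisms\<close>

text \<open>Maps are normalised outside the vertices, so that each isomorphism is counted once and
  there are finitely many.\<close>

definition isos :: "('v, 'd) pforest \<Rightarrow> ('w, 'd) pforest \<Rightarrow> ('v \<Rightarrow> 'w) set" where
  "isos F G = {\<phi> \<in> extensional (verts F). pf_iso \<phi> F G}"

lemma pf_iso_cong:
  assumes F: "part_forest F" and i: "pf_iso \<phi> F G" and eq: "\<And>v. v \<in> verts F \<Longrightarrow> \<psi> v = \<phi> v"
  shows "pf_iso \<psi> F G"
proof -
  have im: "\<psi> ` B = \<phi> ` B" if "B \<in> blocks F" for B
    using that partition_onD1[OF part_forestD(5)[OF F]] eq by (intro image_cong) auto
  have "(`) \<psi> ` blocks F = (`) \<phi> ` blocks F" by (rule image_cong[OF refl im])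
  moreover have "bij_betw \<psi> (verts F) (verts G)"
    using bij_betw_cong[of "verts F" \<psi> \<phi>] eq i by (simp add: pf_iso_def)
  ultimately show ?thesis using i eq by (simp add: pf_iso_def)
qed

lemma isos_restrict:
  assumes "part_forest F" "pf_iso \<phi> F G" shows "restrict \<phi> (verts F) \<in> isos F G"
  using pf_iso_cong[OF assms, of "restrict \<phi> (verts F)"] by (simp add: isos_def)

lemma isosD: "\<phi> \<in> isos F G \<Longrightarrow> pf_iso \<phi> F G" "\<phi> \<in> isos F G \<Longrightarrow> v \<notin> verts F \<Longrightarrow> \<phi> v = undefined"
  by (auto simp: isos_def extensional_def)

lemma card_isos_left:
  assumes F: "part_tree F" and F': "part_tree F'" and i: "pf_iso \<alpha> F' F"
  shows "card (isos F G) = card (isos F' G)"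
proof (rule bij_betw_same_card)
  let ?inv = "inv_into (verts F') \<alpha>"
  note D = pf_isoD[OF part_treeD[OF F'] i]
  have j: "pf_iso ?inv F F'" by (rule pf_iso_sym[OF F' i])
  have inv1: "?inv (\<alpha> v) = v" if "v \<in> verts F'" for v using D(2) that by simp
  have inv2: "\<alpha> (?inv v) = v" "?inv v \<in> verts F'" if "v \<in> verts F" for v
    using that D(3) by (auto simp: f_inv_into_f inv_into_into)
  show "bij_betw (\<lambda>\<phi>. restrict (\<phi> \<circ> \<alpha>) (verts F')) (isos F G) (isos F' G)"
  proof (rule bij_betwI[where g = "\<lambda>\<phi>. restrict (\<phi> \<circ> ?inv) (verts F)"])
    show "(\<lambda>\<phi>. restrict (\<phi> \<circ> \<alpha>) (verts F')) \<in> isos F G \<rightarrow> isos F' G"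
      using pf_iso_trans[OF F' i] by (auto intro!: isos_restrict[OF part_treeD[OF F']] dest: isosD(1))
    show "(\<lambda>\<phi>. restrict (\<phi> \<circ> ?inv) (verts F)) \<in> isos F' G \<rightarrow> isos F G"
      using pf_iso_trans[OF F j] by (auto intro!: isos_restrict[OF part_treeD[OF F]] dest: isosD(1))
    show "restrict (restrict (\<phi> \<circ> \<alpha>) (verts F') \<circ> ?inv) (verts F) = \<phi>" if "\<phi> \<in> isos F G" for \<phi>
      using isosD(2)[OF that] inv2 by (auto simp: fun_eq_iff restrict_def)
    show "restrict (restrict (\<phi> \<circ> ?inv) (verts F) \<circ> \<alpha>) (verts F') = \<phi>" if "\<phi> \<in> isos F' G" for \<phi>
      using isosD(2)[OF that] inv1 D(4) by (auto simp: fun_eq_iff restrict_def)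
  qed
qed

lemma card_isos_right:
  assumes F: "part_tree F" and G: "part_tree G" and i: "pf_iso \<beta> G G'"
  shows "card (isos F G) = card (isos F G')"
proof (rule bij_betw_same_card)
  let ?inv = "inv_into (verts G) \<beta>"
  note D = pf_isoD[OF part_treeD[OF G] i]
  have j: "pf_iso ?inv G' G" by (rule pf_iso_sym[OF G i])
  have inv1: "?inv (\<beta> v) = v" if "v \<in> verts G" for v using D(2) that by simp
  have inv2: "\<beta> (?inv v) = v" if "v \<in> verts G'" for v
    using that D(3) by (auto simp: f_inv_into_f)
  show "bij_betw (\<lambda>\<phi>. restrict (\<beta> \<circ> \<phi>) (verts F)) (isos F G) (isos F G')"
  proof (rule bij_betwI[where g = "\<lambda>\<phi>. restrict (?inv \<circ> \<phi>) (verts F)"])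
    show "(\<lambda>\<phi>. restrict (\<beta> \<circ> \<phi>) (verts F)) \<in> isos F G \<rightarrow> isos F G'"
      using pf_iso_trans[OF F _ i] by (auto intro!: isos_restrict[OF part_treeD[OF F]] dest: isosD(1))
    show "(\<lambda>\<phi>. restrict (?inv \<circ> \<phi>) (verts F)) \<in> isos F G' \<rightarrow> isos F G"
      using pf_iso_trans[OF F _ j] by (auto intro!: isos_restrict[OF part_treeD[OF F]] dest: isosD(1))
    show "restrict (?inv \<circ> restrict (\<beta> \<circ> \<phi>) (verts F)) (verts F) = \<phi>" if "\<phi> \<in> isos F G" for \<phi>
      using isosD(2)[OF that] inv1 pf_isoD(4)[OF part_treeD[OF F] isosD(1)[OF that]]
      by (auto simp: fun_eq_iff restrict_def)
    show "restrict (\<beta> \<circ> restrict (?inv \<circ> \<phi>) (verts F)) (verts F) = \<phi>" if "\<phi> \<in> isos F G'" for \<phi>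
      using isosD(2)[OF that] inv2 pf_isoD(4)[OF part_treeD[OF F] isosD(1)[OF that]]
      by (auto simp: fun_eq_iff restrict_def)
  qed
qed

text \<open>Automorphisms extended by the identity and automorphisms cut off outside the vertices
  are the same data.\<close>

lemma sym_factor_isos: "sym_factor T = card (isos (rep_ptree T) (rep_ptree T))"
  unfolding sym_factor_def
proof (rule bij_betw_same_card)
  let ?F = "rep_ptree T"
  note F = part_forest_rep[of T]
  show "bij_betw (\<lambda>\<phi>. restrict \<phi> (verts ?F)) {\<phi>. \<phi> permutes verts ?F \<and> pf_iso \<phi> ?F ?F} (isos ?F ?F)"
  proof (rule bij_betwI[where g = "\<lambda>\<phi> v. if v \<in> verts ?F then \<phi> v else v"])
    show "(\<lambda>\<phi>. restrict \<phi> (verts ?F)) \<in> {\<phi>. \<phi> permutes verts ?F \<and> pf_iso \<phi> ?F ?F} \<rightarrow> isos ?F ?F"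
      using isos_restrict[OF F] by auto
    show "(\<lambda>\<phi> v. if v \<in> verts ?F then \<phi> v else v) \<in> isos ?F ?F \<rightarrow> {\<phi>. \<phi> permutes verts ?F \<and> pf_iso \<phi> ?F ?F}"
    proof (intro funcsetI CollectI conjI)
      fix \<phi> assume \<phi>: "\<phi> \<in> isos ?F ?F"
      show i: "pf_iso (\<lambda>v. if v \<in> verts ?F then \<phi> v else v) ?F ?F"
        by (rule pf_iso_cong[OF F isosD(1)[OF \<phi>]]) simp
      show "(\<lambda>v. if v \<in> verts ?F then \<phi> v else v) permutes verts ?F"
        by (rule bij_imp_permutes[OF pf_isoD(1)[OF F i]]) simp
    qed
    show "(\<lambda>v. if v \<in> verts ?F then restrict \<phi> (verts ?F) v else v) = \<phi>"
      if "\<phi> \<in> {\<phi>. \<phi> permutes verts ?F \<and> pf_iso \<phi> ?F ?F}" for \<phi>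
      using that by (auto simp: fun_eq_iff permutes_not_in)
    show "restrict (\<lambda>v. if v \<in> verts ?F then \<phi> v else v) (verts ?F) = \<phi>" if "\<phi> \<in> isos ?F ?F" for \<phi>
      using isosD(2)[OF that] by (auto simp: fun_eq_iff restrict_def)
  qed
qed

text \<open>Composition with fixed isomorphisms identifies the isomorphisms from \<open>F\<close> to
  \<open>G\<close> with the automorphisms of a representative, if there are any.\<close>

lemma card_isos:
  assumes F: "part_tree F" and G: "part_tree G"
  shows "card (isos F G) = (if ptree_class F = ptree_class G then sym_factor (ptree_class F) else 0)"
proof (cases "ptree_class F = ptree_class G")
  case True
  obtain \<phi> where i: "pf_iso \<phi> F (rep_ptree (ptree_class F))" by (rule rep_ptree_class[OF F])
  obtain \<psi> where j: "pf_iso \<psi> G (rep_ptree (ptree_class G))" by (rule rep_ptree_class[OF G])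
  show ?thesis
    using card_isos_right[OF F G j] card_isos_left[OF part_tree_rep F i, of "rep_ptree (ptree_class G)"] True
    by (simp add: sym_factor_isos)
next
  case False
  hence "isos F G = {}" using ptree_class_eqI[OF F G] by (auto dest: isosD(1))
  thus ?thesis using False by simp
qed

lemma sym_factor_pos: "sym_factor T > 0"
proof -
  let ?S = "{\<phi>. \<phi> permutes verts (rep_ptree T) \<and> pf_iso \<phi> (rep_ptree T) (rep_ptree T)}"
  have "finite ?S"
    by (rule finite_subset[OF _ finite_permutations[OF part_forestD(1)[OF part_forest_rep]]]) auto
  moreover have "id \<in> ?S" using pf_iso_refl[OF part_tree_rep] permutes_id by blast
  ultimately show ?thesis unfolding sym_factor_def using card_gt_0_iff by blast
qed

lemma finite_isos: "part_tree F \<Longrightarrow> part_tree G \<Longrightarrow> finite (isos F G)"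
proof -
  assume F: "part_tree F" and G: "part_tree G"
  have "isos F G \<subseteq> verts F \<rightarrow>\<^sub>E verts G"
    using pf_isoD(4)[OF part_treeD[OF F]] by (auto simp: isos_def PiE_def)
  thus ?thesis
    by (rule finite_subset) (intro finite_PiE part_forestD(1) part_treeD F G)
qed

section \<open>Grafting\<close>

context
  fixes F :: "('v, 'd) pforest" and G :: "('w, 'd) pforest" and s r b
  assumes F: "part_tree F" and G: "part_tree G" and r: "roots G = {r}" and s: "s \<in> verts F"
    and b: "b \<in> insert None (Some ` child_blocks F s)"
begin

lemma graft_simps:
  "verts (graft F s b G) = verts F <+> verts G"
  "(Inl u, Inl v) \<in> edges (graft F s b G) \<longleftrightarrow> (u, v) \<in> edges F"
  "(Inr x, Inr y) \<in> edges (graft F s b G) \<longleftrightarrow> (x, y) \<in> edges G"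
  "(Inl u, Inr y) \<in> edges (graft F s b G) \<longleftrightarrow> u = s \<and> y = r"
  "(Inr x, Inl v) \<notin> edges (graft F s b G)"
  "dec (graft F s b G) (Inl u) = dec F u"
  "dec (graft F s b G) (Inr x) = dec G x"
  by (auto simp: graft_def Let_def r)

lemma root_block: "C \<in> blocks G \<Longrightarrow> r \<in> C \<Longrightarrow> C = {r}"
proof -
  assume C: "C \<in> blocks G" "r \<in> C"
  show "C = {r}"
  proof (intro equalityI subsetI)
    fix y assume "y \<in> C"
    hence "same_block G r y" using C by (auto simp: same_block_def)
    thus "y \<in> {r}" using part_forestD(12)[OF part_treeD[OF G]] r by auto
  next
    fix y assume "y \<in> {r}"
    thus "y \<in> C" using C by simp
  qed
qed

lemma root_block_in: "{r} \<in> blocks G"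
proof -
  have "r \<in> verts G" using r roots_subset[of G] by auto
  then obtain C where "C \<in> blocks G" "r \<in> C" using partition_onD1[OF part_forestD(5)[OF part_treeD[OF G]]] by auto
  thus ?thesis using root_block by simp
qed

text \<open>One description for both cases of \<open>b\<close>: with \<open>b = Some B\<close> the
  blocks \<open>B\<close> and \<open>{r}\<close> disappear and their union takes their place. The
  root block of \<open>G\<close> is \<open>{r}\<close> because \<open>G\<close> has one
  root.\<close>

lemma graft_blocks:
  "C \<in> blocks (graft F s b G) \<longleftrightarrow>
     (\<exists>B\<in>blocks F. b \<noteq> Some B \<and> C = Inl ` B) \<or> (\<exists>B\<in>blocks G. (b \<noteq> None \<longrightarrow> B \<noteq> {r}) \<and> C = Inr ` B) \<or>
     (\<exists>B. b = Some B \<and> C = insert (Inr r) (Inl ` B))"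
proof (cases b)
  case None
  thus ?thesis by (auto simp: graft_def Let_def disj_union_def)
next
  case (Some B)
  have B: "B \<in> blocks F" using b Some by (auto simp: child_blocks_def)
  hence "B \<noteq> {}" using partition_onD3[OF part_forestD(5)[OF part_treeD[OF F]]] by auto
  have eq: "blocks (graft F s b G) = insert (Inl ` B \<union> {Inr r}) ((((`) Inl ` blocks F) \<union> ((`) Inr ` blocks G)) - {Inl ` B, {Inr r}})"
    using Some by (auto simp: graft_def Let_def disj_union_def r)
  have n1: "Inl ` B' \<noteq> {Inr r}" for B' :: "'v set" by auto
  have n2: "Inr ` C' \<noteq> Inl ` B" for C' :: "'w set" using \<open>B \<noteq> {}\<close> by auto
  have n3: "Inl ` B' = (Inl ` B :: ('v + 'w) set) \<longleftrightarrow> B' = B" for B' :: "'v set" by (simp add: inj_image_eq_iff)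
  have n4: "Inr ` C' = ({Inr r} :: ('v + 'w) set) \<longleftrightarrow> C' = {r}" for C' :: "'w set"
    using inj_image_eq_iff[of "Inr :: 'w \<Rightarrow> 'v + 'w" C' "{r}"] by simp
  have l: "(\<exists>B'\<in>blocks F. C = Inl ` B') \<and> C \<noteq> Inl ` B \<and> C \<noteq> {Inr r} \<longleftrightarrow> (\<exists>B'\<in>blocks F. b \<noteq> Some B' \<and> C = Inl ` B')"
    by (auto simp: n1 n3 Some)
  have g: "(\<exists>C'\<in>blocks G. C = Inr ` C') \<and> C \<noteq> Inl ` B \<and> C \<noteq> {Inr r} \<longleftrightarrow>
      (\<exists>C'\<in>blocks G. (b \<noteq> None \<longrightarrow> C' \<noteq> {r}) \<and> C = Inr ` C')"
    by (auto simp: n2 n4 Some)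
  have i: "C = Inl ` B \<union> {Inr r} \<longleftrightarrow> (\<exists>B. b = Some B \<and> C = insert (Inr r) (Inl ` B))"
    by (simp add: Some)
  show ?thesis
    unfolding eq l[symmetric] g[symmetric] i[symmetric] insert_iff Diff_iff Un_iff image_iff empty_iff by blast
qed

lemma graft_same_block:
  "same_block (graft F s b G) (Inl u) (Inl v) \<longleftrightarrow> same_block F u v"
  "same_block (graft F s b G) (Inr x) (Inr y) \<longleftrightarrow> same_block G x y"
  "same_block (graft F s b G) (Inl u) (Inr y) \<longleftrightarrow> (\<exists>B. b = Some B \<and> u \<in> B \<and> y = r)"
  "same_block (graft F s b G) (Inr y) (Inl u) \<longleftrightarrow> (\<exists>B. b = Some B \<and> u \<in> B \<and> y = r)"
proof -
  have bF: "B \<in> blocks F" if "b = Some B" for B using b that by (auto simp: child_blocks_def)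
  show "same_block (graft F s b G) (Inl u) (Inl v) \<longleftrightarrow> same_block F u v"
  proof
    assume "same_block (graft F s b G) (Inl u) (Inl v)"
    then obtain C where C: "C \<in> blocks (graft F s b G)" "Inl u \<in> C" "Inl v \<in> C" by (auto simp: same_block_def)
    thus "same_block F u v" unfolding graft_blocks using bF by (auto simp: same_block_def)
  next
    assume "same_block F u v"
    then obtain B where B: "B \<in> blocks F" "u \<in> B" "v \<in> B" by (auto simp: same_block_def)
    show "same_block (graft F s b G) (Inl u) (Inl v)"
    proof (cases "b = Some B")
      case True
      hence "insert (Inr r) (Inl ` B) \<in> blocks (graft F s b G)" unfolding graft_blocks by blast
      thus ?thesis using B unfolding same_block_def by (intro bexI) auto
    next
      case False
      hence "Inl ` B \<in> blocks (graft F s b G)" unfolding graft_blocks using B by blast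
      thus ?thesis using B unfolding same_block_def by (intro bexI) auto
    qed
  qed
  show "same_block (graft F s b G) (Inr x) (Inr y) \<longleftrightarrow> same_block G x y"
  proof
    assume "same_block (graft F s b G) (Inr x) (Inr y)"
    then obtain C where C: "C \<in> blocks (graft F s b G)" "Inr x \<in> C" "Inr y \<in> C" by (auto simp: same_block_def)
    thus "same_block G x y" unfolding graft_blocks using root_block_in by (auto simp: same_block_def)
  next
    assume "same_block G x y"
    then obtain B where B: "B \<in> blocks G" "x \<in> B" "y \<in> B" by (auto simp: same_block_def)
    show "same_block (graft F s b G) (Inr x) (Inr y)"
    proof (cases "b \<noteq> None \<and> B = {r}")
      case True
      then obtain B' where "b = Some B'" by auto
      hence "insert (Inr r) (Inl ` B') \<in> blocks (graft F s b G)" unfolding graft_blocks by blast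
      thus ?thesis using B True unfolding same_block_def by (intro bexI) auto
    next
      case False
      have "\<exists>C\<in>blocks G. (b \<noteq> None \<longrightarrow> C \<noteq> {r}) \<and> Inr ` B = Inr ` C"
        using False by (intro bexI[OF _ B(1)]) auto
      hence "Inr ` B \<in> blocks (graft F s b G)" unfolding graft_blocks by (intro disjI2 disjI1)
      thus ?thesis using B unfolding same_block_def by (intro bexI) auto
    qed
  qed
  show *: "same_block (graft F s b G) (Inl u) (Inr y) \<longleftrightarrow> (\<exists>B. b = Some B \<and> u \<in> B \<and> y = r)"
  proof
    assume "same_block (graft F s b G) (Inl u) (Inr y)"
    then obtain C where C: "C \<in> blocks (graft F s b G)" "Inl u \<in> C" "Inr y \<in> C" by (auto simp: same_block_def)
    thus "\<exists>B. b = Some B \<and> u \<in> B \<and> y = r" unfolding graft_blocks by auto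
  next
    assume "\<exists>B. b = Some B \<and> u \<in> B \<and> y = r"
    then obtain B where B: "b = Some B" "u \<in> B" "y = r" by blast
    hence "insert (Inr r) (Inl ` B) \<in> blocks (graft F s b G)" unfolding graft_blocks by blast
    thus "same_block (graft F s b G) (Inl u) (Inr y)" using B unfolding same_block_def by (intro bexI) auto
  qed
  show "same_block (graft F s b G) (Inr y) (Inl u) \<longleftrightarrow> (\<exists>B. b = Some B \<and> u \<in> B \<and> y = r)"
    unfolding *[symmetric] by (auto simp: same_block_def)
qed

lemma roots_graft: "roots (graft F s b G) = Inl ` roots F"
proof (rule set_eqI)
  fix x
  show "x \<in> roots (graft F s b G) \<longleftrightarrow> x \<in> Inl ` roots F"
  proof (cases x)
    case (Inl v)
    have "(\<exists>u. (u, Inl v) \<in> edges (graft F s b G)) \<longleftrightarrow> (\<exists>u. (u, v) \<in> edges F)"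
    proof
      assume "\<exists>u. (u, Inl v) \<in> edges (graft F s b G)"
      then obtain u where "(u, Inl v) \<in> edges (graft F s b G)" by blast
      thus "\<exists>u. (u, v) \<in> edges F" by (cases u) (auto simp: graft_simps)
    next
      assume "\<exists>u. (u, v) \<in> edges F"
      thus "\<exists>u. (u, Inl v) \<in> edges (graft F s b G)" using graft_simps(2) by blast
    qed
    thus ?thesis by (auto simp: Inl roots_def graft_simps(1))
  next
    case (Inr y)
    have "\<exists>u. (u, Inr y) \<in> edges (graft F s b G)" if y: "y \<in> verts G"
    proof (cases "y = r")
      case True
      thus ?thesis using graft_simps(4) by blast
    next
      case False
      hence "y \<notin> roots G" using r by simp
      then obtain x where "(x, y) \<in> edges G" using y by (auto simp: roots_def)
      thus ?thesis using graft_simps(3) by blast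
    qed
    thus ?thesis by (auto simp: Inr roots_def graft_simps(1))
  qed
qed

text \<open>The merged block consists of children of \<open>s\<close>: those of \<open>B\<close> by
  \<open>child_blocks\<close>, and \<open>r\<close> because it is attached to
  \<open>s\<close>.\<close>

lemma part_tree_graft: "part_tree (graft F s b G)"
proof -
  let ?U = "graft F s b G"
  note F' = part_treeD[OF F] and G' = part_treeD[OF G]
  note D = part_forestD[OF F'] and E = part_forestD[OF G']
  have rG: "r \<in> verts G" using r roots_subset[of G] by auto
  have bF: "B \<in> blocks F" if "b = Some B" for B using b that by (auto simp: child_blocks_def)
  have bE: "(s, u) \<in> edges F" if "b = Some B" "u \<in> B" for B u using b that by (auto simp: child_blocks_def)
  have ps: "w \<noteq> r" if "(x, w) \<in> edges G" for x w using that r by (auto simp: roots_def)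
  obtain h :: "_ \<Rightarrow> nat" where h: "\<And>u v. (u, v) \<in> edges F \<Longrightarrow> h u < h v"
    using F' by (auto simp: part_forest_def rooted_forest_rank)
  obtain k :: "_ \<Rightarrow> nat" where k: "\<And>u v. (u, v) \<in> edges G \<Longrightarrow> k u < k v"
    using G' by (auto simp: part_forest_def rooted_forest_rank)
  have "rooted_forest ?U"
    unfolding rooted_forest_rank
  proof (intro conjI allI impI)
    show "finite (verts ?U)" using D(1) E(1) by (simp add: graft_simps)
    show "edges ?U \<subseteq> verts ?U \<times> verts ?U"
    proof
      fix e assume "e \<in> edges ?U"
      moreover obtain x y where "e = (x, y)" by (cases e)
      ultimately show "e \<in> verts ?U \<times> verts ?U"
        using D(2,3) E(2,3) s rG by (cases x; cases y) (auto simp: graft_simps)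
    qed
    show "u = u'" if uv: "(u, v) \<in> edges ?U \<and> (u', v) \<in> edges ?U" for u u' v
    proof (cases v)
      case (Inl w)
      thus ?thesis using uv D(4) by (cases u; cases u') (auto simp: graft_simps)
    next
      case (Inr w)
      thus ?thesis using uv E(4) by (cases u; cases u') (auto simp: graft_simps dest: ps)
    qed
    show "\<exists>h::_ \<Rightarrow> nat. \<forall>u v. (u, v) \<in> edges ?U \<longrightarrow> h u < h v"
    \<comment> \<open>The only new edge goes from \<open>s\<close> to \<open>r\<close>, so the ranks
      of \<open>G\<close> are shifted above the rank of \<open>s\<close>.\<close>
    proof (intro exI[of _ "case_sum h (\<lambda>w. h s + 1 + k w)"] allI impI)
      show "case_sum h (\<lambda>w. h s + 1 + k w) u < case_sum h (\<lambda>w. h s + 1 + k w) v" if "(u, v) \<in> edges ?U" for u v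
        using that h k by (cases u; cases v) (auto simp: graft_simps)
    qed
  qed
  moreover have "partition_on (verts ?U) (blocks ?U)"
  proof (rule partition_onI')
    show "v \<in> verts ?U \<longleftrightarrow> (\<exists>B\<in>blocks ?U. v \<in> B)" for v
    proof -
      have "(\<exists>B\<in>blocks ?U. v \<in> B) \<longleftrightarrow> same_block ?U v v" by (auto simp: same_block_def)
      also have "\<dots> \<longleftrightarrow> v \<in> verts ?U"
        using D(6,8) E(6,8) by (cases v) (auto simp: graft_same_block graft_simps)
      finally show ?thesis ..
    qed
    show "{} \<notin> blocks ?U"
      using partition_onD3[OF D(5)] partition_onD3[OF E(5)] by (auto simp: graft_blocks)
    fix B C v assume B: "B \<in> blocks ?U" and C: "C \<in> blocks ?U" and v: "v \<in> B" "v \<in> C"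
    show "B = C"
    proof (cases v)
      case (Inl w)
      \<comment> \<open>Any block of the graft around \<open>w\<close> is a function of the block of
        \<open>F\<close> around \<open>w\<close>, which is unique.\<close>
      have *: "\<exists>B'\<in>blocks F. w \<in> B' \<and> B = (if b = Some B' then insert (Inr r) (Inl ` B') else Inl ` B')"
        if "B \<in> blocks ?U" "Inl w \<in> B" for B
        using that bF unfolding graft_blocks by auto
      show ?thesis using *[OF B] *[OF C] v Inl partition_on_unique[OF D(5), of _ _ w] by metis
    next
      case (Inr w)
      have *: "\<exists>B'\<in>blocks G. w \<in> B' \<and> B = (if b \<noteq> None \<and> B' = {r} then insert (Inr r) (Inl ` the b) else Inr ` B')"
        if B: "B \<in> blocks ?U" "Inr w \<in> B" for B
      proof -
        consider (1) B' where "B = Inl ` B'" | (2) B' where "B' \<in> blocks G" "b \<noteq> None \<longrightarrow> B' \<noteq> {r}" "B = Inr ` B'"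
          | (3) B' where "b = Some B'" "B = insert (Inr r) (Inl ` B')"
          using B(1) unfolding graft_blocks by metis
        thus ?thesis
        proof cases
          case 1
          thus ?thesis using B(2) by auto
        next
          case 2
          thus ?thesis using B(2) by (intro bexI[OF _ 2(1)]) auto
        next
          case 3
          thus ?thesis using B(2) by (intro bexI[OF _ root_block_in]) auto
        qed
      qed
      show ?thesis using *[OF B] *[OF C] v Inr partition_on_unique[OF E(5), of _ _ w] by metis
    qed
  qed
  moreover have "(u \<in> roots ?U \<and> v \<in> roots ?U) \<or> (\<exists>p. (p, u) \<in> edges ?U \<and> (p, v) \<in> edges ?U)"
    if sb: "same_block ?U u v" for u v
  proof (cases u; cases v)
    fix x y assume uv: "u = Inl x" "v = Inl y"
    hence "same_block F x y" using sb by (simp add: graft_same_block)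
    hence "(x \<in> roots F \<and> y \<in> roots F) \<or> (\<exists>p. (p, x) \<in> edges F \<and> (p, y) \<in> edges F)"
      using F' by (simp add: part_forest_iff)
    thus ?thesis
    proof
      assume "\<exists>p. (p, x) \<in> edges F \<and> (p, y) \<in> edges F"
      then obtain p where "(p, x) \<in> edges F" "(p, y) \<in> edges F" by blast
      hence "(Inl p, u) \<in> edges ?U \<and> (Inl p, v) \<in> edges ?U" using uv by (simp add: graft_simps)
      thus ?thesis by blast
    qed (use uv in \<open>simp add: roots_graft\<close>)
  next
    fix x y assume uv: "u = Inr x" "v = Inr y"
    hence "same_block G x y" using sb by (simp add: graft_same_block)
    hence "(x = r \<and> y = r) \<or> (\<exists>p. (p, x) \<in> edges G \<and> (p, y) \<in> edges G)"
      using G' r by (simp add: part_forest_iff)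
    thus ?thesis using uv graft_simps(3) graft_simps(4) by metis
  next
    fix x y assume uv: "u = Inl x" "v = Inr y"
    hence "(s, x) \<in> edges F" "y = r" using sb bE by (auto simp: graft_same_block)
    hence "(Inl s, u) \<in> edges ?U \<and> (Inl s, v) \<in> edges ?U" using uv by (simp add: graft_simps)
    thus ?thesis by blast
  next
    fix x y assume uv: "u = Inr x" "v = Inl y"
    hence "(s, y) \<in> edges F" "x = r" using sb bE by (auto simp: graft_same_block)
    hence "(Inl s, u) \<in> edges ?U \<and> (Inl s, v) \<in> edges ?U" using uv by (simp add: graft_simps)
    thus ?thesis by blast
  qed
  ultimately have "part_forest ?U" unfolding part_forest_iff by blast
  thus ?thesis using F unfolding part_tree_iff by (auto simp: roots_graft graft_same_block)
qed

end

lemma same_block_determines: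
  assumes F: "part_forest F" and B: "B \<in> blocks F" "u \<in> B"
  shows "B = {v. same_block F u v}"
proof (intro equalityI subsetI)
  fix v assume "v \<in> {v. same_block F u v}"
  then obtain C where C: "C \<in> blocks F" "u \<in> C" "v \<in> C" by (auto simp: same_block_def)
  have "C = B" by (rule partition_on_unique[OF part_forestD(5)[OF F] C(1) B(1) C(2) B(2)])
  thus "v \<in> B" using C by simp
qed (use B in \<open>auto simp: same_block_def\<close>)

definition graft_sites :: "('v, 'd) pforest \<Rightarrow> ('v \<times> 'v set option) set" where
  "graft_sites F = Sigma (verts F) (\<lambda>s. insert None (Some ` child_blocks F s))"

lemma finite_graft_sites: "part_forest F \<Longrightarrow> finite (graft_sites F)"
proof -
  assume F: "part_forest F"
  have "child_blocks F s \<subseteq> blocks F" for s by (auto simp: child_blocks_def)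
  hence "finite (child_blocks F s)" for s
    using finite_elements[OF part_forestD(1,5)[OF F]] finite_subset by blast
  thus ?thesis unfolding graft_sites_def using part_forestD(1)[OF F] by (intro finite_SigmaI) auto
qed

section \<open>Graftings with an isomorphism, against ideals with two isomorphisms\<close>

context
  fixes F :: "('v, 'd) pforest" and G :: "('w, 'd) pforest" and H :: "('x, 'd) pforest" and r r0 \<rho>
  assumes F: "part_tree F" and G: "part_tree G" and H: "part_tree H"
    and r0: "roots F = {r0}" and r: "roots G = {r}" and \<rho>: "roots H = {\<rho>}"
begin

lemmas F_forest = part_treeD[OF F] and G_forest = part_treeD[OF G] and H_forest = part_treeD[OF H]

text \<open>The site \<open>p\<close> is left out of the value: it is recovered from the position of
  the grafted tree in \<open>H\<close>.\<close>

definition cut_map where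
  "cut_map = (\<lambda>(p :: 'v \<times> 'v set option, \<gamma> :: 'v + 'w \<Rightarrow> 'x).
     (\<gamma> ` Inr ` verts G, restrict (\<gamma> \<circ> Inl) (verts F), restrict (\<gamma> \<circ> Inr) (verts G)))"

text \<open>No edge of a graft leads from \<open>G\<close> back to \<open>F\<close>, so the image of
  \<open>G\<close> is an ideal. Its only root is the image of \<open>r\<close>, hence merging the
  roots changes nothing on it.\<close>

lemma cut_map_in:
  assumes p: "(s, b) \<in> graft_sites F" and g: "pf_iso \<gamma> (graft F s b G) H"
  shows "\<gamma> ` Inr ` verts G \<in> ideals H"
    "pf_iso (\<gamma> \<circ> Inl) F (restrict_forest H (verts H - \<gamma> ` Inr ` verts G))"
    "pf_iso (\<gamma> \<circ> Inr) G (merge_roots (restrict_forest H (\<gamma> ` Inr ` verts G)))"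
proof -
  let ?U = "graft F s b G" and ?I = "\<gamma> ` Inr ` verts G"
  have s: "s \<in> verts F" and b: "b \<in> insert None (Some ` child_blocks F s)" using p by (auto simp: graft_sites_def)
  note S = graft_simps[OF F G r s b] and B = graft_same_block[OF F G r s b]
  have U: "part_forest ?U" by (rule part_treeD[OF part_tree_graft[OF F G r s b]])
  note D = pf_isoD[OF U g]
  have VH: "verts H = \<gamma> ` Inl ` verts F \<union> ?I" using D(3) by (simp add: S Plus_def image_Un)
  have inj: "\<gamma> (Inl u) \<noteq> \<gamma> (Inr y)" if "u \<in> verts F" "y \<in> verts G" for u y
    using D(8)[of "Inl u" "Inr y"] that by (auto simp: S)
  have notI: "\<gamma> (Inl u) \<notin> ?I" if "u \<in> verts F" for u using inj that by blast
  have VI: "verts H - ?I = \<gamma> ` Inl ` verts F" using VH notI by auto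
  show I: "?I \<in> ideals H"
    unfolding ideals_def
  proof (intro CollectI conjI allI impI)
    show "?I \<subseteq> verts H" using VH by auto
    fix v w assume vw: "v \<in> ?I \<and> (v, w) \<in> edges H"
    then obtain x where x: "x \<in> verts G" "v = \<gamma> (Inr x)" by auto
    have "w \<in> verts H" using part_forestD(3)[OF H_forest] vw by blast
    then obtain z where z: "z \<in> verts ?U" "w = \<gamma> z" using D(3) by auto
    have "(Inr x, z) \<in> edges ?U" using D(5)[of "Inr x" z] vw x z by (auto simp: S)
    hence "\<exists>y\<in>verts G. z = Inr y" using z by (cases z) (auto simp: S)
    thus "w \<in> ?I" using z by auto
  qed
  show "pf_iso (\<gamma> \<circ> Inl) F (restrict_forest H (verts H - ?I))"
  proof (rule pf_isoI[OF F_forest part_forest_restrict[OF H_forest]])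
    show "bij_betw (\<gamma> \<circ> Inl) (verts F) (verts (restrict_forest H (verts H - ?I)))"
      unfolding bij_betw_def
    proof
      show "inj_on (\<gamma> \<circ> Inl) (verts F)" by (rule inj_onI) (use D(8) in \<open>auto simp: S\<close>)
      show "(\<gamma> \<circ> Inl) ` verts F = verts (restrict_forest H (verts H - ?I))"
        using VI by (auto simp: image_comp)
    qed
    have m: "\<gamma> (Inl u) \<in> verts H - ?I" if "u \<in> verts F" for u using VI that by blast
    show "(u, v) \<in> edges F \<longleftrightarrow> ((\<gamma> \<circ> Inl) u, (\<gamma> \<circ> Inl) v) \<in> edges (restrict_forest H (verts H - ?I))"
      if "u \<in> verts F" "v \<in> verts F" for u v
      using D(5)[of "Inl u" "Inl v"] that m by (simp add: S InlI)
    show "same_block F u v \<longleftrightarrow> same_block (restrict_forest H (verts H - ?I)) ((\<gamma> \<circ> Inl) u) ((\<gamma> \<circ> Inl) v)"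
      if "u \<in> verts F" "v \<in> verts F" for u v
      using D(6)[of "Inl u" "Inl v"] that m by (simp add: S B InlI)
    show "dec (restrict_forest H (verts H - ?I)) ((\<gamma> \<circ> Inl) v) = dec F v" if "v \<in> verts F" for v
      using D(7)[of "Inl v"] that by (simp add: S InlI)
  qed
  have E: "(\<gamma> (Inr x), \<gamma> (Inr y)) \<in> edges H \<longleftrightarrow> (x, y) \<in> edges G" if "x \<in> verts G" "y \<in> verts G" for x y
    using D(5)[of "Inr x" "Inr y"] that by (simp add: S InrI)
  have R: "\<gamma> (Inr y) \<in> roots (restrict_forest H ?I) \<longleftrightarrow> y = r" if y: "y \<in> verts G" for y
  proof -
    have "(\<forall>u\<in>?I. (u, \<gamma> (Inr y)) \<notin> edges H) \<longleftrightarrow> (\<forall>x\<in>verts G. (x, y) \<notin> edges G)"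
      using E y by simp
    also have "\<dots> \<longleftrightarrow> y \<in> roots G" using y part_forestD(2)[OF G_forest] by (auto simp: roots_def)
    finally show ?thesis unfolding roots_restrict[OF H_forest] using y VH r by auto
  qed
  show "pf_iso (\<gamma> \<circ> Inr) G (merge_roots (restrict_forest H ?I))"
  proof (rule pf_isoI[OF G_forest part_treeD[OF part_tree_upper[OF H_forest]]])
    show "bij_betw (\<gamma> \<circ> Inr) (verts G) (verts (merge_roots (restrict_forest H ?I)))"
      unfolding bij_betw_def
    proof
      show "inj_on (\<gamma> \<circ> Inr) (verts G)" by (rule inj_onI) (use D(8) in \<open>auto simp: S\<close>)
      show "(\<gamma> \<circ> Inr) ` verts G = verts (merge_roots (restrict_forest H ?I))"
        using VH by auto
    qed
    show "(u, v) \<in> edges G \<longleftrightarrow> ((\<gamma> \<circ> Inr) u, (\<gamma> \<circ> Inr) v) \<in> edges (merge_roots (restrict_forest H ?I))"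
      if "u \<in> verts G" "v \<in> verts G" for u v
      using E that by simp
    show "same_block G u v \<longleftrightarrow> same_block (merge_roots (restrict_forest H ?I)) ((\<gamma> \<circ> Inr) u) ((\<gamma> \<circ> Inr) v)"
      if uv: "u \<in> verts G" "v \<in> verts G" for u v
    proof -
      have "same_block H (\<gamma> (Inr u)) (\<gamma> (Inr v)) \<longleftrightarrow> same_block G u v"
        using D(6)[of "Inr u" "Inr v"] uv by (simp add: S B InrI)
      moreover have "same_block G r r" using part_forestD(8)[OF G_forest] r roots_subset[of G] by auto
      ultimately show ?thesis
        unfolding same_block_merge[OF part_forest_restrict[OF H_forest]] using uv by (auto simp: R)
    qed
    show "dec (merge_roots (restrict_forest H ?I)) ((\<gamma> \<circ> Inr) v) = dec G v" if "v \<in> verts G" for v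
      using D(7)[of "Inr v"] that by (simp add: S InrI)
  qed
qed

text \<open>The two restrictions determine \<gamma>. The parent of the image of \<open>r\<close> is
  the image of \<open>s\<close>, and the vertices of \<open>F\<close> whose images share the block
  of the image of \<open>r\<close> form \<open>b\<close>, with \<open>None\<close> when there are
  none.\<close>

lemma cut_map_inj:
  assumes p: "(s, b) \<in> graft_sites F" "(s', b') \<in> graft_sites F"
    and g: "\<gamma> \<in> isos (graft F s b G) H" "\<gamma>' \<in> isos (graft F s' b' G) H"
    and eq: "cut_map ((s, b), \<gamma>) = cut_map ((s', b'), \<gamma>')"
  shows "s = s'" "b = b'" "\<gamma> = \<gamma>'"
proof -
  have s: "s \<in> verts F" and b: "b \<in> insert None (Some ` child_blocks F s)"
    and s': "s' \<in> verts F" and b': "b' \<in> insert None (Some ` child_blocks F s')"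
    using p by (auto simp: graft_sites_def)
  note B = graft_same_block[OF F G r s b] and B' = graft_same_block[OF F G r s' b']
  note S = graft_simps[OF F G r s b] graft_simps[OF F G r s' b']
  note D = pf_isoD[OF part_treeD[OF part_tree_graft[OF F G r s b]] isosD(1)[OF g(1)]]
  note D' = pf_isoD[OF part_treeD[OF part_tree_graft[OF F G r s' b']] isosD(1)[OF g(2)]]
  have rG: "r \<in> verts G" using r roots_subset[of G] by auto
  have l: "\<gamma> (Inl u) = \<gamma>' (Inl u)" if "u \<in> verts F" for u
  proof -
    have "restrict (\<gamma> \<circ> Inl) (verts F) u = restrict (\<gamma>' \<circ> Inl) (verts F) u" using eq by (simp add: cut_map_def)
    thus ?thesis using that by simp
  qed
  have rr: "\<gamma> (Inr u) = \<gamma>' (Inr u)" if "u \<in> verts G" for u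
  proof -
    have "restrict (\<gamma> \<circ> Inr) (verts G) u = restrict (\<gamma>' \<circ> Inr) (verts G) u" using eq by (simp add: cut_map_def)
    thus ?thesis using that by simp
  qed
  show "\<gamma> = \<gamma>'"
  proof
    fix x show "\<gamma> x = \<gamma>' x"
      by (cases x; cases "x \<in> verts F <+> verts G")
        (use l rr isosD(2)[OF g(1), of x] isosD(2)[OF g(2), of x] in \<open>auto simp: S\<close>)
  qed
  have "(\<gamma> (Inl s), \<gamma> (Inr r)) \<in> edges H" using D(5)[of "Inl s" "Inr r"] s rG by (simp add: S InlI InrI)
  hence "(\<gamma>' (Inl s), \<gamma>' (Inr r)) \<in> edges H" using l[OF s] rr[OF rG] by simp
  thus "s = s'" using D'(5)[of "Inl s" "Inr r"] s rG by (simp add: S InlI InrI)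
  have m: "(\<exists>B. b = Some B \<and> u \<in> B) \<longleftrightarrow> (\<exists>B. b' = Some B \<and> u \<in> B)" if u: "u \<in> verts F" for u
    using D(6)[of "Inl u" "Inr r"] D'(6)[of "Inl u" "Inr r"] u rG l[OF u] rr[OF rG] by (simp add: S B B' InlI InrI)
  \<comment> \<open>Blocks are nonempty, so \<open>None\<close> and \<open>Some\<close> are told
    apart by membership.\<close>
  have sub: "C \<subseteq> verts F \<and> C \<noteq> {}" if "b = Some C \<or> b' = Some C" for C
  proof -
    have "C \<in> blocks F" using that b b' by (auto simp: child_blocks_def)
    thus ?thesis using partition_onD1[OF part_forestD(5)[OF F_forest]] partition_onD3[OF part_forestD(5)[OF F_forest]] by auto
  qed
  show "b = b'"
  proof (cases b)
    case None
    thus ?thesis using m sub by (cases b') auto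
  next
    case (Some C)
    then obtain u where "u \<in> C" "u \<in> verts F" using sub by blast
    then obtain C' where C': "b' = Some C'" using m Some by auto
    have "u \<in> C \<longleftrightarrow> u \<in> C'" if "u \<in> verts F" for u using m[OF that] Some C' by simp
    thus ?thesis using sub[of C] sub[of C'] Some C' by auto
  qed
qed

text \<open>The site is dictated by \<open>H\<close>: \<open>s\<close> comes from the parent of
  \<open>\<beta> r\<close>, and \<open>b\<close> from its block. It remains to see that
  \<open>H\<close> has no edge and no block between the two parts beyond those of the graft.\<close>

lemma cut_map_surj:
  assumes I: "I \<in> ideals H" and \<alpha>: "\<alpha> \<in> isos F (restrict_forest H (verts H - I))"
    and \<beta>: "\<beta> \<in> isos G (merge_roots (restrict_forest H I))"
  shows "\<exists>s b \<gamma>. (s, b) \<in> graft_sites F \<and> \<gamma> \<in> isos (graft F s b G) H \<and> cut_map ((s, b), \<gamma>) = (I, \<alpha>, \<beta>)"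
proof -
  let ?R = "restrict_forest H (verts H - I)" and ?P = "merge_roots (restrict_forest H I)"
  have R: "part_forest ?R" by (rule part_forest_restrict[OF H_forest])
  have P: "part_forest ?P" by (rule part_treeD[OF part_tree_upper[OF H_forest]])
  note A = pf_isoD[OF F_forest isosD(1)[OF \<alpha>]] and B = pf_isoD[OF G_forest isosD(1)[OF \<beta>]]
  note DH = part_forestD[OF H_forest]
  have IV: "I \<subseteq> verts H" by (rule idealsD(1)[OF I])
  have imA: "\<alpha> ` verts F = verts H - I" using A(3) by auto
  have imB: "\<beta> ` verts G = I" using B(3) IV by auto
  have aI: "\<alpha> u \<in> verts H" "\<alpha> u \<notin> I" if "u \<in> verts F" for u using imA that by auto
  have bI: "\<beta> y \<in> I" "\<beta> y \<in> verts H" if "y \<in> verts G" for y using imB IV that by auto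
  have rG: "r \<in> verts G" and r0F: "r0 \<in> verts F" using r r0 roots_subset[of G] roots_subset[of F] by auto
  \<comment> \<open>The single root of \<open>H\<close> is the image of \<open>r0\<close>; so the
    ideal misses it, and every vertex of the ideal has a parent.\<close>
  have "\<alpha> r0 \<in> roots ?R" using roots_iso[OF F_forest R isosD(1)[OF \<alpha>] r0F] r0 by simp
  hence "\<alpha> r0 = \<rho>" using roots_restrict_compl[OF H_forest I] \<rho> by auto
  hence \<rho>I: "\<rho> \<notin> I" using aI r0F by auto
  have rootP: "\<beta> y \<in> roots (restrict_forest H I) \<longleftrightarrow> y = r" if "y \<in> verts G" for y
    using roots_iso[OF G_forest P isosD(1)[OF \<beta>] that] r by simp
  \<comment> \<open>A vertex of \<open>I\<close> with its parent outside \<open>I\<close> is a root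
    of the restriction, hence \<open>\<beta> r\<close>: only one edge can enter the ideal.\<close>
  have rootI: "y = r" if y: "y \<in> verts G" and u: "(u, \<beta> y) \<in> edges H" "u \<notin> I" for y u
  proof -
    have "(w, \<beta> y) \<notin> edges H" if "w \<in> I" for w using DH(4)[OF u(1), of w] u(2) that by auto
    hence "\<beta> y \<in> roots (restrict_forest H I)" unfolding roots_restrict[OF H_forest] using bI[OF y] by blast
    thus ?thesis using rootP y by simp
  qed
  have "\<beta> r \<notin> roots H" using \<rho> \<rho>I bI[OF rG] by auto
  then obtain u0 where u0: "(u0, \<beta> r) \<in> edges H" using bI[OF rG] by (auto simp: roots_def)
  have "\<beta> r \<in> roots (restrict_forest H I)" using rootP rG by simp
  hence "u0 \<notin> I" using u0 unfolding roots_restrict[OF H_forest] by auto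
  hence "u0 \<in> \<alpha> ` verts F" using imA DH(2)[OF u0] by auto
  then obtain s where s: "s \<in> verts F" "\<alpha> s = u0" by blast
  have sE: "(\<alpha> s, \<beta> r) \<in> edges H" using u0 s by simp
  have edA: "(\<alpha> u, \<alpha> v) \<in> edges H \<longleftrightarrow> (u, v) \<in> edges F" if "u \<in> verts F" "v \<in> verts F" for u v
    using A(5)[OF that] aI that by simp
  have sbA: "same_block H (\<alpha> u) (\<alpha> v) \<longleftrightarrow> same_block F u v" if "u \<in> verts F" "v \<in> verts F" for u v
    using A(6)[OF that] aI that by simp
  have edB: "(\<beta> u, \<beta> v) \<in> edges H \<longleftrightarrow> (u, v) \<in> edges G" if "u \<in> verts G" "v \<in> verts G" for u v
    using B(5)[OF that] bI that by simp
  have sbB: "same_block H (\<beta> u) (\<beta> v) \<longleftrightarrow> same_block G u v" if uv: "u \<in> verts G" "v \<in> verts G" for u v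
  proof -
    have "same_block G u v \<longleftrightarrow> same_block H (\<beta> u) (\<beta> v) \<or> (u = r \<and> v = r)"
      using B(6)[OF uv] uv bI rootP unfolding same_block_merge[OF part_forest_restrict[OF H_forest]] by auto
    thus ?thesis using DH(8)[OF bI(2)[OF rG]] by auto
  qed
  \<comment> \<open>The vertices of \<open>F\<close> that land in the block of
    \<open>\<beta> r\<close>; if there are any, they form a full block of children of
    \<open>s\<close>.\<close>
  define C where "C = {u \<in> verts F. same_block H (\<alpha> u) (\<beta> r)}"
  define b where "b = (if C = {} then None else Some C)"
  have Cb: "C \<in> child_blocks F s" if ne: "C \<noteq> {}"
  proof -
    obtain u where u: "u \<in> verts F" "same_block H (\<alpha> u) (\<beta> r)" using ne by (auto simp: C_def)
    obtain B where B: "B \<in> blocks F" "u \<in> B" using part_forestD(8)[OF F_forest u(1)] by (auto simp: same_block_def)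
    have "C = {v. same_block F u v}"
    proof (intro equalityI subsetI)
      fix v assume "v \<in> C"
      hence v: "v \<in> verts F" "same_block H (\<alpha> v) (\<beta> r)" by (auto simp: C_def)
      have "same_block H (\<alpha> u) (\<alpha> v)" using DH(9)[OF u(2) DH(10)[OF v(2)]] .
      thus "v \<in> {v. same_block F u v}" using sbA u v by simp
    next
      fix v assume "v \<in> {v. same_block F u v}"
      hence v: "same_block F u v" by simp
      have vF: "v \<in> verts F" by (rule part_forestD(7)[OF F_forest v])
      have "same_block H (\<alpha> v) (\<alpha> u)" using sbA[OF vF u(1)] part_forestD(10)[OF F_forest v] by simp
      thus "v \<in> C" using DH(9)[OF _ u(2)] vF by (simp add: C_def)
    qed
    hence "C = B" using same_block_determines[OF F_forest B] by simp
    moreover have "(s, v) \<in> edges F" if "v \<in> C" for v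
    proof -
      have v: "v \<in> verts F" "same_block H (\<alpha> v) (\<beta> r)" using that by (auto simp: C_def)
      have "(\<alpha> s, \<alpha> v) \<in> edges H" using DH(11)[OF v(2)] sE by simp
      thus ?thesis using edA[OF s(1) v(1)] by simp
    qed
    ultimately show ?thesis using B by (auto simp: child_blocks_def)
  qed
  have b: "b \<in> insert None (Some ` child_blocks F s)" using Cb by (auto simp: b_def)
  have bC: "(\<exists>B. b = Some B \<and> u \<in> B \<and> y = r) \<longleftrightarrow> u \<in> C \<and> y = r" for u y by (auto simp: b_def)
  note S = graft_simps[OF F G r s(1) b] and SB = graft_same_block[OF F G r s(1) b]
  let ?U = "graft F s b G"
  have U: "part_forest ?U" by (rule part_treeD[OF part_tree_graft[OF F G r s(1) b]])
  define \<gamma> where "\<gamma> = restrict (case_sum \<alpha> \<beta>) (verts ?U)"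
  have gl: "\<gamma> (Inl u) = \<alpha> u" if "u \<in> verts F" for u using that by (simp add: \<gamma>_def S InlI)
  have gr: "\<gamma> (Inr u) = \<beta> u" if "u \<in> verts G" for u using that by (simp add: \<gamma>_def S InrI)
  have sbAB: "same_block H (\<alpha> u) (\<beta> y) \<longleftrightarrow> u \<in> C \<and> y = r" if u: "u \<in> verts F" and y: "y \<in> verts G" for u y
  proof
    assume sb: "same_block H (\<alpha> u) (\<beta> y)"
    have "\<beta> y \<notin> roots H" using \<rho> \<rho>I bI[OF y] by auto
    then obtain p where p: "(p, \<beta> y) \<in> edges H" using bI[OF y] by (auto simp: roots_def)
    \<comment> \<open>Vertices of one block have the same parent, and the parent of a vertex outside
      the ideal is outside it.\<close>
    have "(p, \<alpha> u) \<in> edges H" using DH(11)[OF sb] p by simp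
    hence "p \<notin> I" using idealsD(2)[OF I] aI[OF u] by blast
    hence "y = r" by (rule rootI[OF y p])
    thus "u \<in> C \<and> y = r" using sb u by (simp add: C_def)
  qed (simp add: C_def)
  have edAB: "(\<alpha> u, \<beta> y) \<in> edges H \<longleftrightarrow> u = s \<and> y = r" if u: "u \<in> verts F" and y: "y \<in> verts G" for u y
  proof
    assume e: "(\<alpha> u, \<beta> y) \<in> edges H"
    have "y = r" by (rule rootI[OF y e aI(2)[OF u]])
    moreover from this have "\<alpha> u = \<alpha> s" using DH(4)[OF e, of "\<alpha> s"] sE by simp
    ultimately show "u = s \<and> y = r" using A(8)[OF u s(1)] by simp
  qed (use sE in simp)
  have edBA: "(\<beta> y, \<alpha> u) \<notin> edges H" if "u \<in> verts F" "y \<in> verts G" for u y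
    using idealsD(2)[OF I, of "\<beta> y" "\<alpha> u"] aI bI that by blast
  have sbBA: "same_block H (\<beta> y) (\<alpha> u) \<longleftrightarrow> u \<in> C \<and> y = r" if u: "u \<in> verts F" and y: "y \<in> verts G" for u y
    using sbAB[OF that] DH(10)[of "\<beta> y" "\<alpha> u"] DH(10)[of "\<alpha> u" "\<beta> y"] by blast
  have iso: "pf_iso \<gamma> ?U H"
  proof (rule pf_isoI[OF U H_forest])
    show "bij_betw \<gamma> (verts ?U) (verts H)"
      unfolding bij_betw_def
    proof
      show "inj_on \<gamma> (verts ?U)"
      proof (rule inj_onI)
        fix x y assume xy: "x \<in> verts ?U" "y \<in> verts ?U" "\<gamma> x = \<gamma> y"
        have ne: "\<alpha> u \<noteq> \<beta> w" if "u \<in> verts F" "w \<in> verts G" for u w using aI(2)[OF that(1)] bI(1)[OF that(2)] by auto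
        show "x = y"
          by (cases x; cases y) (use xy A(8) B(8) ne ne[symmetric] in \<open>auto simp: S gl gr\<close>)
      qed
      have "\<gamma> ` verts ?U = \<alpha> ` verts F \<union> \<beta> ` verts G"
        by (auto simp: S gl gr Plus_def image_Un image_image)
      thus "\<gamma> ` verts ?U = verts H" using imA imB IV by auto
    qed
    fix x y assume xy: "x \<in> verts ?U" "y \<in> verts ?U"
    show "(x, y) \<in> edges ?U \<longleftrightarrow> (\<gamma> x, \<gamma> y) \<in> edges H"
      by (cases x; cases y) (use xy in \<open>auto simp: S gl gr edA edB edAB edBA\<close>)
    show "same_block ?U x y \<longleftrightarrow> same_block H (\<gamma> x) (\<gamma> y)"
      by (cases x; cases y) (use xy in \<open>auto simp: S gl gr SB sbA sbB sbAB sbBA bC\<close>)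
    show "dec H (\<gamma> y) = dec ?U y"
      by (cases y) (use xy A(7) B(7) in \<open>auto simp: S gl gr\<close>)
  qed
  have "\<gamma> \<in> isos ?U H" using iso by (simp add: isos_def \<gamma>_def)
  moreover have "cut_map ((s, b), \<gamma>) = (I, \<alpha>, \<beta>)"
  proof -
    have "\<gamma> ` Inr ` verts G = I" using imB gr by (auto simp: image_image)
    moreover have "restrict (\<gamma> \<circ> Inl) (verts F) = \<alpha>"
      using gl isosD(2)[OF \<alpha>] by (auto simp: fun_eq_iff restrict_def)
    moreover have "restrict (\<gamma> \<circ> Inr) (verts G) = \<beta>"
      using gr isosD(2)[OF \<beta>] by (auto simp: fun_eq_iff restrict_def)
    ultimately show ?thesis by (simp add: cut_map_def)
  qed
  ultimately show ?thesis using s b by (auto simp: graft_sites_def)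
qed

lemma graft_count:
  "(\<Sum>(s, b)\<in>graft_sites F. card (isos (graft F s b G) H)) =
   (\<Sum>I\<in>ideals H. card (isos F (restrict_forest H (verts H - I))) * card (isos G (merge_roots (restrict_forest H I))))"
proof -
  let ?A = "Sigma (graft_sites F) (\<lambda>p. isos (graft F (fst p) (snd p) G) H)"
  let ?B = "Sigma (ideals H) (\<lambda>I. isos F (restrict_forest H (verts H - I)) \<times> isos G (merge_roots (restrict_forest H I)))"
  have bij: "bij_betw cut_map ?A ?B"
    unfolding bij_betw_def
  proof
    show "inj_on cut_map ?A"
    proof (rule inj_onI)
      fix x y assume x: "x \<in> ?A" and y: "y \<in> ?A" and eq: "cut_map x = cut_map y"
      obtain s b \<gamma> where xs: "x = ((s, b), \<gamma>)" by (metis prod.collapse)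
      obtain s' b' \<gamma>' where ys: "y = ((s', b'), \<gamma>')" by (metis prod.collapse)
      show "x = y" using cut_map_inj[of s b s' b' \<gamma> \<gamma>'] x y eq by (simp add: xs ys)
    qed
    show "cut_map ` ?A = ?B"
    proof (intro equalityI subsetI)
      fix z assume "z \<in> cut_map ` ?A"
      then obtain s b \<gamma> where p: "(s, b) \<in> graft_sites F" and g: "\<gamma> \<in> isos (graft F s b G) H"
        and z: "z = cut_map ((s, b), \<gamma>)" by auto
      show "z \<in> ?B"
        using cut_map_in[OF p isosD(1)[OF g]] by (auto simp: z cut_map_def intro!: isos_restrict F_forest G_forest)
    next
      fix z assume "z \<in> ?B"
      then obtain I \<alpha> \<beta> where z: "z = (I, \<alpha>, \<beta>)" and I: "I \<in> ideals H"
        and a: "\<alpha> \<in> isos F (restrict_forest H (verts H - I))" and b: "\<beta> \<in> isos G (merge_roots (restrict_forest H I))"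
        by auto
      obtain s b \<gamma> where *: "(s, b) \<in> graft_sites F" "\<gamma> \<in> isos (graft F s b G) H" "cut_map ((s, b), \<gamma>) = (I, \<alpha>, \<beta>)"
        using cut_map_surj[OF I a b] by blast
      have "((s, b), \<gamma>) \<in> ?A" using * by simp
      thus "z \<in> cut_map ` ?A" unfolding z *(3)[symmetric] by (rule imageI)
    qed
  qed
  have fin: "finite (isos (graft F (fst p) (snd p) G) H)" if "p \<in> graft_sites F" for p
    using that part_tree_graft[OF F G r] by (auto simp: graft_sites_def intro!: finite_isos[OF _ H])
  have "(\<Sum>(s, b)\<in>graft_sites F. card (isos (graft F s b G) H)) = card ?A"
    using card_SigmaI[OF finite_graft_sites[OF F_forest], of "\<lambda>p. isos (graft F (fst p) (snd p) G) H"] fin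
    by (simp add: case_prod_unfold)
  also have "\<dots> = card ?B" by (rule bij_betw_same_card[OF bij])
  also have "\<dots> = (\<Sum>I\<in>ideals H. card (isos F (restrict_forest H (verts H - I)) \<times> isos G (merge_roots (restrict_forest H I))))"
    by (rule card_SigmaI[OF finite_ideals[OF H_forest]])
      (auto intro!: finite_isos F G part_tree_restrict_compl[OF H] part_tree_upper[OF H_forest])
  finally show ?thesis by (simp add: card_cartesian_product)
qed

text \<open>By \<open>card_isos\<close> each number of isomorphisms is 0 or an automorphism order.
  The three orders that remain are the weights of \<open>gCP_embed\<close> at the product and at its
  two factors.\<close>

lemma graft_count_sym:
  "sym_factor (ptree_class H) * (\<Sum>(s, b)\<in>graft_sites F. if ptree_class (graft F s b G) = ptree_class H then 1 else 0) =
   (\<Sum>I\<in>ideals H. (if lower H I = ptree_class F then sym_factor (ptree_class F) else 0) *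
      (if upper H I = ptree_class G then sym_factor (ptree_class G) else 0))"
proof -
  have 1: "card (isos (graft F (fst p) (snd p) G) H) =
      sym_factor (ptree_class H) * (if ptree_class (graft F (fst p) (snd p) G) = ptree_class H then 1 else 0)"
    if "p \<in> graft_sites F" for p
    using card_isos[OF part_tree_graft[OF F G r] H, of "fst p" "snd p"] that by (auto simp: graft_sites_def)
  have 2: "card (isos F (restrict_forest H (verts H - I))) = (if lower H I = ptree_class F then sym_factor (ptree_class F) else 0)"
    if "I \<in> ideals H" for I
    using card_isos[OF F part_tree_restrict_compl[OF H that]] by (auto simp: lower_def)
  have 3: "card (isos G (merge_roots (restrict_forest H I))) = (if upper H I = ptree_class G then sym_factor (ptree_class G) else 0)" for I
    using card_isos[OF G part_tree_upper[OF H_forest]] by (auto simp: upper_def)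
  have "sym_factor (ptree_class H) * (\<Sum>(s, b)\<in>graft_sites F. if ptree_class (graft F s b G) = ptree_class H then 1 else 0)
    = (\<Sum>(s, b)\<in>graft_sites F. card (isos (graft F s b G) H))"
    unfolding case_prod_unfold sum_distrib_left by (rule sum.cong) (simp_all add: 1)
  also have "\<dots> = (\<Sum>I\<in>ideals H. (if lower H I = ptree_class F then sym_factor (ptree_class F) else 0) *
      (if upper H I = ptree_class G then sym_factor (ptree_class G) else 0))"
    unfolding graft_count by (rule sum.cong) (simp_all add: 2 3)
  finally show ?thesis .
qed

end

section \<open>The grading by the number of roots\<close>

lemma nroots_lower:
  assumes F: "part_tree F" and I: "I \<in> ideals F" shows "nroots (lower F I) = card (roots F - I)"
  unfolding lower_def nroots_class[OF part_tree_restrict_compl[OF F I]]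
    roots_restrict_compl[OF part_treeD[OF F] I] ..

lemma nroots_upper:
  assumes F: "part_tree F" shows "nroots (upper F I) = card (roots (restrict_forest F I))"
  unfolding upper_def nroots_class[OF part_tree_upper[OF part_treeD[OF F]]] by simp

lemma roots_Int_subset: "roots F \<inter> I \<subseteq> roots (restrict_forest F I)"
  by (auto simp: roots_def)

lemma card_roots_split:
  "part_forest F \<Longrightarrow> card (roots F) = card (roots F - I) + card (roots F \<inter> I)"
  using card_Int_Diff[OF finite_roots, of F I] by simp

text \<open>A root of \<open>F\<close> stays a root in the part that contains it; only the upper
  part can acquire new ones.\<close>

lemma nroots_le:
  assumes F: "part_tree F" and I: "I \<in> ideals F"
  shows "nroots (ptree_class F) \<le> nroots (lower F I) + nroots (upper F I)"
    and "nroots (lower F I) \<le> nroots (ptree_class F)"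
proof -
  note F' = part_treeD[OF F]
  have "card (roots F \<inter> I) \<le> card (roots (restrict_forest F I))"
    by (rule card_mono[OF finite_roots[OF part_forest_restrict[OF F']] roots_Int_subset])
  thus "nroots (ptree_class F) \<le> nroots (lower F I) + nroots (upper F I)"
    using card_roots_split[OF F', of I] by (simp add: nroots_class[OF F] nroots_lower[OF F I] nroots_upper[OF F])
  show "nroots (lower F I) \<le> nroots (ptree_class F)"
    unfolding nroots_class[OF F] nroots_lower[OF F I] by (rule card_mono[OF finite_roots[OF F']]) auto
qed

text \<open>A split is a union of connected components.\<close>

definition splits :: "('v, 'd) pforest \<Rightarrow> 'v set set" where
  "splits F = {I \<in> ideals F. verts F - I \<in> ideals F}"

text \<open>Closure under children, together with that of the complement, makes membership constant
  along edges.\<close>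

lemma splits_iff:
  assumes F: "part_forest F"
  shows "I \<in> splits F \<longleftrightarrow> I \<subseteq> verts F \<and> (\<forall>u v. (u, v) \<in> edges F \<longrightarrow> (u \<in> I \<longleftrightarrow> v \<in> I))"
proof
  assume "I \<in> splits F"
  hence 1: "I \<in> ideals F" and 2: "verts F - I \<in> ideals F" by (auto simp: splits_def)
  have "u \<in> I \<longleftrightarrow> v \<in> I" if uv: "(u, v) \<in> edges F" for u v
    using idealsD(2)[OF 1 _ uv] idealsD(2)[OF 2 _ uv] part_forestD(2)[OF F uv] by auto
  thus "I \<subseteq> verts F \<and> (\<forall>u v. (u, v) \<in> edges F \<longrightarrow> (u \<in> I \<longleftrightarrow> v \<in> I))" using idealsD(1)[OF 1] by blast
next
  assume *: "I \<subseteq> verts F \<and> (\<forall>u v. (u, v) \<in> edges F \<longrightarrow> (u \<in> I \<longleftrightarrow> v \<in> I))"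
  thus "I \<in> splits F" using part_forestD(3)[OF F] unfolding splits_def ideals_def by auto
qed

lemma roots_restrict_split:
  assumes F: "part_forest F" and I: "I \<in> splits F"
  shows "roots (restrict_forest F I) = roots F \<inter> I"
proof (rule set_eqI)
  fix v
  have "u \<in> I" if "(u, v) \<in> edges F" "v \<in> I" for u using I that unfolding splits_iff[OF F] by blast
  thus "v \<in> roots (restrict_forest F I) \<longleftrightarrow> v \<in> roots F \<inter> I"
    unfolding roots_restrict[OF F] by (auto simp: roots_def)
qed

text \<open>Equality leaves no new root in the upper part, so the cut severs no edge.\<close>

lemma split_if_nroots_eq:
  assumes F: "part_tree F" and I: "I \<in> ideals F"
    and eq: "nroots (ptree_class F) = nroots (lower F I) + nroots (upper F I)"
  shows "I \<in> splits F"
proof -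
  note F' = part_treeD[OF F]
  have "card (roots F \<inter> I) = card (roots (restrict_forest F I))"
    using eq card_roots_split[OF F', of I] by (simp add: nroots_class[OF F] nroots_lower[OF F I] nroots_upper[OF F])
  hence r: "roots F \<inter> I = roots (restrict_forest F I)"
    using card_subset_eq[OF finite_roots[OF part_forest_restrict[OF F']] roots_Int_subset] by blast
  have "u \<in> I" if uv: "(u, v) \<in> edges F" "v \<in> I" for u v
  proof (rule ccontr)
    assume u: "u \<notin> I"
    have "w \<notin> I" if "(w, v) \<in> edges F" for w using part_forestD(4)[OF F' uv(1) that] u by simp
    hence "v \<in> roots (restrict_forest F I)"
      unfolding roots_restrict[OF F'] using uv idealsD(1)[OF I] by blast
    hence "v \<in> roots F" using r by blast
    thus False using uv by (auto simp: roots_def)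
  qed
  thus ?thesis unfolding splits_iff[OF F'] using idealsD[OF I] by blast
qed

text \<open>No edge crosses a split, and a block that crosses it consists of roots: otherwise two of
  its vertices would have a common parent lying on both sides. The roots of a tree form one block
  anyway, so the product restores \<open>F\<close>.\<close>

lemma tree_split:
  assumes F: "part_tree F" and I: "I \<in> splits F"
  shows "ptree_class F = tmul (lower F I) (upper F I)"
proof -
  note F' = part_treeD[OF F]
  have I1: "I \<in> ideals F" using I by (simp add: splits_def)
  have IE: "u \<in> I \<longleftrightarrow> v \<in> I" if "(u, v) \<in> edges F" for u v using I that unfolding splits_iff[OF F'] by blast
  let ?A = "restrict_forest F (verts F - I)" and ?RI = "restrict_forest F I"
  let ?B = "merge_roots ?RI"
  let ?M = "merge_roots (disj_union ?A ?B)"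
  have A: "part_tree ?A" by (rule part_tree_restrict_compl[OF F I1])
  have B: "part_tree ?B" by (rule part_tree_upper[OF F'])
  note AB = part_forest_disj_union[OF part_treeD[OF A] part_treeD[OF B]]
  have M: "part_tree ?M" by (rule part_tree_tmul[OF part_treeD[OF A] part_treeD[OF B]])
  define \<phi> where "\<phi> v = (if v \<in> I then Inr v else Inl v)" for v
  have rA: "roots ?A = roots F - I" by (rule roots_restrict_compl[OF F' I1])
  have rB: "roots ?RI = roots F \<inter> I" by (rule roots_restrict_split[OF F' I])
  have tr: "same_block F u v" if "u \<in> roots F" "v \<in> roots F" for u v using F that by (simp add: part_tree_iff)
  have cross: "u \<in> roots F \<and> v \<in> roots F" if sb: "same_block F u v" and "u \<in> I" "v \<notin> I" for u v
  proof (rule ccontr)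
    assume "\<not> (u \<in> roots F \<and> v \<in> roots F)"
    then obtain p where "(p, u) \<in> edges F" "(p, v) \<in> edges F"
      using sb F' unfolding part_forest_iff by blast
    thus False using IE[of p u] IE[of p v] that by blast
  qed
  have "pf_iso \<phi> F ?M"
  proof (rule pf_isoI[OF F' part_treeD[OF M]])
    have "inj_on \<phi> (verts F)" by (rule inj_onI) (auto simp: \<phi>_def split: if_splits)
    moreover have "\<phi> ` verts F = (verts F - I) <+> I"
    proof (rule set_eqI)
      fix x show "x \<in> \<phi> ` verts F \<longleftrightarrow> x \<in> (verts F - I) <+> I"
        by (cases x) (use idealsD(1)[OF I1] in \<open>auto simp: \<phi>_def image_iff\<close>)
    qed
    moreover have "verts ?M = (verts F - I) <+> I" using idealsD(1)[OF I1] by auto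
    ultimately show "bij_betw \<phi> (verts F) (verts ?M)" by (simp add: bij_betw_def)
    fix u v assume uv: "u \<in> verts F" "v \<in> verts F"
    show "(u, v) \<in> edges F \<longleftrightarrow> (\<phi> u, \<phi> v) \<in> edges ?M"
      using uv IE[of u v] by (auto simp: \<phi>_def)
    show "same_block F u v \<longleftrightarrow> same_block ?M (\<phi> u) (\<phi> v)"
    proof -
      have key: "same_block F u v \<or> (u \<in> roots F \<and> v \<in> roots F) \<longleftrightarrow> same_block F u v" using tr[of u v] by blast
      have x1: "same_block F u v \<longleftrightarrow> u \<in> roots F \<and> v \<in> roots F" if "u \<in> I" "v \<notin> I"
        using tr[of u v] cross[of u v] that by blast
      have x2: "same_block F u v \<longleftrightarrow> u \<in> roots F \<and> v \<in> roots F" if "u \<notin> I" "v \<in> I"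
        using tr[of u v] cross[of v u] that part_forestD(10)[OF F', of u v] by blast
      have p: "Inl w \<in> P <+> Q \<longleftrightarrow> w \<in> P" "Inr w \<in> P <+> Q \<longleftrightarrow> w \<in> Q" for w and P Q :: "'a set" by auto
      show ?thesis
        unfolding same_block_merge[OF AB] roots_disj_union(3) merge_simps rA rB
        by (cases "u \<in> I"; cases "v \<in> I")
          (use uv in \<open>simp_all add: \<phi>_def same_block_merge[OF part_forest_restrict[OF F']] rB p key x1 x2\<close>)
    qed
    show "dec ?M (\<phi> v) = dec F v" by (simp add: \<phi>_def)
  qed
  hence "ptree_class F = ptree_class ?M" by (rule ptree_class_eqI[OF F M])
  thus ?thesis unfolding lower_def upper_def tmul_class[OF A B] .
qed

text \<open>The copy of \<open>x\<close> inside the product is a split; it is carried over to the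
  representative by an isomorphism.\<close>

lemma split_of_tmul:
  obtains I where "I \<in> splits (rep_ptree (tmul a x))" "lower (rep_ptree (tmul a x)) I = a" "upper (rep_ptree (tmul a x)) I = x"
proof -
  let ?F = "rep_ptree a" and ?G = "rep_ptree x"
  let ?M = "merge_roots (disj_union ?F ?G)"
  note F = part_tree_rep[of a] and G = part_tree_rep[of x]
  note F' = part_forest_rep[of a] and G' = part_forest_rep[of x]
  have M: "part_tree ?M" by (rule part_tree_tmul[OF F' G'])
  let ?K = "{} <+> verts ?G"
  have K: "?K \<in> ideals ?M" by (rule Plus_ideal[OF F G trivial_ideals(1)[OF F'] trivial_ideals(2)[OF G']])
  have K': "verts ?F <+> {} \<in> ideals ?M" by (rule Plus_ideal[OF F G trivial_ideals(2)[OF F'] trivial_ideals(1)[OF G']])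
  have e1: "lower ?G (verts ?G) = empty_ptree" using lower_eq_empty[OF G trivial_ideals(2)[OF G']] by simp
  have e2: "upper ?F {} = empty_ptree" using upper_eq_empty[OF F trivial_ideals(1)[OF F']] by simp
  have l: "lower ?M ?K = a"
    unfolding lower_Plus[OF F G trivial_ideals(1)[OF F'] trivial_ideals(2)[OF G']] lower_empty[OF F] e1
    by (simp add: tmul_empty_right)
  have u: "upper ?M ?K = x"
    unfolding upper_Plus[OF F G trivial_ideals(1)[OF F'] trivial_ideals(2)[OF G']] upper_verts[OF G] e2
    by (simp add: tmul_empty_left)
  have T: "tmul a x = ptree_class ?M" by (simp add: tmul_def)
  obtain \<phi> where i: "pf_iso \<phi> ?M (rep_ptree (tmul a x))" unfolding T by (rule rep_ptree_class[OF M])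
  note D = pf_isoD[OF part_treeD[OF M] i]
  have im: "\<phi> ` J \<in> ideals (rep_ptree (tmul a x))" if "J \<in> ideals ?M" for J
    using bij_ideals[OF part_treeD[OF M] part_forest_rep i] that by (auto simp: bij_betw_def)
  have "verts (rep_ptree (tmul a x)) - \<phi> ` ?K = \<phi> ` (verts ?M - ?K)"
    unfolding D(3) by (rule inj_on_image_set_diff[OF D(2), symmetric]) (use idealsD(1)[OF K] in auto)
  also have "verts ?M - ?K = verts ?F <+> {}" by auto
  finally have "\<phi> ` ?K \<in> splits (rep_ptree (tmul a x))" using im[OF K] im[OF K'] by (simp add: splits_def)
  moreover have "lower (rep_ptree (tmul a x)) (\<phi> ` ?K) = a" using lower_iso[OF M part_tree_rep i K] l by simp
  moreover have "upper (rep_ptree (tmul a x)) (\<phi> ` ?K) = x" using upper_iso[OF M part_tree_rep i K] u by simp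
  ultimately show ?thesis by (rule that)
qed

text \<open>The complement of a split is an ideal, so the restriction to the split has its roots in
  one block already. Lower and upper parts thus trade places under complement.\<close>

lemma split_swap:
  assumes F: "part_tree F" and I: "I \<in> splits F"
  shows "upper F I = lower F (verts F - I)"
  unfolding upper_def lower_def
proof (rule ptree_class_same)
  note F' = part_treeD[OF F]
  have I': "verts F - I \<in> ideals F" and I1: "I \<in> ideals F" using I by (simp_all add: splits_def)
  have sub: "I \<subseteq> verts F" by (rule idealsD(1)[OF I1])
  have VI: "verts F - (verts F - I) = I" using sub by auto
  show "part_tree (merge_roots (restrict_forest F I))" by (rule part_tree_upper[OF F'])
  show "part_tree (restrict_forest F (verts F - (verts F - I)))" by (rule part_tree_restrict_compl[OF F I'])
  show "verts (merge_roots (restrict_forest F I)) = verts (restrict_forest F (verts F - (verts F - I)))" unfolding VI by simp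
  fix u v
  show "(u, v) \<in> edges (merge_roots (restrict_forest F I)) \<longleftrightarrow> (u, v) \<in> edges (restrict_forest F (verts F - (verts F - I)))"
    unfolding VI by simp
  show "same_block (merge_roots (restrict_forest F I)) u v \<longleftrightarrow> same_block (restrict_forest F (verts F - (verts F - I))) u v"
    unfolding VI by (rule same_block_merge_tree[OF part_tree_restrict_compl[OF F I', unfolded VI]])
  show "dec (merge_roots (restrict_forest F I)) v = dec (restrict_forest F (verts F - (verts F - I))) v" by simp
qed

section \<open>Leading terms of products of dual basis elements\<close>

lemma delta_mult_nonzeroE:
  assumes "dual_mult (delta a) (delta x) t \<noteq> (0 :: 'k::field)"
  obtains I where "I \<in> ideals (rep_ptree t)" "lower (rep_ptree t) I = a" "upper (rep_ptree t) I = x"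
proof -
  obtain I where I: "I \<in> ideals (rep_ptree t)"
    and nz: "delta a (lower (rep_ptree t) I) * delta x (upper (rep_ptree t) I) \<noteq> (0 :: 'k)"
    using assms[unfolded dual_mult_rep] by (rule sum.not_neutral_contains_not_neutral)
  have "lower (rep_ptree t) I = a" "upper (rep_ptree t) I = x"
    using nz by (simp_all add: delta_def split: if_splits)
  with I show ?thesis by (rule that)
qed

text \<open>The coefficient is a number of ideals, positive by \<open>split_of_tmul\<close>;
  characteristic zero keeps it nonzero in the field.\<close>

lemma delta_mult_tmul_nonzero:
  "dual_mult (delta a) (delta x) (tmul a x) \<noteq> (0 :: 'k::field_char_0)"
proof -
  let ?F = "rep_ptree (tmul a x)"
  let ?S = "{I \<in> ideals ?F. lower ?F I = a \<and> upper ?F I = x}"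
  have fin: "finite (ideals ?F)" by (rule finite_ideals[OF part_forest_rep])
  have "dual_mult (delta a) (delta x) (tmul a x) = (\<Sum>I\<in>ideals ?F. if lower ?F I = a \<and> upper ?F I = x then 1 else 0 :: 'k)"
    unfolding dual_mult_rep by (rule sum.cong) (auto simp: delta_def)
  also have "\<dots> = (\<Sum>I\<in>?S. 1)" by (rule sum.inter_filter[OF fin, symmetric])
  also have "\<dots> = of_nat (card ?S)" by simp
  finally have eq: "dual_mult (delta a) (delta x) (tmul a x) = (of_nat (card ?S) :: 'k)" .
  obtain I where "I \<in> splits ?F" "lower ?F I = a" "upper ?F I = x" by (rule split_of_tmul)
  hence "I \<in> ?S" by (simp add: splits_def)
  hence "?S \<noteq> {}" by blast
  hence "card ?S \<noteq> 0" using fin by simp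
  thus ?thesis unfolding eq by simp
qed

text \<open>At a tree with two roots the only contributing ideals are splits, and complementing them
  exchanges the two factors.\<close>

lemma delta_mult_commute_top:
  assumes x: "nroots x = 1" and y: "nroots y = 1" and t: "nroots t = 2"
  shows "dual_mult (delta x) (delta y) t = (dual_mult (delta y) (delta x) t :: 'k::field)"
proof -
  let ?F = "rep_ptree t"
  have eq: "dual_mult (delta x) (delta y) t = (\<Sum>I\<in>splits ?F. delta x (lower ?F I) * delta y (upper ?F I) :: 'k)"
    if "nroots x = 1" "nroots y = 1" for x y
    unfolding dual_mult_rep
  proof (rule sum.mono_neutral_right[OF finite_ideals[OF part_forest_rep]])
    show "splits ?F \<subseteq> ideals ?F" by (auto simp: splits_def)
    show "\<forall>I\<in>ideals ?F - splits ?F. delta x (lower ?F I) * delta y (upper ?F I) = (0 :: 'k)"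
    proof
      fix I assume I: "I \<in> ideals ?F - splits ?F"
      have "\<not> (lower ?F I = x \<and> upper ?F I = y)"
        using split_if_nroots_eq[OF part_tree_rep, of I t] I t that by auto
      thus "delta x (lower ?F I) * delta y (upper ?F I) = (0 :: 'k)" by (auto simp: delta_def)
    qed
  qed
  have comp: "verts ?F - I \<in> splits ?F" "verts ?F - (verts ?F - I) = I" if "I \<in> splits ?F" for I
  proof -
    have "I \<in> ideals ?F" using that by (simp add: splits_def)
    from idealsD(1)[OF this] show d: "verts ?F - (verts ?F - I) = I" by blast
    show "verts ?F - I \<in> splits ?F" using that d by (simp add: splits_def)
  qed
  have "(\<Sum>I\<in>splits ?F. delta x (lower ?F I) * delta y (upper ?F I) :: 'k)
    = (\<Sum>I\<in>splits ?F. delta y (lower ?F I) * delta x (upper ?F I))"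
  proof (rule sum.reindex_bij_witness[where i = "\<lambda>I. verts ?F - I" and j = "\<lambda>I. verts ?F - I"])
    fix I assume I: "I \<in> splits ?F"
    show "delta y (lower ?F (verts ?F - I)) * delta x (upper ?F (verts ?F - I)) = (delta x (lower ?F I) * delta y (upper ?F I) :: 'k)"
      using split_swap[OF part_tree_rep I] split_swap[OF part_tree_rep comp(1)[OF I]] comp(2)[OF I] by simp
  qed (simp_all add: comp)
  thus ?thesis using eq x y by simp
qed

text \<open>The split is the set of descendants of \<open>r\<close>, counting \<open>r\<close>
  itself. It is also closed under parents, since parents are unique and \<open>r\<close> has
  none.\<close>

lemma component_split:
  assumes F: "part_forest F" and r: "r \<in> roots F"
  shows "\<exists>I\<in>splits F. roots F \<inter> I = {r}"
proof
  let ?I = "{v. (r, v) \<in> (edges F)\<^sup>*}"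
  have rV: "r \<in> verts F" using r by (simp add: roots_def)
  have noin: "(u, r) \<notin> edges F" for u using r by (simp add: roots_def)
  show "?I \<in> splits F"
    unfolding splits_iff[OF F]
  proof (intro conjI allI impI)
    show "?I \<subseteq> verts F"
    proof
      fix v assume "v \<in> ?I"
      hence "(r, v) \<in> (edges F)\<^sup>*" by simp
      thus "v \<in> verts F" 
        using rV part_forestD(3)[OF F] by (induction rule: rtrancl_induct) blast+
    qed
    fix u v assume uv: "(u, v) \<in> edges F"
    show "u \<in> ?I \<longleftrightarrow> v \<in> ?I"
    proof
      assume "u \<in> ?I" thus "v \<in> ?I" using uv by (auto intro: rtrancl_into_rtrancl)
    next
      assume "v \<in> ?I"
      hence "(r, v) \<in> (edges F)\<^sup>*" by simp
      thus "u \<in> ?I"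
      proof (cases rule: rtranclE)
        case base
        thus ?thesis using uv noin by simp
      next
        case (step w)
        thus ?thesis using part_forestD(4)[OF F uv, of w] by simp
      qed
    qed
  qed
  show "roots F \<inter> ?I = {r}"
  proof (intro equalityI subsetI)
    fix v assume v: "v \<in> roots F \<inter> ?I"
    hence "(r, v) \<in> (edges F)\<^sup>*" by simp
    thus "v \<in> {r}"
    proof (cases rule: rtranclE)
      case (step w)
      thus ?thesis using v by (auto simp: roots_def)
    qed simp
  next
    fix v assume "v \<in> {r}"
    thus "v \<in> roots F \<inter> ?I" using r by simp
  qed
qed

lemma split_empty_if_no_roots:
  assumes F: "part_forest F" and K: "K \<in> splits F" and r: "roots F \<inter> K = {}"
  shows "K = {}"
proof -
  have "verts (restrict_forest F K) = {}"
    using roots_empty_iff[OF part_forest_restrict[OF F], of K] roots_restrict_split[OF F K] r by simp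
  thus ?thesis using K unfolding splits_iff[OF F] by auto
qed

text \<open>Both decompositions are splits \<open>I\<close> and \<open>J\<close> of one tree, each
  with a single root. With the same root their differences are splits without roots, hence empty;
  with different roots they are disjoint, and \<open>c\<close> is what remains after removing
  both.\<close>

lemma tmul_diamond:
  assumes x: "nroots x = 1" and y: "nroots y = 1" and eq: "tmul a x = tmul b y"
  shows "(a = b \<and> x = y) \<or> (\<exists>c. a = tmul c y \<and> b = tmul c x)"
proof -
  let ?F = "rep_ptree (tmul a x)"
  note F = part_tree_rep[of "tmul a x"] and F' = part_forest_rep[of "tmul a x"]
  obtain I where I: "I \<in> splits ?F" "lower ?F I = a" "upper ?F I = x" by (rule split_of_tmul)
  obtain J where J: "J \<in> splits ?F" "lower ?F J = b" "upper ?F J = y" unfolding eq by (rule split_of_tmul)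
  have "card (roots ?F \<inter> I) = 1"
    using nroots_upper[OF F, of I] I(3) x roots_restrict_split[OF F' I(1)] by simp
  then obtain r where r: "roots ?F \<inter> I = {r}" by (auto simp: card_1_singleton_iff)
  have "card (roots ?F \<inter> J) = 1"
    using nroots_upper[OF F, of J] J(3) y roots_restrict_split[OF F' J(1)] by simp
  then obtain r' where r': "roots ?F \<inter> J = {r'}" by (auto simp: card_1_singleton_iff)
  have spl: "I - J \<in> splits ?F" "J - I \<in> splits ?F" "I \<inter> J \<in> splits ?F" "I \<union> J \<in> splits ?F"
    using I(1) J(1) unfolding splits_iff[OF F'] by auto
  show ?thesis
  proof (cases "r = r'")
    case True
    have "roots ?F \<inter> (I - J) = {}" "roots ?F \<inter> (J - I) = {}" using r r' True by auto
    hence "I - J = {}" "J - I = {}" using split_empty_if_no_roots[OF F'] spl by auto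
    hence "I = J" by auto
    thus ?thesis using I J by simp
  next
    case False
    have "roots ?F \<inter> (I \<inter> J) = {}" using r r' False by auto
    hence IJ: "I \<inter> J = {}" using split_empty_if_no_roots[OF F'] spl by auto
    \<comment> \<open>Stated for arbitrary disjoint splits, to be used with \<open>I\<close> and
      \<open>J\<close> in both orders.\<close>
    have step: "lower ?F I = tmul (lower ?F (I \<union> J)) (upper ?F J)"
      if I: "I \<in> splits ?F" and J: "J \<in> splits ?F" and IJ: "I \<inter> J = {}" and U: "I \<union> J \<in> splits ?F" for I J
    proof -
      have Ii: "I \<in> ideals ?F" and Ui: "I \<union> J \<in> ideals ?F" and Ji: "J \<in> ideals ?F"
        using I U J by (simp_all add: splits_def)
      have JV: "J \<subseteq> verts ?F" by (rule idealsD(1)[OF Ji])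
      let ?R = "restrict_forest ?F (verts ?F - I)"
      have R: "part_tree ?R" by (rule part_tree_restrict_compl[OF F Ii])
      have JR: "J \<in> splits ?R"
        unfolding splits_iff[OF part_treeD[OF R]] using J IJ unfolding splits_iff[OF F'] by auto
      have "upper ?R J = upper ?F J"
        unfolding upper_def
      proof (rule ptree_class_same[OF part_tree_upper[OF part_treeD[OF R]] part_tree_upper[OF F']])
        have Jmem: "w \<in> verts ?F \<and> w \<notin> I" if "w \<in> J" for w using that JV IJ by auto
        show "verts (merge_roots (restrict_forest ?R J)) = verts (merge_roots (restrict_forest ?F J))" using IJ by auto
        have rt: "roots (restrict_forest ?R J) = roots (restrict_forest ?F J)"
          unfolding roots_restrict_split[OF part_treeD[OF R] JR] roots_restrict_split[OF F' J]
            roots_restrict_compl[OF F' Ii] using IJ by auto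
        fix u v assume "u \<in> verts (merge_roots (restrict_forest ?F J))" "v \<in> verts (merge_roots (restrict_forest ?F J))"
        hence uv: "u \<in> J" "v \<in> J" by auto
        show "(u, v) \<in> edges (merge_roots (restrict_forest ?R J)) \<longleftrightarrow> (u, v) \<in> edges (merge_roots (restrict_forest ?F J))"
          using uv Jmem by simp
        show "same_block (merge_roots (restrict_forest ?R J)) u v \<longleftrightarrow> same_block (merge_roots (restrict_forest ?F J)) u v"
          unfolding same_block_merge[OF part_forest_restrict[OF part_treeD[OF R]]]
            same_block_merge[OF part_forest_restrict[OF F']] rt using uv Jmem by simp
        show "dec (merge_roots (restrict_forest ?R J)) v = dec (merge_roots (restrict_forest ?F J)) v" by simp
      qed
      moreover have "lower ?R J = lower ?F (I \<union> J)" by (rule lower_lower[OF F' Ii JV IJ Ui F])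
      moreover have "lower ?F I = tmul (lower ?R J) (upper ?R J)"
        unfolding lower_def[of ?F I] by (rule tree_split[OF R JR])
      ultimately show ?thesis by simp
    qed
    have "a = tmul (lower ?F (I \<union> J)) y" using step[OF I(1) J(1) IJ spl(4)] I J by simp
    moreover have "b = tmul (lower ?F (I \<union> J)) x"
      using step[OF J(1) I(1)] IJ spl(4) I J by (simp add: Un_commute Int_commute)
    ultimately show ?thesis by blast
  qed
qed

lemma tmul_decomp:
  assumes "nroots t > 0"
  shows "\<exists>a x. nroots x = 1 \<and> t = tmul a x"
proof -
  let ?F = "rep_ptree t"
  have "roots ?F \<noteq> {}" using assms by (auto simp: nroots_def)
  then obtain r where "r \<in> roots ?F" by blast
  then obtain I where I: "I \<in> splits ?F" "roots ?F \<inter> I = {r}" using component_split[OF part_forest_rep] by blast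
  have "nroots (upper ?F I) = 1"
    using nroots_upper[OF part_tree_rep, of t I] roots_restrict_split[OF part_forest_rep I(1)] I(2) by simp
  thus ?thesis using tree_split[OF part_tree_rep I(1)] by auto
qed

text \<open>The tree \<open>t\<close> has at most one root more than \<open>a\<close>, and an extra
  root forces the cut to be a split, so that \<open>t\<close> is the product.\<close>

lemma delta_mult_deg:
  assumes x: "nroots x = 1" and nz: "dual_mult (delta a) (delta x) t \<noteq> (0 :: 'k::field)"
  shows "nroots a \<le> nroots t" and "t = tmul a x \<or> nroots t \<le> nroots a"
proof -
  obtain I where I: "I \<in> ideals (rep_ptree t)" "lower (rep_ptree t) I = a" "upper (rep_ptree t) I = x"
    using delta_mult_nonzeroE[OF nz] .
  note le = nroots_le[OF part_tree_rep I(1)]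
  show "nroots a \<le> nroots t" using le(2) I by simp
  show "t = tmul a x \<or> nroots t \<le> nroots a"
  proof (cases "nroots t = nroots a + 1")
    case True
    hence "I \<in> splits (rep_ptree t)" using split_if_nroots_eq[OF part_tree_rep I(1)] I x by simp
    thus ?thesis using tree_split[OF part_tree_rep] I by fastforce
  next
    case False
    thus ?thesis using le(1) I x by simp
  qed
qed

lemma enveloping_basis_PT:
  "enveloping_basis (PT D) (dual_mult :: ('d ptree \<Rightarrow> 'k::field_char_0) \<Rightarrow> _) empty_ptree nroots tmul"
proof (rule enveloping_basis.intro)
  show alg: "unital_algebra fscale (fin_supp_on (PT D)) dual_mult (delta empty_ptree :: 'd ptree \<Rightarrow> 'k)"
    by (rule unital_algebra_dual)
  show "nroots (empty_ptree :: 'd ptree) = 0" by (simp add: nroots_eq_0)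
  fix x y :: "'d ptree" assume xy: "x \<in> PT D" "y \<in> PT D" "nroots x = 1" "nroots y = 1"
  let ?C = "commutator dual_mult (delta x) (delta y) :: 'd ptree \<Rightarrow> 'k"
  have "?C \<in> fin_supp_on (PT D)"
    unfolding commutator_def using xy by (intro fin_supp_on_diff dual_mult_closed fin_supp_on_delta)
  \<comment> \<open>Trees in either product have one or two roots; the terms with two roots cancel
    in the commutator.\<close>
  moreover have "nroots t = 1" if nz: "?C t \<noteq> 0" for t
  proof -
    have ne: "nroots t \<noteq> 2"
      using nz delta_mult_commute_top[OF xy(3,4), of t] by (auto simp: commutator_def fun_apply)
    have "dual_mult (delta x) (delta y) t \<noteq> (0 :: 'k) \<or> dual_mult (delta y) (delta x) t \<noteq> (0 :: 'k)"
      using nz by (auto simp: commutator_def fun_apply)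
    thus ?thesis
    proof
      assume nz: "dual_mult (delta x) (delta y) t \<noteq> (0 :: 'k)"
      show ?thesis using delta_mult_deg[OF xy(4) nz] ne xy by (auto simp: nroots_tmul)
    next
      assume nz: "dual_mult (delta y) (delta x) t \<noteq> (0 :: 'k)"
      show ?thesis using delta_mult_deg[OF xy(3) nz] ne xy by (auto simp: nroots_tmul)
    qed
  qed
  ultimately show "?C \<in> fin_supp_on {t \<in> PT D. nroots t = 1}" by (simp add: fin_supp_on_iff)
next
  fix t :: "'d ptree" assume t: "t \<in> PT D" "nroots t > 0"
  obtain a x where "nroots x = 1" "t = tmul a x" using tmul_decomp[OF t(2)] by blast
  thus "\<exists>a\<in>PT D. \<exists>x\<in>PT D. nroots x = 1 \<and> t = tmul a x" using t(1) PT_tmul by blast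
next
  fix a b x y :: "'d ptree"
  assume P: "a \<in> PT D" "b \<in> PT D" "x \<in> PT D" "y \<in> PT D" and xy: "nroots x = 1" "nroots y = 1"
    and eq: "tmul a x = tmul b y"
  from tmul_diamond[OF xy eq] show "(a = b \<and> x = y) \<or> (\<exists>c\<in>PT D. a = tmul c y \<and> b = tmul c x)"
    using P PT_tmul by blast
next
  fix a x t :: "'d ptree" assume "nroots x = 1" "dual_mult (delta a) (delta x) t \<noteq> (0 :: 'k)"
  thus "t = tmul a x \<or> nroots t \<le> nroots a" by (rule delta_mult_deg(2))
qed (simp_all add: empty_in_PT nroots_eq_0 PT_tmul nroots_tmul delta_mult_tmul_nonzero)

section \<open>The preLie algebra\<close>

lemma vector_space_pscale: "vector_space (pscale :: 'k::field \<Rightarrow> ('a \<Rightarrow>\<^sub>0 'k) \<Rightarrow> _)"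
  by unfold_locales (auto intro!: poly_mapping_eqI simp: lookup_add algebra_simps)

interpretation ps: vector_space "pscale :: 'k::field \<Rightarrow> ('a \<Rightarrow>\<^sub>0 'k) \<Rightarrow> _"
  by (rule vector_space_pscale)

lemma subspace_keys: "ps.subspace {x :: 'a \<Rightarrow>\<^sub>0 'k::field. Poly_Mapping.keys x \<subseteq> Y}"
  unfolding ps.subspace_def
proof (intro conjI ballI allI)
  fix x y :: "'a \<Rightarrow>\<^sub>0 'k" assume "x \<in> {x. Poly_Mapping.keys x \<subseteq> Y}" "y \<in> {x. Poly_Mapping.keys x \<subseteq> Y}"
  thus "x + y \<in> {x. Poly_Mapping.keys x \<subseteq> Y}" using keys_add[of x y] by auto
next
  fix c and x :: "'a \<Rightarrow>\<^sub>0 'k" assume "x \<in> {x. Poly_Mapping.keys x \<subseteq> Y}"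
  thus "pscale c x \<in> {x. Poly_Mapping.keys x \<subseteq> Y}" by (auto simp: in_keys_iff subset_iff)
qed simp

lemma poly_mapping_expand: "x = (\<Sum>a\<in>Poly_Mapping.keys x. pscale (Poly_Mapping.lookup x a) (Poly_Mapping.single a 1))"
proof (rule poly_mapping_eqI)
  fix b
  have "Poly_Mapping.lookup x b = (\<Sum>a\<in>Poly_Mapping.keys x. if a = b then Poly_Mapping.lookup x a else 0)"
    by (simp add: in_keys_iff)
  also have "\<dots> = (\<Sum>a\<in>Poly_Mapping.keys x. Poly_Mapping.lookup x a * Poly_Mapping.lookup (Poly_Mapping.single a 1) b)"
    by (rule sum.cong) (auto simp: lookup_single when_def)
  finally show "Poly_Mapping.lookup x b =
      Poly_Mapping.lookup (\<Sum>a\<in>Poly_Mapping.keys x. pscale (Poly_Mapping.lookup x a) (Poly_Mapping.single a 1)) b"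
    by (simp add: lookup_sum)
qed

lemma gCP_iff: "x \<in> (gCP D :: ('d ptree \<Rightarrow>\<^sub>0 'k::field) set) \<longleftrightarrow> Poly_Mapping.keys x \<subseteq> PT1 D"
proof
  assume "x \<in> gCP D"
  hence "x \<in> ps.span ((\<lambda>T. Poly_Mapping.single T 1) ` PT1 D)" by (simp add: gCP_def)
  moreover have "ps.span ((\<lambda>T. Poly_Mapping.single T 1) ` PT1 D) \<subseteq> {x :: 'd ptree \<Rightarrow>\<^sub>0 'k. Poly_Mapping.keys x \<subseteq> PT1 D}"
    by (rule ps.span_minimal[OF _ subspace_keys]) auto
  ultimately show "Poly_Mapping.keys x \<subseteq> PT1 D" by blast
next
  assume x: "Poly_Mapping.keys x \<subseteq> PT1 D"
  have "(\<Sum>a\<in>Poly_Mapping.keys x. pscale (Poly_Mapping.lookup x a) (Poly_Mapping.single a 1)) \<in> gCP D"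
    unfolding gCP_def by (intro ps.span_sum ps.span_scale ps.span_base imageI) (use x in blast)
  thus "x \<in> gCP D" using poly_mapping_expand[of x] by simp
qed

lemma subspace_gCP: "ps.subspace (gCP D)"
  unfolding gCP_def by (rule ps.subspace_span)

text \<open>Fixed index sets in both arguments, since the supports of sums and multiples
  vary.\<close>

lemma bilin_ext_superset:
  assumes "finite S" "finite S'" "Poly_Mapping.keys x \<subseteq> S" "Poly_Mapping.keys y \<subseteq> S'"
  shows "bilin_ext m x y = (\<Sum>a\<in>S. \<Sum>b\<in>S'. pscale (Poly_Mapping.lookup x a * Poly_Mapping.lookup y b) (m a b))"
proof -
  have inner: "(\<Sum>b\<in>Poly_Mapping.keys y. pscale (Poly_Mapping.lookup x a * Poly_Mapping.lookup y b) (m a b))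
      = (\<Sum>b\<in>S'. pscale (Poly_Mapping.lookup x a * Poly_Mapping.lookup y b) (m a b))" for a
    by (rule sum.mono_neutral_left[OF assms(2,4)]) (auto simp: in_keys_iff)
  show ?thesis
    unfolding bilin_ext_def inner
    by (rule sum.mono_neutral_left[OF assms(1,3)]) (auto simp: in_keys_iff intro!: sum.neutral)
qed

lemma bilin_ext_add_left: "bilin_ext m (x + x') y = bilin_ext m x y + bilin_ext m x' y"
proof -
  let ?S = "Poly_Mapping.keys x \<union> Poly_Mapping.keys x'"
  have S: "finite ?S" "finite (Poly_Mapping.keys y)" by auto
  have 1: "bilin_ext m x y = (\<Sum>a\<in>?S. \<Sum>b\<in>Poly_Mapping.keys y. pscale (Poly_Mapping.lookup x a * Poly_Mapping.lookup y b) (m a b))"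
    by (rule bilin_ext_superset[OF S]) auto
  have 2: "bilin_ext m x' y = (\<Sum>a\<in>?S. \<Sum>b\<in>Poly_Mapping.keys y. pscale (Poly_Mapping.lookup x' a * Poly_Mapping.lookup y b) (m a b))"
    by (rule bilin_ext_superset[OF S]) auto
  have 3: "bilin_ext m (x + x') y = (\<Sum>a\<in>?S. \<Sum>b\<in>Poly_Mapping.keys y. pscale (Poly_Mapping.lookup (x + x') a * Poly_Mapping.lookup y b) (m a b))"
    by (rule bilin_ext_superset[OF S keys_add]) auto
  show ?thesis unfolding 1 2 3 by (simp add: lookup_add distrib_right ps.scale_left_distrib sum.distrib)
qed

lemma bilin_ext_add_right: "bilin_ext m x (y + y') = bilin_ext m x y + bilin_ext m x y'"
proof -
  let ?S = "Poly_Mapping.keys y \<union> Poly_Mapping.keys y'"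
  have S: "finite (Poly_Mapping.keys x)" "finite ?S" by auto
  have 1: "bilin_ext m x y = (\<Sum>a\<in>Poly_Mapping.keys x. \<Sum>b\<in>?S. pscale (Poly_Mapping.lookup x a * Poly_Mapping.lookup y b) (m a b))"
    by (rule bilin_ext_superset[OF S]) auto
  have 2: "bilin_ext m x y' = (\<Sum>a\<in>Poly_Mapping.keys x. \<Sum>b\<in>?S. pscale (Poly_Mapping.lookup x a * Poly_Mapping.lookup y' b) (m a b))"
    by (rule bilin_ext_superset[OF S]) auto
  have 3: "bilin_ext m x (y + y') = (\<Sum>a\<in>Poly_Mapping.keys x. \<Sum>b\<in>?S. pscale (Poly_Mapping.lookup x a * Poly_Mapping.lookup (y + y') b) (m a b))"
    by (rule bilin_ext_superset[OF S _ keys_add]) auto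
  show ?thesis unfolding 1 2 3 by (simp add: lookup_add distrib_left ps.scale_left_distrib sum.distrib)
qed

lemma keys_pscale: "Poly_Mapping.keys (pscale c x) \<subseteq> Poly_Mapping.keys x"
  by (auto simp: in_keys_iff)

lemma bilin_ext_scale_left: "bilin_ext m (pscale c x) y = pscale c (bilin_ext m x y)"
  and bilin_ext_scale_right: "bilin_ext m x (pscale c y) = pscale c (bilin_ext m x y)"
  unfolding bilin_ext_superset[OF finite_keys finite_keys keys_pscale order_refl]
    bilin_ext_superset[OF finite_keys finite_keys order_refl keys_pscale]
  by (simp_all add: bilin_ext_def ps.scale_sum_right mult_ac)

text \<open>The double sum becomes one sum over sites, the index set of
  \<open>graft_count_sym\<close>.\<close>

lemma gCP_prod_basis:
  "gCP_prod = bilin_ext (\<lambda>T T'. \<Sum>(s, b)\<in>graft_sites (rep_ptree T).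
     Poly_Mapping.single (ptree_class (graft (rep_ptree T) s b (rep_ptree T'))) 1)"
proof -
  have "(\<Sum>s\<in>verts F. \<Sum>b\<in>insert None (Some ` child_blocks F s). h s b) = (\<Sum>(s, b)\<in>graft_sites F. h s b)"
    if F: "part_forest F" for F :: "(nat, 'a) pforest" and h :: "nat \<Rightarrow> nat set option \<Rightarrow> 'a ptree \<Rightarrow>\<^sub>0 'b"
  proof -
    have "finite (insert None (Some ` child_blocks F s))" for s
    proof -
      have "child_blocks F s \<subseteq> blocks F" by (auto simp: child_blocks_def)
      hence "finite (child_blocks F s)" using finite_elements[OF part_forestD(1,5)[OF F]] finite_subset by blast
      thus ?thesis by simp
    qed
    thus ?thesis unfolding graft_sites_def by (intro sum.Sigma part_forestD(1)[OF F] ballI)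
  qed
  thus ?thesis unfolding gCP_prod_def Let_def by (simp add: part_forest_rep)
qed

lemma single_root: "nroots T = 1 \<Longrightarrow> \<exists>r. roots (rep_ptree T) = {r}"
  by (simp add: nroots_def card_1_singleton_iff)

lemma graft_in_PT1:
  assumes T: "T \<in> PT1 D" and T': "T' \<in> PT1 D" and p: "(s, b) \<in> graft_sites (rep_ptree T)"
  shows "ptree_class (graft (rep_ptree T) s b (rep_ptree T')) \<in> PT1 D"
proof -
  let ?F = "rep_ptree T" and ?G = "rep_ptree T'"
  note F = part_tree_rep[of T] and G = part_tree_rep[of T']
  obtain r where r: "roots ?G = {r}" using single_root T' by (auto simp: PT1_iff)
  have s: "s \<in> verts ?F" and b: "b \<in> insert None (Some ` child_blocks ?F s)"
    using p by (auto simp: graft_sites_def)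
  note U = part_tree_graft[OF F G r s b] and S = graft_simps[OF F G r s b]
  have "nroots (ptree_class (graft ?F s b ?G)) = nroots T"
    unfolding nroots_class[OF U] roots_graft[OF F G r s b] by (simp add: nroots_def card_image)
  moreover have "dec (graft ?F s b ?G) ` verts (graft ?F s b ?G) = dec ?F ` verts ?F \<union> dec ?G ` verts ?G"
    by (simp add: S Plus_def image_Un image_image)
  ultimately show ?thesis using T T' unfolding PT1_iff PT_class[OF U] by (simp add: PT_def)
qed

lemma gCP_prod_closed:
  assumes x: "x \<in> gCP D" and y: "y \<in> gCP D" shows "gCP_prod x y \<in> (gCP D :: ('d ptree \<Rightarrow>\<^sub>0 'k::field) set)"
proof -
  have base: "(\<Sum>(s, b)\<in>graft_sites (rep_ptree T). Poly_Mapping.single (ptree_class (graft (rep_ptree T) s b (rep_ptree T'))) 1)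
    \<in> (gCP D :: ('d ptree \<Rightarrow>\<^sub>0 'k) set)" if "T \<in> PT1 D" "T' \<in> PT1 D" for T T'
    by (rule ps.subspace_sum[OF subspace_gCP])
      (auto simp: gCP_def intro!: ps.span_base imageI graft_in_PT1[OF that])
  show ?thesis
    unfolding gCP_prod_basis bilin_ext_def
    by (intro ps.subspace_sum[OF subspace_gCP] ps.subspace_scale[OF subspace_gCP] base)
      (use x y in \<open>auto simp: gCP_iff\<close>)
qed

section \<open>The embedding in the dual, and the preLie product as a component of the dual
  product\<close>

lemma gCP_embed_closed:
  assumes "x \<in> gCP D" shows "gCP_embed x \<in> fin_supp_on {t \<in> PT D. nroots t = 1}"
proof -
  have "{a. gCP_embed x a \<noteq> 0} \<subseteq> Poly_Mapping.keys x" by (auto simp: gCP_embed_def in_keys_iff)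
  thus ?thesis using assms unfolding fin_supp_on_def gCP_iff
    by (auto simp: PT1_iff intro: finite_subset)
qed

lemma gCP_embed_linear: "linear_on A pscale fscale gCP_embed"
  by (simp add: linear_on_def fun_eq_iff gCP_embed_def lookup_add fun_apply algebra_simps)

lemma gCP_embed_add: "gCP_embed (x + y) = gCP_embed x + gCP_embed y"
  and gCP_embed_diff: "gCP_embed (x - y) = gCP_embed x - gCP_embed y"
  by (simp_all add: fun_eq_iff gCP_embed_def lookup_add lookup_minus fun_apply algebra_simps)

lemma gCP_embed_inj: "gCP_embed x = (gCP_embed y :: 'd ptree \<Rightarrow> 'k::field_char_0) \<Longrightarrow> x = y"
proof (rule poly_mapping_eqI)
  fix T :: "'d ptree" assume "gCP_embed x = (gCP_embed y :: 'd ptree \<Rightarrow> 'k)"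
  from fun_cong[OF this, of T] sym_factor_pos[of T]
  show "Poly_Mapping.lookup x T = Poly_Mapping.lookup y T" by (simp add: gCP_embed_def)
qed

text \<open>The inverse divides by automorphism orders, which are nonzero in characteristic
  zero.\<close>

lemma gCP_embed_bij:
  "bij_betw gCP_embed (gCP D) (fin_supp_on {t \<in> PT D. nroots t = 1} :: ('d ptree \<Rightarrow> 'k::field_char_0) set)"
proof (rule bij_betw_imageI)
  show "inj_on (gCP_embed :: _ \<Rightarrow> 'd ptree \<Rightarrow> 'k) (gCP D)" by (rule inj_onI) (rule gCP_embed_inj)
  show "gCP_embed ` gCP D = (fin_supp_on {t \<in> PT D. nroots t = 1} :: ('d ptree \<Rightarrow> 'k) set)"
  proof (intro equalityI subsetI)
    fix u :: "'d ptree \<Rightarrow> 'k" assume u: "u \<in> fin_supp_on {t \<in> PT D. nroots t = 1}"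
    let ?v = "\<lambda>T. u T / of_nat (sym_factor T)"
    have "finite {T. ?v T \<noteq> 0}" using u by (auto simp: fin_supp_on_def intro: finite_subset[of _ "{a. u a \<noteq> 0}"])
    hence l: "Poly_Mapping.lookup (Abs_poly_mapping ?v) = ?v" by simp
    have "Abs_poly_mapping ?v \<in> gCP D"
      using u by (auto simp: gCP_iff in_keys_iff l fin_supp_on_iff PT1_iff)
    moreover have "u = gCP_embed (Abs_poly_mapping ?v)"
    proof
      fix T :: "'d ptree"
      have "of_nat (sym_factor T) \<noteq> (0 :: 'k)" using sym_factor_pos[of T] by simp
      thus "u T = gCP_embed (Abs_poly_mapping ?v) T" by (simp add: gCP_embed_def l)
    qed
    ultimately show "u \<in> gCP_embed ` gCP D" by blast
  next
    fix u :: "'d ptree \<Rightarrow> 'k" assume "u \<in> gCP_embed ` gCP D"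
    then obtain x where x: "x \<in> gCP D" and u: "u = gCP_embed x" by blast
    show "u \<in> fin_supp_on {t \<in> PT D. nroots t = 1}" unfolding u by (rule gCP_embed_closed[OF x])
  qed
qed

text \<open>For basis trees this is \<open>graft_count_sym\<close>, with the three automorphism
  orders supplied by \<open>gCP_embed\<close>. The restriction to one root matters: at a tree with
  two roots the dual product also contains the product of the factors.\<close>

lemma gCP_embed_prod:
  assumes x: "x \<in> gCP D" and y: "y \<in> (gCP D :: ('d ptree \<Rightarrow>\<^sub>0 'k::field_char_0) set)" and t: "nroots t = 1"
  shows "gCP_embed (gCP_prod x y) t = dual_mult (gCP_embed x) (gCP_embed y) t"
proof -
  let ?H = "rep_ptree t"
  let ?lx = "Poly_Mapping.lookup x" and ?ly = "Poly_Mapping.lookup y"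
  let ?l = "\<lambda>a I. (if lower ?H I = a then of_nat (sym_factor a) else 0) :: 'k"
  let ?u = "\<lambda>a I. (if upper ?H I = a then of_nat (sym_factor a) else 0) :: 'k"
  have base: "of_nat (sym_factor t) * Poly_Mapping.lookup (\<Sum>(s, b)\<in>graft_sites (rep_ptree T).
      Poly_Mapping.single (ptree_class (graft (rep_ptree T) s b (rep_ptree T'))) 1) t
    = (\<Sum>I\<in>ideals ?H. ?l T I * ?u T' I)" if T: "T \<in> PT1 D" and T': "T' \<in> PT1 D" for T T'
  proof -
    obtain r0 where r0: "roots (rep_ptree T) = {r0}" using single_root T by (auto simp: PT1_iff)
    obtain r where r: "roots (rep_ptree T') = {r}" using single_root T' by (auto simp: PT1_iff)
    obtain \<rho> where \<rho>: "roots ?H = {\<rho>}" using single_root[OF t] by blast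
    \<comment> \<open>Counted in \<open>nat\<close>, as in \<open>graft_count_sym\<close>, and
      mapped to the field afterwards.\<close>
    let ?n = "\<Sum>(s, b)\<in>graft_sites (rep_ptree T). if ptree_class (graft (rep_ptree T) s b (rep_ptree T')) = t then 1 else 0 :: nat"
    have n: "sym_factor t * ?n = (\<Sum>I\<in>ideals ?H. (if lower ?H I = T then sym_factor T else 0) * (if upper ?H I = T' then sym_factor T' else 0))"
      using graft_count_sym[OF part_tree_rep part_tree_rep part_tree_rep r0 r \<rho>] unfolding ptree_class_rep .
    have "Poly_Mapping.lookup (\<Sum>(s, b)\<in>graft_sites (rep_ptree T).
      Poly_Mapping.single (ptree_class (graft (rep_ptree T) s b (rep_ptree T'))) 1) t = (of_nat ?n :: 'k)"
      by (simp add: lookup_sum case_prod_unfold lookup_single when_def of_nat_sum if_distrib cong: if_cong)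
    hence "of_nat (sym_factor t) * Poly_Mapping.lookup (\<Sum>(s, b)\<in>graft_sites (rep_ptree T).
      Poly_Mapping.single (ptree_class (graft (rep_ptree T) s b (rep_ptree T'))) 1) t = (of_nat (sym_factor t * ?n) :: 'k)"
      by simp
    also have "\<dots> = (\<Sum>I\<in>ideals ?H. ?l T I * ?u T' I)"
      unfolding n of_nat_sum of_nat_mult by (rule sum.cong) auto
    finally show ?thesis .
  qed
  \<comment> \<open>Each value of the embedding is written as a sum of indicators over all keys, so
    that the sums over keys and over ideals can be exchanged.\<close>
  have ex: "gCP_embed z a = (\<Sum>T\<in>Poly_Mapping.keys z. Poly_Mapping.lookup z T * (if a = T then of_nat (sym_factor T) else 0))"
    for z :: "'d ptree \<Rightarrow>\<^sub>0 'k" and a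
  proof -
    have "gCP_embed z a = (\<Sum>T\<in>Poly_Mapping.keys z. if a = T then Poly_Mapping.lookup z T * of_nat (sym_factor T) else 0)"
      by (simp add: gCP_embed_def in_keys_iff)
    also have "\<dots> = (\<Sum>T\<in>Poly_Mapping.keys z. Poly_Mapping.lookup z T * (if a = T then of_nat (sym_factor T) else 0))"
      by (rule sum.cong) auto
    finally show ?thesis .
  qed
  have "gCP_embed (gCP_prod x y) t = (\<Sum>a\<in>Poly_Mapping.keys x. \<Sum>b\<in>Poly_Mapping.keys y.
      ?lx a * ?ly b * (of_nat (sym_factor t) * Poly_Mapping.lookup (\<Sum>(s, b')\<in>graft_sites (rep_ptree a).
      Poly_Mapping.single (ptree_class (graft (rep_ptree a) s b' (rep_ptree b))) 1) t))"
    unfolding gCP_embed_def gCP_prod_basis bilin_ext_def lookup_sum[of _ "Poly_Mapping.keys x"]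
      lookup_sum[of _ "Poly_Mapping.keys y"] lookup_pscale sum_distrib_left
    by (simp add: mult_ac)
  also have "\<dots> = (\<Sum>a\<in>Poly_Mapping.keys x. \<Sum>b\<in>Poly_Mapping.keys y. \<Sum>I\<in>ideals ?H. (?lx a * ?l a I) * (?ly b * ?u b I))"
  proof (intro sum.cong refl)
    fix a b assume "a \<in> Poly_Mapping.keys x" "b \<in> Poly_Mapping.keys y"
    hence ab: "a \<in> PT1 D" "b \<in> PT1 D" using x y by (auto simp: gCP_iff)
    show "?lx a * ?ly b * (of_nat (sym_factor t) * Poly_Mapping.lookup (\<Sum>(s, b')\<in>graft_sites (rep_ptree a).
      Poly_Mapping.single (ptree_class (graft (rep_ptree a) s b' (rep_ptree b))) 1) t)
      = (\<Sum>I\<in>ideals ?H. (?lx a * ?l a I) * (?ly b * ?u b I))"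
      unfolding base[OF ab] sum_distrib_left by (rule sum.cong) (simp_all add: mult_ac)
  qed
  also have "\<dots> = (\<Sum>a\<in>Poly_Mapping.keys x. \<Sum>I\<in>ideals ?H. \<Sum>b\<in>Poly_Mapping.keys y. (?lx a * ?l a I) * (?ly b * ?u b I))"
    by (rule sum.cong[OF refl]) (rule sum.swap)
  also have "\<dots> = (\<Sum>I\<in>ideals ?H. \<Sum>a\<in>Poly_Mapping.keys x. \<Sum>b\<in>Poly_Mapping.keys y. (?lx a * ?l a I) * (?ly b * ?u b I))"
    by (rule sum.swap)
  also have "\<dots> = (\<Sum>I\<in>ideals ?H. gCP_embed x (lower ?H I) * gCP_embed y (upper ?H I))"
    unfolding ex sum_product ..
  also have "\<dots> = dual_mult (gCP_embed x) (gCP_embed y) t" by (simp add: dual_mult_rep)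
  finally show ?thesis .
qed

lemma gCP_embed_zero:
  assumes "x \<in> gCP D" "nroots t \<noteq> 1" shows "gCP_embed x t = (0 :: 'k::field)"
  using gCP_embed_closed[OF assms(1)] assms(2) by (auto simp: fin_supp_on_iff)

text \<open>This is the right-sidedness of the coproduct.\<close>

lemma dual_mult_cong_left:
  assumes t: "nroots t = 1" and fg: "\<And>a. nroots a \<le> 1 \<Longrightarrow> f a = g a"
  shows "dual_mult f h t = dual_mult g h t"
  unfolding dual_mult_rep
proof (rule sum.cong[OF refl])
  fix I assume "I \<in> ideals (rep_ptree t)"
  hence "nroots (lower (rep_ptree t) I) \<le> 1" using nroots_le(2)[OF part_tree_rep, of I t] t by simp
  thus "f (lower (rep_ptree t) I) * h (upper (rep_ptree t) I) = g (lower (rep_ptree t) I) * h (upper (rep_ptree t) I)"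
    by (simp add: fg)
qed

text \<open>At trees with one root \<open>gCP_embed_prod\<close> applies. Elsewhere the left side
  vanishes by the support of the embedding, and the right side by
  \<open>bracket_closed\<close>.\<close>

lemma gCP_embed_commutator:
  assumes x: "x \<in> gCP D" and y: "y \<in> (gCP D :: ('d ptree \<Rightarrow>\<^sub>0 'k::field_char_0) set)"
  shows "gCP_embed (commutator gCP_prod x y) = commutator dual_mult (gCP_embed x) (gCP_embed y)"
proof
  interpret E: enveloping_basis "PT D" "dual_mult :: ('d ptree \<Rightarrow> 'k) \<Rightarrow> _" empty_ptree nroots tmul
    by (rule enveloping_basis_PT)
  fix t
  show "gCP_embed (commutator gCP_prod x y) t = commutator dual_mult (gCP_embed x) (gCP_embed y) t"
  proof (cases "nroots t = 1")
    case True
    thus ?thesis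
      using gCP_embed_prod[OF x y] gCP_embed_prod[OF y x]
      by (simp add: commutator_def gCP_embed_diff fun_apply)
  next
    case False
    have "commutator dual_mult (gCP_embed x) (gCP_embed y) t = 0"
      using E.bracket_closed[OF gCP_embed_closed[OF x] gCP_embed_closed[OF y]] False by (auto simp: fin_supp_on_iff)
    moreover have "gCP_embed (commutator gCP_prod x y) t = 0"
      using gCP_embed_zero[OF gCP_prod_closed[OF x y] False] gCP_embed_zero[OF gCP_prod_closed[OF y x] False]
      by (simp add: commutator_def gCP_embed_diff fun_apply)
    ultimately show ?thesis by simp
  qed
qed

text \<open>The inner products differ on trees with two roots, but at a tree with one root a left
  factor is only evaluated at trees with at most one. At the empty tree both inner products vanish,
  the dual one by the counit.\<close>

lemma gCP_embed_prod_prod: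
  assumes x: "x \<in> gCP D" and y: "y \<in> gCP D" and z: "z \<in> (gCP D :: ('d ptree \<Rightarrow>\<^sub>0 'k::field_char_0) set)" and t: "nroots t = 1"
  shows "gCP_embed (gCP_prod (gCP_prod x y) z) t = dual_mult (dual_mult (gCP_embed x) (gCP_embed y)) (gCP_embed z) t"
  unfolding gCP_embed_prod[OF gCP_prod_closed[OF x y] z t]
proof (rule dual_mult_cong_left[OF t])
  interpret E: enveloping_basis "PT D" "dual_mult :: ('d ptree \<Rightarrow> 'k) \<Rightarrow> _" empty_ptree nroots tmul
    by (rule enveloping_basis_PT)
  fix a :: "'d ptree" assume a: "nroots a \<le> 1"
  show "gCP_embed (gCP_prod x y) a = dual_mult (gCP_embed x) (gCP_embed y) a"
  proof (cases "nroots a = 1")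
    case True
    thus ?thesis by (rule gCP_embed_prod[OF x y])
  next
    case False
    hence a0: "a = empty_ptree" using a nroots_eq_0[of a] by simp
    have n: "nroots a \<noteq> 1" by fact
    have "dual_counit (dual_mult (gCP_embed x) (gCP_embed y)) = dual_counit (gCP_embed x) * dual_counit (gCP_embed y)"
      using alg_hom_dual_counit[of D, where 'k='k] E.G_A[OF gCP_embed_closed[OF x]] E.G_A[OF gCP_embed_closed[OF y]]
      unfolding alg_hom_def by blast
    hence "dual_mult (gCP_embed x) (gCP_embed y) a = 0"
      using gCP_embed_zero[OF x n] by (simp add: dual_counit_apply a0)
    thus ?thesis using gCP_embed_zero[OF gCP_prod_closed[OF x y] n] by simp
  qed
qed

text \<open>In x(yz) the inner product is evaluated at trees with many roots, so it cannot be
  exchanged for the dual one. The difference with \<open>y\<close> and \<open>z\<close> swapped can: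
  it is x[y, z], and the bracket is the same in both algebras. What remains is the associativity of
  the dual product.\<close>

lemma gCP_right_prelie:
  assumes x: "x \<in> gCP D" and y: "y \<in> gCP D" and z: "z \<in> (gCP D :: ('d ptree \<Rightarrow>\<^sub>0 'k::field_char_0) set)"
  shows "gCP_prod (gCP_prod x y) z - gCP_prod x (gCP_prod y z) = gCP_prod (gCP_prod x z) y - gCP_prod x (gCP_prod z y)"
proof (rule gCP_embed_inj)
  interpret E: enveloping_basis "PT D" "dual_mult :: ('d ptree \<Rightarrow> 'k) \<Rightarrow> _" empty_ptree nroots tmul
    by (rule enveloping_basis_PT)
  let ?X = "gCP_embed x" and ?Y = "gCP_embed y" and ?Z = "gCP_embed z"
  note c = gCP_prod_closed
  show "gCP_embed (gCP_prod (gCP_prod x y) z - gCP_prod x (gCP_prod y z))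
    = gCP_embed (gCP_prod (gCP_prod x z) y - gCP_prod x (gCP_prod z y))"
  proof
    fix t
    show "gCP_embed (gCP_prod (gCP_prod x y) z - gCP_prod x (gCP_prod y z)) t
      = gCP_embed (gCP_prod (gCP_prod x z) y - gCP_prod x (gCP_prod z y)) t"
    proof (cases "nroots t = 1")
      case True
      have A: "?X \<in> E.A" "?Y \<in> E.A" "?Z \<in> E.A" using gCP_embed_closed x y z E.G_A by blast+
      have "commutator gCP_prod y z \<in> gCP D"
        unfolding commutator_def by (intro ps.subspace_diff[OF subspace_gCP] c y z)
      hence "gCP_embed (gCP_prod x (commutator gCP_prod y z)) t = dual_mult ?X (commutator dual_mult ?Y ?Z) t"
        unfolding gCP_embed_commutator[OF y z, symmetric] by (rule gCP_embed_prod[OF x _ True])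
      also have "\<dots> = dual_mult (dual_mult ?X ?Y) ?Z t - dual_mult (dual_mult ?X ?Z) ?Y t"
        using A by (simp add: commutator_def E.mul_diff_right E.mul_closed dual_mult_assoc fun_apply)
      also have "\<dots> = gCP_embed (gCP_prod (gCP_prod x y) z) t - gCP_embed (gCP_prod (gCP_prod x z) y) t"
        using gCP_embed_prod_prod[OF x y z True] gCP_embed_prod_prod[OF x z y True] by simp
      finally have eq: "gCP_embed (gCP_prod x (commutator gCP_prod y z)) t
        = gCP_embed (gCP_prod (gCP_prod x y) z) t - gCP_embed (gCP_prod (gCP_prod x z) y) t" .
      have "gCP_prod x (gCP_prod y z) = gCP_prod x (commutator gCP_prod y z) + gCP_prod x (gCP_prod z y)"
        unfolding gCP_prod_basis commutator_def bilin_ext_add_right[symmetric] by simp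
      thus ?thesis using eq by (simp add: gCP_embed_diff gCP_embed_add fun_apply)
    next
      case False
      have zero: "gCP_embed w t = 0" if "w \<in> gCP D" for w :: "'d ptree \<Rightarrow>\<^sub>0 'k"
        by (rule gCP_embed_zero[OF that False])
      show ?thesis
        unfolding gCP_embed_diff fun_apply
        by (simp add: zero[OF c[OF c[OF x y] z]] zero[OF c[OF x c[OF y z]]]
            zero[OF c[OF c[OF x z] y]] zero[OF c[OF x c[OF z y]]])
    qed
  qed
qed

lemma prelie_algebra_gCP: "prelie_algebra pscale (gCP D :: ('d ptree \<Rightarrow>\<^sub>0 'k::field_char_0) set) gCP_prod"
proof unfold_locales
  show "ps.subspace (gCP D)" by (rule subspace_gCP)
  show "gCP_prod x y \<in> gCP D" if "x \<in> gCP D" "y \<in> gCP D" for x y :: "'d ptree \<Rightarrow>\<^sub>0 'k"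
    by (rule gCP_prod_closed[OF that])
  show "linear_on (gCP D) pscale pscale (\<lambda>x. gCP_prod x y)" for y :: "'d ptree \<Rightarrow>\<^sub>0 'k"
    unfolding gCP_prod_basis linear_on_def by (simp add: bilin_ext_add_left bilin_ext_scale_left)
  show "linear_on (gCP D) pscale pscale (gCP_prod x)" for x :: "'d ptree \<Rightarrow>\<^sub>0 'k"
    unfolding gCP_prod_basis linear_on_def by (simp add: bilin_ext_add_right bilin_ext_scale_right)
qed (rule gCP_right_prelie)

text \<open>A product of two nonempty trees has at least two roots, where the embedding vanishes;
  the remaining pairs contain the empty tree and give the two tensor terms.\<close>

lemma gCP_embed_primitive:
  assumes x: "x \<in> (gCP D :: ('d ptree \<Rightarrow>\<^sub>0 'k::field_char_0) set)"
  shows "dual_comult (gCP_embed x) = tens (gCP_embed x) dual_unit + tens dual_unit (gCP_embed x)"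
proof
  fix p :: "'d ptree \<times> 'd ptree"
  obtain T T' where p: "p = (T, T')" by (cases p)
  let ?e = "empty_ptree :: 'd ptree"
  have e: "gCP_embed x ?e = 0" by (rule gCP_embed_zero[OF x]) simp
  consider "T = ?e" | "T' = ?e" | "T \<noteq> ?e" "T' \<noteq> ?e" by blast
  thus "dual_comult (gCP_embed x) p = (tens (gCP_embed x) dual_unit + tens dual_unit (gCP_embed x)) p"
  proof cases
    case 1
    thus ?thesis by (simp add: p dual_comult_apply fun_apply tens_def dual_unit_eq delta_def tmul_empty_left e)
  next
    case 2
    thus ?thesis by (simp add: p dual_comult_apply fun_apply tens_def dual_unit_eq delta_def tmul_empty_right e)
  next
    case 3
    hence "nroots (tmul T T') \<noteq> 1"
      using nroots_eq_0[of T] nroots_eq_0[of T'] by (simp add: nroots_tmul)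
    thus ?thesis using 3 gCP_embed_zero[OF x] by (simp add: p dual_comult_apply fun_apply tens_def dual_unit_eq delta_def)
  qed
qed

lemma enveloping_hopf_algebra_gCP:
  "enveloping_hopf_algebra TYPE('b::ab_group_add) pscale (gCP D :: ('d ptree \<Rightarrow>\<^sub>0 'k::field_char_0) set) (commutator gCP_prod)
     (PT D) dual_mult dual_unit dual_comult dual_counit gCP_embed"
  unfolding enveloping_hopf_algebra_def
proof (intro conjI ballI)
  interpret E: enveloping_basis "PT D" "dual_mult :: ('d ptree \<Rightarrow> 'k) \<Rightarrow> _" empty_ptree nroots tmul
    by (rule enveloping_basis_PT)
  show "enveloping_algebra TYPE('b) pscale (gCP D :: ('d ptree \<Rightarrow>\<^sub>0 'k::field_char_0) set) (commutator gCP_prod)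
      fscale (fin_supp_on (PT D)) dual_mult dual_unit gCP_embed"
    unfolding dual_unit_eq
  proof (rule E.enveloping_algebra_transport[OF gCP_embed_linear gCP_embed_bij])
    fix x y :: "'d ptree \<Rightarrow>\<^sub>0 'k" assume xy: "x \<in> gCP D" "y \<in> gCP D"
    show "x + y \<in> gCP D" by (rule ps.subspace_add[OF subspace_gCP xy])
    have "commutator gCP_prod x y \<in> gCP D"
      unfolding commutator_def by (intro ps.subspace_diff[OF subspace_gCP] gCP_prod_closed xy)
    thus "commutator gCP_prod x y \<in> gCP D \<and>
        gCP_embed (commutator gCP_prod x y) = commutator dual_mult (gCP_embed x) (gCP_embed y)"
      using gCP_embed_commutator[OF xy] by simp
  next
    fix c and x :: "'d ptree \<Rightarrow>\<^sub>0 'k" assume "x \<in> gCP D"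
    thus "pscale c x \<in> gCP D" by (rule ps.subspace_scale[OF subspace_gCP])
  qed
  show "dual_counit (gCP_embed x) = 0" if "x \<in> gCP D" for x :: "'d ptree \<Rightarrow>\<^sub>0 'k"
    unfolding dual_counit_apply by (rule gCP_embed_zero[OF that]) simp
qed (rule alg_hom_dual_comult alg_hom_dual_counit gCP_embed_primitive; assumption?)+

theorem theorem4p11:
  fixes D :: "'d set"
  shows "prelie_algebra pscale (gCP D :: ('d ptree \<Rightarrow>\<^sub>0 'k::field_char_0) set) gCP_prod
    \<and> enveloping_hopf_algebra TYPE('b::ab_group_add)
        pscale (gCP D :: ('d ptree \<Rightarrow>\<^sub>0 'k) set) (commutator gCP_prod)
        (PT D) dual_mult dual_unit dual_comult dual_counit gCP_embed
    \<and> (\<forall>x\<in>(gCP D :: ('d ptree \<Rightarrow>\<^sub>0 'k) set). \<forall>y\<in>gCP D. \<forall>T\<in>PT1 D.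
        gCP_embed (gCP_prod x y) T = dual_mult (gCP_embed x) (gCP_embed y) T)"
  by (intro conjI ballI prelie_algebra_gCP enveloping_hopf_algebra_gCP gCP_embed_prod)
    (simp_all add: PT1_iff)

end
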